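(* Let $F$ be an $(M_\infty)$-space and let $E$ be a Banach space. If $n=cd(E)$ and there exists a bounded net of compact operators $\{K_\alpha\}_\alpha\subset\mathcal K(E)$ satisfying both conditions: (1) $K_\alpha^*(x^* )\to x^*$ for all $x^*\in E^*$; (2) for all $\varepsilon>0$ and all $\alpha_0$ there exists $\alpha>\alpha_0$ such that for every $x\in E$, $\|K_\alpha(x)\|^n+\|x-K_\alpha(x)\|^n\le(1+\varepsilon)\|x\|^n$; then $\mathcal P_w(^nE,F)$ is an $M$-ideal in $\mathcal P(^nE,F)$.
   Context: $\mathcal P(^nE,F)$ is the Banach space of continuous $n$-homogeneous polynomials $P:E\to F$ with norm $\|P\|=\sup_{\|x\|\le1}\|P(x)\|$. $\mathcal P_w(^nE,F)$ is the subspace of polynomials that are weakly continuous on bounded sets: $\|P(x_\alpha)-P(x)\|\to0$ for every bounded net $(x_\alpha)$ converging weakly to $x\in E$. The critical degree $cd(E)$ is the smallest $k\ge1$ such that $\mathcal P_w(^kE,\mathbb K)\ne\mathcal P(^kE,\mathbb K)$ (the hypothesis $n=cd(E)$ includes that it exists). $\mathcal K(X)$ and $\mathcal L(X)$ denote the compact and the bounded linear operators on $X$. A closed subspace $J$ of a Banach space $X$ is an $M$-ideal if there is a linear projection $\pi$ on $X^*$ with kernel $J^\perp$ such that $\|x^*\|=\|\pi(x^* )\|+\|x^*-\pi(x^* )\|$ for all $x^*\in X^*$. A Banach space $F$ is an $(M_\infty)$-space if $\mathcal K(F\oplus_\infty F)$ is an $M$-ideal in $\mathcal L(F\oplus_\infty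 F)$, where $\oplus_\infty$ is the direct sum with maximum norm. *)

theory Defs
  imports "HOL-Analysis.Analysis" "HOL-Library.Function_Algebras"
begin

section \<open>Scalars and normed spaces\<close>

text \<open>The scalar field is \<open>\<real>\<close> or \<open>\<complex>\<close>, up to an isometric isomorphism.\<close>

class real_or_complex = real_normed_field +
  assumes isometric_real_or_complex:
    "\<exists>h :: 'a \<Rightarrow> complex. (\<forall>x y. h (x + y) = h x + h y) \<and> (\<forall>x y. h (x * y) = h x * h y)
       \<and> (\<forall>r x. h (r *\<^sub>R x) = r *\<^sub>R h x) \<and> (\<forall>x. norm (h x) = norm x)
       \<and> (range h = \<real> \<or> range h = UNIV)"

instance real :: real_or_complex
  by standard (rule exI[of _ complex_of_real], auto simp: Reals_def scaleR_conv_of_real)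

instance complex :: real_or_complex
  by standard (rule exI[of _ "\<lambda>x. x"], auto simp: distrib_left)

text \<open>The library has no class of complex Banach spaces. A normed space over \<open>'k\<close> is a real
  normed space (a type) with a compatible multiplication by scalars from \<open>'k\<close>.
  For \<open>'k = real\<close> this forces \<open>scale = scaleR\<close>. A Banach space over \<open>'k\<close> is such a
  structure on a type of class \<open>banach\<close>.\<close>

locale normed_space_over = vector_space scale
  for scale :: "'k::real_or_complex \<Rightarrow> 'e::real_normed_vector \<Rightarrow> 'e" +
  assumes scale_of_real: "scale (of_real r) x = r *\<^sub>R x"
    and norm_scale: "norm (scale a x) = norm a * norm x"

text \<open>The spaces of operators, polynomials and functionals are sets of functions with pointwise
  addition.\<close>

definition fun_scale :: "('k \<Rightarrow> 'f \<Rightarrow> 'f) \<Rightarrow> 'k \<Rightarrow> ('e \<Rightarrow> 'f) \<Rightarrow> 'e \<Rightarrow> 'f" where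
  "fun_scale s a T = (\<lambda>x. s a (T x))"


section \<open>Duals and M-ideals\<close>

text \<open>A normed space is given here by a carrier \<open>X\<close> in an additive group, a scalar multiplication
  \<open>s\<close> and a norm \<open>N\<close>. Functionals are set to \<open>0\<close> off the carrier, so that equality of
  functionals on \<open>X\<close> is equality of functions.\<close>

definition dual_space ::
  "('k::real_or_complex \<Rightarrow> 'v::ab_group_add \<Rightarrow> 'v) \<Rightarrow> ('v \<Rightarrow> real) \<Rightarrow> 'v set \<Rightarrow> ('v \<Rightarrow> 'k) set" where
  "dual_space s N X = {\<phi>. (\<forall>x\<in>X. \<forall>y\<in>X. \<phi> (x + y) = \<phi> x + \<phi> y)
     \<and> (\<forall>a. \<forall>x\<in>X. \<phi> (s a x) = a * \<phi> x)
     \<and> (\<exists>C. \<forall>x\<in>X. norm (\<phi> x) \<le> C * N x)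
     \<and> (\<forall>x. x \<notin> X \<longrightarrow> \<phi> x = 0)}"

definition dual_norm :: "('v \<Rightarrow> real) \<Rightarrow> 'v set \<Rightarrow> ('v \<Rightarrow> 'k::real_or_complex) \<Rightarrow> real" where
  "dual_norm N X \<phi> = (SUP x\<in>{x\<in>X. N x \<le> 1}. norm (\<phi> x))"

definition annihilator ::
  "('k::real_or_complex \<Rightarrow> 'v::ab_group_add \<Rightarrow> 'v) \<Rightarrow> ('v \<Rightarrow> real) \<Rightarrow> 'v set \<Rightarrow> 'v set \<Rightarrow> ('v \<Rightarrow> 'k) set" where
  "annihilator s N X J = {\<phi> \<in> dual_space s N X. \<forall>x\<in>J. \<phi> x = 0}"

definition closed_subspace ::
  "('k::real_or_complex \<Rightarrow> 'v::ab_group_add \<Rightarrow> 'v) \<Rightarrow> ('v \<Rightarrow> real) \<Rightarrow> 'v set \<Rightarrow> 'v set \<Rightarrow> bool" where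
  "closed_subspace s N J X \<longleftrightarrow> J \<subseteq> X \<and> module.subspace s J
     \<and> (\<forall>x\<in>X. (\<forall>e>0. \<exists>y\<in>J. N (x - y) < e) \<longrightarrow> x \<in> J)"

definition linear_projection_on ::
  "('v \<Rightarrow> 'k::real_or_complex) set \<Rightarrow> (('v \<Rightarrow> 'k) \<Rightarrow> ('v \<Rightarrow> 'k)) \<Rightarrow> bool" where
  "linear_projection_on D \<pi> \<longleftrightarrow> (\<forall>\<phi>\<in>D. \<pi> \<phi> \<in> D \<and> \<pi> (\<pi> \<phi>) = \<pi> \<phi>)
     \<and> (\<forall>\<phi>\<in>D. \<forall>\<psi>\<in>D. \<pi> (\<phi> + \<psi>) = \<pi> \<phi> + \<pi> \<psi>)
     \<and> (\<forall>a. \<forall>\<phi>\<in>D. \<pi> (fun_scale (*) a \<phi>) = fun_scale (*) a (\<pi> \<phi>))"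

definition M_ideal ::
  "('k::real_or_complex \<Rightarrow> 'v::ab_group_add \<Rightarrow> 'v) \<Rightarrow> ('v \<Rightarrow> real) \<Rightarrow> 'v set \<Rightarrow> 'v set \<Rightarrow> bool" where
  "M_ideal s N J X \<longleftrightarrow> closed_subspace s N J X
     \<and> (\<exists>\<pi>. linear_projection_on (dual_space s N X) \<pi>
          \<and> {\<phi> \<in> dual_space s N X. \<pi> \<phi> = 0} = annihilator s N X J
          \<and> (\<forall>\<phi> \<in> dual_space s N X.
                dual_norm N X \<phi> = dual_norm N X (\<pi> \<phi>) + dual_norm N X (\<phi> - \<pi> \<phi>)))"


section \<open>Operators and \<open>(M\<^sub>\<infinity>)\<close>-spaces\<close>

definition bounded_ops ::
  "('k::real_or_complex \<Rightarrow> 'e::real_normed_vector \<Rightarrow> 'e) \<Rightarrow> ('e \<Rightarrow> 'e) set" where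
  "bounded_ops s = {T. Vector_Spaces.linear s s T \<and> bounded_linear T}"

definition compact_ops ::
  "('k::real_or_complex \<Rightarrow> 'e::real_normed_vector \<Rightarrow> 'e) \<Rightarrow> ('e \<Rightarrow> 'e) set" where
  "compact_ops s = {T \<in> bounded_ops s. \<forall>B. bounded B \<longrightarrow> compact (closure (T ` B))}"

definition op_norm :: "('e \<Rightarrow> real) \<Rightarrow> ('e \<Rightarrow> 'e) \<Rightarrow> real" where
  "op_norm N T = (SUP x\<in>{x. N x \<le> 1}. N (T x))"

definition prod_scale :: "('k \<Rightarrow> 'f \<Rightarrow> 'f) \<Rightarrow> 'k \<Rightarrow> 'f \<times> 'f \<Rightarrow> 'f \<times> 'f" where
  "prod_scale s a p = (s a (fst p), s a (snd p))"

definition max_norm :: "'f::real_normed_vector \<times> 'f \<Rightarrow> real" where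
  "max_norm p = max (norm (fst p)) (norm (snd p))"

text \<open>The library norm of \<open>'f \<times> 'f\<close> is the Euclidean one. It is equivalent to the maximum norm, so
  both norms have the same bounded and the same compact operators, but the operator norm has to be
  taken with respect to \<open>max_norm\<close>.\<close>

lemma max_norm_equivalent: "max_norm p \<le> norm p" "norm p \<le> 2 * max_norm p"
proof -
  have "norm (fst p) \<le> norm p" "norm (snd p) \<le> norm p"
    by (metis norm_fst_le prod.collapse, metis norm_snd_le prod.collapse)
  then show "max_norm p \<le> norm p"
    by (simp add: max_norm_def)
  have "norm p \<le> norm (fst p) + norm (snd p)"
    by (simp add: norm_prod_def sqrt_sum_squares_le_sum)
  then show "norm p \<le> 2 * max_norm p"
    by (simp add: max_norm_def)
qed

definition M_infty_space :: "('k::real_or_complex \<Rightarrow> 'f::real_normed_vector \<Rightarrow> 'f) \<Rightarrow> bool" where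
  "M_infty_space s \<longleftrightarrow>
     M_ideal (fun_scale (prod_scale s)) (op_norm max_norm)
       (compact_ops (prod_scale s)) (bounded_ops (prod_scale s))"


section \<open>Nets and weak continuity on bounded sets\<close>

definition directed_set :: "'i set \<Rightarrow> ('i \<Rightarrow> 'i \<Rightarrow> bool) \<Rightarrow> bool" where
  "directed_set I le \<longleftrightarrow> I \<noteq> {} \<and> reflp_on I le \<and> transp_on I le
     \<and> (\<forall>i\<in>I. \<forall>j\<in>I. \<exists>k\<in>I. le i k \<and> le j k)"

definition net_filter :: "'i set \<Rightarrow> ('i \<Rightarrow> 'i \<Rightarrow> bool) \<Rightarrow> 'i filter" where
  "net_filter I le = (INF i\<in>I. principal {j\<in>I. le i j})"

lemma eventually_net_filter:
  assumes "directed_set I le"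
  shows "eventually P (net_filter I le) \<longleftrightarrow> (\<exists>i\<in>I. \<forall>j\<in>I. le i j \<longrightarrow> P j)"
proof -
  have "eventually P (net_filter I le) \<longleftrightarrow> (\<exists>i\<in>I. eventually P (principal {j\<in>I. le i j}))"
    unfolding net_filter_def
  proof (rule eventually_INF_base)
    show "I \<noteq> {}" using assms by (simp add: directed_set_def)
    fix i j assume ij: "i \<in> I" "j \<in> I"
    then obtain k where k: "k \<in> I" "le i k" "le j k"
      using assms unfolding directed_set_def by blast
    have "transp_on I le" using assms by (simp add: directed_set_def)
    then have "{l\<in>I. le k l} \<subseteq> {l\<in>I. le i l} \<inter> {l\<in>I. le j l}"
      using ij k by (auto dest: transp_onD)
    then show "\<exists>x\<in>I. principal {l\<in>I. le x l}
        \<le> inf (principal {l\<in>I. le i l}) (principal {l\<in>I. le j l})"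
      using k(1) by (auto simp: inf_principal)
  qed
  then show ?thesis by (auto simp: eventually_principal)
qed

text \<open>Nets in \<open>E\<close> are represented by their filters of tails, because one cannot quantify over the
  index type of a net inside a definition. The lemmas below show that this is the same as
  quantifying over nets.\<close>

definition weakly_continuous_on_bounded ::
  "('k::real_or_complex \<Rightarrow> 'e::real_normed_vector \<Rightarrow> 'e) \<Rightarrow> ('e \<Rightarrow> 'f::real_normed_vector) \<Rightarrow> bool" where
  "weakly_continuous_on_bounded s P \<longleftrightarrow>
     (\<forall>(\<F> :: 'e filter) x. (\<exists>C. \<forall>\<^sub>F y in \<F>. norm y \<le> C)
        \<longrightarrow> (\<forall>\<phi> \<in> dual_space s norm UNIV. (\<phi> \<longlongrightarrow> \<phi> x) \<F>)
        \<longrightarrow> ((\<lambda>y. norm (P y - P x)) \<longlongrightarrow> 0) \<F>)"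

lemma weakly_continuous_on_bounded_net:
  assumes P: "weakly_continuous_on_bounded s P"
    and I: "directed_set I le"
    and bd: "\<exists>C. \<forall>\<alpha>\<in>I. norm (x \<alpha>) \<le> C"
    and w: "\<forall>\<phi> \<in> dual_space s norm UNIV. ((\<lambda>\<alpha>. \<phi> (x \<alpha>)) \<longlongrightarrow> \<phi> l) (net_filter I le)"
  shows "((\<lambda>\<alpha>. norm (P (x \<alpha>) - P l)) \<longlongrightarrow> 0) (net_filter I le)"
proof -
  obtain C where C: "\<forall>\<alpha>\<in>I. norm (x \<alpha>) \<le> C" using bd by blast
  have ne: "I \<noteq> {}" using I by (simp add: directed_set_def)
  let ?F = "filtermap x (net_filter I le)"
  have "\<forall>\<^sub>F y in ?F. norm y \<le> C"
    using C ne by (auto simp: eventually_filtermap eventually_net_filter[OF I])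
  moreover have "\<forall>\<phi> \<in> dual_space s norm UNIV. (\<phi> \<longlongrightarrow> \<phi> l) ?F"
    using w by (auto simp: filterlim_filtermap)
  ultimately have "((\<lambda>y. norm (P y - P l)) \<longlongrightarrow> 0) ?F"
    using P unfolding weakly_continuous_on_bounded_def by blast
  then show ?thesis by (simp add: filterlim_filtermap)
qed

lemma weakly_continuous_on_bounded_iff_net:
  fixes s :: "'k::real_or_complex \<Rightarrow> 'e::real_normed_vector \<Rightarrow> 'e"
    and P :: "'e \<Rightarrow> 'f::real_normed_vector"
  shows "weakly_continuous_on_bounded s P \<longleftrightarrow>
    (\<forall>(I :: ('e set \<times> 'e) set) le x l. directed_set I le \<longrightarrow> (\<exists>C. \<forall>\<alpha>\<in>I. norm (x \<alpha>) \<le> C)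
       \<longrightarrow> (\<forall>\<phi> \<in> dual_space s norm UNIV. ((\<lambda>\<alpha>. \<phi> (x \<alpha>)) \<longlongrightarrow> \<phi> l) (net_filter I le))
       \<longrightarrow> ((\<lambda>\<alpha>. norm (P (x \<alpha>) - P l)) \<longlongrightarrow> 0) (net_filter I le))" (is "_ \<longleftrightarrow> ?R")
proof
  assume "weakly_continuous_on_bounded s P"
  then show ?R by (intro allI impI) (rule weakly_continuous_on_bounded_net)
next
  assume R: ?R
  show "weakly_continuous_on_bounded s P"
    unfolding weakly_continuous_on_bounded_def
  proof (intro allI impI)
    fix \<F> :: "'e filter" and l
    assume "\<exists>C. \<forall>\<^sub>F y in \<F>. norm y \<le> C"
      and w: "\<forall>\<phi> \<in> dual_space s norm UNIV. (\<phi> \<longlongrightarrow> \<phi> l) \<F>"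
    then obtain C where C: "\<forall>\<^sub>F y in \<F>. norm y \<le> C" by blast
    show "((\<lambda>y. norm (P y - P l)) \<longlongrightarrow> 0) \<F>"
    proof (cases "\<F> = bot")
      case False
      define I where "I = {(A, a). (\<forall>\<^sub>F y in \<F>. y \<in> A) \<and> A \<subseteq> cball 0 C \<and> a \<in> A}"
      define le :: "'e set \<times> 'e \<Rightarrow> 'e set \<times> 'e \<Rightarrow> bool" where "le p q \<longleftrightarrow> fst q \<subseteq> fst p" for p q
      have pt: "\<exists>a. (A, a) \<in> I" if "\<forall>\<^sub>F y in \<F>. y \<in> A" "A \<subseteq> cball 0 C" for A
        using that False eventually_happens'[of \<F> "\<lambda>y. y \<in> A"] by (auto simp: I_def)
      have Cb: "\<forall>\<^sub>F y in \<F>. y \<in> cball 0 C" using C by simp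
      have dir: "directed_set I le"
        unfolding directed_set_def
      proof (intro conjI ballI)
        show "I \<noteq> {}" using pt[OF Cb] by auto
        show "reflp_on I le" "transp_on I le"
          by (auto simp: le_def reflp_on_def transp_on_def)
        fix p q assume "p \<in> I" "q \<in> I"
        then have "\<forall>\<^sub>F y in \<F>. y \<in> fst p \<inter> fst q" "fst p \<inter> fst q \<subseteq> cball 0 C"
          by (auto simp: I_def eventually_conj_iff)
        from pt[OF this] obtain a where "(fst p \<inter> fst q, a) \<in> I" by blast
        then show "\<exists>k\<in>I. le p k \<and> le q k"
          by (intro bexI[of _ "(fst p \<inter> fst q, a)"]) (auto simp: le_def)
      qed
      have "eventually Q (filtermap snd (net_filter I le)) \<longleftrightarrow> eventually Q \<F>" for Q
      proof
        assume "eventually Q (filtermap snd (net_filter I le))"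
        then obtain A a where Aa: "(A, a) \<in> I" "\<forall>j\<in>I. le (A, a) j \<longrightarrow> Q (snd j)"
          by (auto simp: eventually_filtermap eventually_net_filter[OF dir])
        have "Q b" if "b \<in> A" for b
          using Aa(2)[rule_format, of "(A, b)"] Aa(1) that by (auto simp: I_def le_def)
        then show "eventually Q \<F>"
          using Aa(1) by (auto simp: I_def elim: eventually_mono)
      next
        assume Q: "eventually Q \<F>"
        have "\<forall>\<^sub>F y in \<F>. y \<in> {y \<in> cball 0 C. Q y}"
          using eventually_conj[OF Q Cb] by (auto elim: eventually_mono)
        then obtain a where "({y \<in> cball 0 C. Q y}, a) \<in> I" using pt by blast
        then show "eventually Q (filtermap snd (net_filter I le))"
          unfolding eventually_filtermap eventually_net_filter[OF dir]
          by (rule rev_bexI) (auto simp: le_def I_def)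
      qed
      then have F: "filtermap snd (net_filter I le) = \<F>" by (simp add: filter_eq_iff)
      have "\<exists>C. \<forall>\<alpha>\<in>I. norm (snd \<alpha>) \<le> C"
        by (rule exI[of _ C]) (auto simp: I_def)
      moreover have "\<forall>\<phi> \<in> dual_space s norm UNIV. ((\<lambda>\<alpha>. \<phi> (snd \<alpha>)) \<longlongrightarrow> \<phi> l) (net_filter I le)"
        using w by (auto simp: F[symmetric] filterlim_filtermap)
      ultimately have "((\<lambda>\<alpha>. norm (P (snd \<alpha>) - P l)) \<longlongrightarrow> 0) (net_filter I le)"
        using R dir by blast
      then show ?thesis by (simp add: F[symmetric] filterlim_filtermap)
    qed simp
  qed
qed


section \<open>Homogeneous polynomials and the critical degree\<close>

definition multilinear ::
  "('k::real_or_complex \<Rightarrow> 'e::real_normed_vector \<Rightarrow> 'e) \<Rightarrow> ('k \<Rightarrow> 'f::real_normed_vector \<Rightarrow> 'f) \<Rightarrow>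
   nat \<Rightarrow> ('e list \<Rightarrow> 'f) \<Rightarrow> bool" where
  "multilinear sE sF n A \<longleftrightarrow>
     (\<forall>xs i. length xs = n \<longrightarrow> i < n \<longrightarrow> Vector_Spaces.linear sE sF (\<lambda>x. A (xs[i := x])))"

definition hom_polys ::
  "('k::real_or_complex \<Rightarrow> 'e::real_normed_vector \<Rightarrow> 'e) \<Rightarrow> ('k \<Rightarrow> 'f::real_normed_vector \<Rightarrow> 'f) \<Rightarrow>
   nat \<Rightarrow> ('e \<Rightarrow> 'f) set" where
  "hom_polys sE sF n =
     {P. (\<exists>A. multilinear sE sF n A \<and> (\<forall>x. P x = A (replicate n x))) \<and> continuous_on UNIV P}"

definition weak_hom_polys ::
  "('k::real_or_complex \<Rightarrow> 'e::real_normed_vector \<Rightarrow> 'e) \<Rightarrow> ('k \<Rightarrow> 'f::real_normed_vector \<Rightarrow> 'f) \<Rightarrow>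
   nat \<Rightarrow> ('e \<Rightarrow> 'f) set" where
  "weak_hom_polys sE sF n = {P \<in> hom_polys sE sF n. weakly_continuous_on_bounded sE P}"

definition poly_norm :: "('e::real_normed_vector \<Rightarrow> 'f::real_normed_vector) \<Rightarrow> real" where
  "poly_norm P = (SUP x\<in>cball 0 1. norm (P x))"

text \<open>\<open>is_critical_degree sE n\<close> states that \<open>cd(E)\<close> exists and equals \<open>n\<close>.\<close>

definition is_critical_degree ::
  "('k::real_or_complex \<Rightarrow> 'e::real_normed_vector \<Rightarrow> 'e) \<Rightarrow> nat \<Rightarrow> bool" where
  "is_critical_degree sE n \<longleftrightarrow>
     1 \<le> n \<and> weak_hom_polys sE (*) n \<noteq> hom_polys sE (*) n
     \<and> (\<forall>k. 1 \<le> k \<and> k < n \<longrightarrow> weak_hom_polys sE (*) k = hom_polys sE (*) k)"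

end

theory Submission
  imports Defs
begin

text \<open>The projection \<open>\<pi>\<close> is obtained as a limit, along an ultrafilter, of adjoints of operators from
  \<open>\<P>(\<^sup>nE,F)\<close> to \<open>\<P>\<^sub>w(\<^sup>nE,F)\<close>. Let \<open>K = K\<^sub>\<alpha>\<close> be as in the hypothesis. The \<open>(M\<^sub>\<infinity>)\<close>-property, applied
  through the Hahn-Banach theorem, yields compact \<open>S\<close> on \<open>F\<close> that are close to the identity on finite
  sets and satisfy \<open>\<parallel>S x + (y - S y)\<parallel> \<le> (1 + \<epsilon>) max \<parallel>x\<parallel> \<parallel>y\<parallel>\<close>. Since \<open>n = cd(E)\<close>, the polynomial
  \<open>\<Phi> Q = S \<circ> (Q - Q \<circ> (I - K))\<close> is weakly continuous on bounded sets, and the assumption on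
  \<open>\<parallel>K x\<parallel>\<^sup>n + \<parallel>x - K x\<parallel>\<^sup>n\<close> gives \<open>\<parallel>P + Q - \<Phi> Q\<parallel> \<le> 1 + \<epsilon>\<close> for \<open>P\<close> in the unit ball of
  \<open>\<P>\<^sub>w(\<^sup>nE,F)\<close> and \<open>Q\<close> in that of \<open>\<P>(\<^sup>nE,F)\<close>. Dualizing this estimate gives the norm identity for
  \<open>\<pi>\<close>. The approximation \<open>P \<circ> K \<rightarrow> P\<close> on \<open>\<P>\<^sub>w(\<^sup>nE,F)\<close> rests on the fact that a polynomial which is
  weakly continuous on bounded sets is weakly uniformly continuous there.\<close>


section \<open>Scalars\<close>

text \<open>The critical degree controls scalar polynomials only. After composition with a
  functional on \<open>F\<close>, the polynomial \<open>Q x - Q (x - a)\<close> with fixed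
  \<open>a\<close> has degree less than \<open>n\<close> and is weakly continuous on bounded sets;
  for the \<open>F\<close>-valued map this gives only weak convergence of the values. The compact
  \<open>S\<close> turns weak into norm convergence. It leaves the defect \<open>I - S\<close>,
  which the inequality from the \<open>(M\<^sub>\<infinity>)\<close>-property absorbs. For the
  operators \<open>\<Phi>\<close> only a uniform bound is established. The limit of their adjoints
  yields one half of the norm identity, but not that the norm of the limit is at most the norm of
  the functional on the subspace. The second approximation \<open>Q \<mapsto> Q \<circ> K\<close>
  has norms with upper limit at most 1 and supplies this half; the two limits are then shown to
  agree. The inequality on \<open>K\<close> is available only at cofinally many indices, which
  depend on the precision. The operators are therefore reindexed by triples of an index of the net,
  a precision and a finite subset of \<open>F\<close>.\<close>

text \<open>Treats both scalar fields at once: \<open>i\<close> is the imaginary unit, or 0 if the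
  field is real, and \<open>re\<close> is the real part. A scalar is recovered from the two real
  numbers \<open>re a\<close> and \<open>re (i * a)\<close>; the last clause is the equality case of
  the bound on \<open>re\<close>.\<close>

lemma scalar_structure:
  "\<exists>(i::'k::real_or_complex) re. (i = 0 \<or> i * i = - 1) \<and> norm i \<le> 1 \<and> re i = 0
     \<and> (\<forall>a b. re (a + b) = re a + re b) \<and> (\<forall>r a. re (r *\<^sub>R a) = r * re a)
     \<and> (\<forall>a. a = of_real (re a) - i * of_real (re (i * a))) \<and> re 1 = (1::real)
     \<and> (\<forall>a. \<bar>re a\<bar> \<le> norm a) \<and> (\<forall>a. re a = norm a \<longrightarrow> a = of_real (norm a))"
proof -
  obtain h :: "'k \<Rightarrow> complex" where add: "\<And>x y. h (x + y) = h x + h y"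
    and mult: "\<And>x y. h (x * y) = h x * h y" and scaleR: "\<And>r x. h (r *\<^sub>R x) = r *\<^sub>R h x"
    and norm: "\<And>x. norm (h x) = norm x" and ran: "range h = \<real> \<or> range h = UNIV"
    using isometric_real_or_complex[where 'a = 'k] by blast
  interpret additive h by standard (rule add)
  have inj: "x = y" if "h x = h y" for x y
    using norm[of "x - y"] that by (simp add: diff)
  have "h 1 * h 1 = h 1" "h 1 \<noteq> 0"
    using mult[of 1 1] norm[of 1] by auto
  then have one: "h 1 = 1" by simp
  have real: "h (of_real r) = of_real r" for r
    using scaleR[of r 1] by (simp add: one of_real_def)
  define re where "re a = Re (h a)" for a
  have re: "\<forall>a b. re (a + b) = re a + re b" "\<forall>r a. re (r *\<^sub>R a) = r * re a" "re 1 = 1"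
    "\<forall>a. \<bar>re a\<bar> \<le> norm a"
    using abs_Re_le_cmod by (auto simp: re_def add scaleR one simp flip: norm)
  have "\<forall>a. re a = norm a \<longrightarrow> a = of_real (norm a)"
  proof (intro allI impI inj)
    fix a assume "re a = norm a"
    then have "Re (h a) = cmod (h a)" by (simp add: re_def norm)
    then have "Im (h a) = 0" by (simp add: Im_eq_0)
    with \<open>re a = norm a\<close> show "h a = h (of_real (norm a))"
      by (simp add: real re_def complex_eq_iff)
  qed
  moreover have "\<exists>i. (i = 0 \<or> i * i = - 1) \<and> norm i \<le> 1 \<and> re i = 0
      \<and> (\<forall>a. a = of_real (re a) - i * of_real (re (i * a)))"
    using ran
  proof
    assume r: "range h = \<real>"
    have "a = of_real (re a)" for a
    proof (rule inj)
      have "h a \<in> \<real>" using r by blast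
      then show "h a = h (of_real (re a))" by (auto simp: real re_def elim: Reals_cases)
    qed
    then show ?thesis by (intro exI[of _ 0]) (simp add: re_def zero)
  next
    assume "range h = UNIV"
    then obtain i where i: "h i = \<i>" by (metis rangeE UNIV_I)
    have "i * i = - 1" by (rule inj) (simp add: mult i minus one)
    moreover have "norm i \<le> 1" using norm[of i] by (simp add: i)
    moreover have "a = of_real (re a) - i * of_real (re (i * a))" for a
      by (rule inj) (simp add: add diff mult real i re_def complex_eq_iff)
    ultimately show ?thesis by (intro exI[of _ i]) (auto simp: re_def i)
  qed
  ultimately show ?thesis using re by blast
qed

text \<open>The map \<open>g\<close> rebuilds a scalar from its two real coordinates, so the ball is
  a closed subset of the continuous image of a product of compact intervals.\<close>

lemma compact_cball_scalar: "compact (cball (0::'k::real_or_complex) r)"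
proof -
  obtain i :: 'k and re where i: "norm i \<le> 1"
    and dec: "\<And>a::'k. a = of_real (re a) - i * of_real (re (i * a))" and re: "\<And>a. \<bar>re a\<bar> \<le> norm a"
    using scalar_structure[where 'k = 'k] by metis
  define g where "g p = of_real (fst p) - i * of_real (snd p)" for p
  have c: "compact (g ` (cball 0 r \<times> cball 0 r))"
    by (intro compact_continuous_image compact_Times compact_cball)
      (auto simp: g_def intro!: continuous_intros)
  have "cball 0 r \<subseteq> g ` (cball 0 r \<times> cball 0 r)"
  proof
    fix a :: 'k assume a: "a \<in> cball 0 r"
    have "norm (i * a) \<le> 1 * norm a"
      unfolding norm_mult by (intro mult_right_mono i) simp
    then have "\<bar>re (i * a)\<bar> \<le> r" "\<bar>re a\<bar> \<le> r"
      using re[of a] re[of "i * a"] a by auto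
    moreover have "a = g (re a, re (i * a))" using dec[of a] by (simp add: g_def)
    ultimately show "a \<in> g ` (cball 0 r \<times> cball 0 r)"
      by (intro image_eqI[of _ _ "(re a, re (i * a))"]) auto
  qed
  then show ?thesis
    using compact_Int_closed[OF c closed_cball, of 0 r] by (simp add: Int_absorb1)
qed

lemma ex_phase:
  fixes u v :: "'k::real_normed_field"
  shows "\<exists>a. norm a = 1 \<and> norm (a * u + v) = norm u + norm v"
proof (cases "u = 0 \<or> v = 0")
  case True
  then show ?thesis by (intro exI[of _ 1]) auto
next
  case False
  define a where "a = v / u * of_real (norm u / norm v)"
  have "norm a = 1" using False by (simp add: a_def norm_mult norm_divide)
  moreover have "a * u + v = of_real (1 + norm u / norm v) * v"
    using False by (simp add: a_def field_simps)
  then have "norm (a * u + v) = (1 + norm u / norm v) * norm v"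
    by (simp only: norm_mult norm_of_real) (simp add: abs_of_nonneg)
  then have "norm (a * u + v) = norm u + norm v" using False by (simp add: field_simps)
  ultimately show ?thesis by blast
qed


section \<open>Ultrafilters\<close>

definition ultra :: "'a filter \<Rightarrow> bool" where
  "ultra U \<longleftrightarrow> U \<noteq> bot \<and> (\<forall>P. eventually P U \<or> (\<forall>\<^sub>F x in U. \<not> P x))"

text \<open>A filter that is minimal among the proper filters below \<open>G\<close> is an
  ultrafilter: its infimum with the principal filter of a set is either improper or the filter
  itself. Zorn's lemma is applied to the reversed order.\<close>

lemma ex_ultra_le:
  assumes "G \<noteq> bot"
  shows "\<exists>U\<le>G. ultra U"
proof -
  define A where "A = {F. F \<le> G \<and> F \<noteq> bot}"
  have "\<exists>m\<in>A. \<forall>a\<in>A. m \<ge> a \<longrightarrow> a = m"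
  proof (rule predicate_Zorn)
    show "partial_order_on A (relation_of (\<lambda>x y. x \<ge> y) A)"
      by (rule partial_order_on_relation_ofI) auto
    fix C assume C: "C \<in> Chains (relation_of (\<lambda>x y. x \<ge> y) A)"
    then have sub: "C \<subseteq> A" by (auto simp: Chains_def relation_of_def)
    have lin: "F \<le> H \<or> H \<le> F" if "F \<in> C" "H \<in> C" for F H
      using C that by (auto simp: Chains_def relation_of_def)
    show "\<exists>u\<in>A. \<forall>a\<in>C. a \<ge> u"
    proof (cases "C = {}")
      case True
      then show ?thesis using assms by (auto simp: A_def)
    next
      case False
      have "Inf C \<noteq> bot"
      proof
        assume "Inf C = bot"
        then have "eventually (\<lambda>_. False) (Inf C)" by simp
        \<comment> \<open>A chain of filters is directed downwards, so what holds eventually for the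
          infimum already holds eventually for one member.\<close>
        then obtain F where "F \<in> C" "eventually (\<lambda>_. False) F"
          by (subst (asm) eventually_Inf_base[OF False])
            (metis inf.orderE inf.order_iff inf_commute lin order_refl, auto)
        then show False using sub by (auto simp: A_def trivial_limit_def)
      qed
      moreover have "Inf C \<le> G" using False sub by (auto simp: A_def intro: Inf_lower2)
      ultimately show ?thesis by (intro bexI[of _ "Inf C"]) (auto simp: A_def Inf_lower)
    qed
  qed
  then obtain U where U: "U \<le> G" "U \<noteq> bot" and min: "\<And>F. F \<le> U \<Longrightarrow> F \<noteq> bot \<Longrightarrow> F = U"
    unfolding A_def by (auto dest: order_trans)
  have "eventually P U \<or> (\<forall>\<^sub>F x in U. \<not> P x)" for P
  proof (cases "inf U (principal {x. P x}) = bot")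
    case True
    then show ?thesis
      by (auto simp: trivial_limit_def eventually_inf_principal)
  next
    case False
    then have "inf U (principal {x. P x}) = U" by (intro min) auto
    then have "eventually P U"
      by (metis (no_types, lifting) eventually_inf_principal eventually_mono eventually_True mem_Collect_eq)
    then show ?thesis ..
  qed
  then show ?thesis using U unfolding ultra_def by blast
qed

text \<open>The image filter lives on a compact ball and so has a cluster point. For an ultrafilter
  every cluster point is a limit, since a neighbourhood or its complement must hold
  eventually.\<close>

lemma ultra_tendsto_Lim:
  fixes f :: "'a \<Rightarrow> 'k::real_or_complex"
  assumes "ultra U" and "\<forall>\<^sub>F x in U. norm (f x) \<le> C"
  shows "(f \<longlongrightarrow> Lim U f) U"
proof -
  let ?V = "filtermap f U"
  have nb: "U \<noteq> bot" using assms(1) by (simp add: ultra_def)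
  then have "?V \<noteq> bot" "\<forall>\<^sub>F x in ?V. x \<in> cball 0 C"
    using assms(2) by (auto simp: filtermap_bot_iff eventually_filtermap)
  then obtain l where l: "inf (nhds l) ?V \<noteq> bot"
    using compact_cball_scalar[of C] unfolding compact_filter by blast
  have "?V \<le> nhds l"
  proof (rule filter_leI)
    fix P assume P: "eventually P (nhds l)"
    show "eventually P ?V"
    proof (rule ccontr)
      assume "\<not> eventually P ?V"
      then have "\<forall>\<^sub>F x in ?V. \<not> P x"
        using assms(1) by (auto simp: ultra_def eventually_filtermap)
      then have "eventually (\<lambda>_. False) (inf (nhds l) ?V)"
        using P unfolding eventually_inf by blast
      then show False using l by (simp add: trivial_limit_def)
    qed
  qed
  then have "(f \<longlongrightarrow> l) U" by (simp add: filterlim_def)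
  then show ?thesis using tendsto_Lim[OF nb] by blast
qed


section \<open>Seminormed spaces and the Hahn-Banach theorem\<close>

text \<open>A seminorm on a carrier is the common setting for norms of operators and polynomials,
  for the distance to a subspace, and for the auxiliary \<open>p\<close> on pairs that sees a
  function at finitely many points only.\<close>

locale seminormed_over = vector_space s
  for s :: "'k::real_or_complex \<Rightarrow> 'v::ab_group_add \<Rightarrow> 'v" +
  fixes N :: "'v \<Rightarrow> real" and X :: "'v set"
  assumes X: "subspace X"
    and N_add: "\<And>x y. x \<in> X \<Longrightarrow> y \<in> X \<Longrightarrow> N (x + y) \<le> N x + N y"
    and N_scale: "\<And>a x. x \<in> X \<Longrightarrow> N (s a x) = norm a * N x"
begin

lemmas X_simps [simp] = subspace_0[OF X] subspace_add[OF X] subspace_scale[OF X]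
  subspace_neg[OF X] subspace_diff[OF X]

lemma N_0 [simp]: "N 0 = 0"
  using N_scale[of 0 0] by simp

lemma N_minus: "x \<in> X \<Longrightarrow> N (- x) = N x"
  using N_scale[of x "- 1"] by simp

lemma N_nonneg: "x \<in> X \<Longrightarrow> 0 \<le> N x"
  using N_add[of x "- x"] by (simp add: N_minus)

section \<open>Sublinear functionals and their minimal elements\<close>

text \<open>The value off \<open>X\<close> is fixed, so that the pointwise order compares whole
  functions and minimality can be stated as an equality of functions.\<close>

definition sublinear :: "('v \<Rightarrow> real) \<Rightarrow> bool" where
  "sublinear q \<longleftrightarrow> (\<forall>x\<in>X. \<forall>y\<in>X. q (x + y) \<le> q x + q y)
     \<and> (\<forall>r\<ge>0. \<forall>x\<in>X. q (s (of_real r) x) = r * q x) \<and> (\<forall>x. x \<notin> X \<longrightarrow> q x = 0)"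

lemma sublinear_neg:
  assumes "sublinear q" "x \<in> X"
  shows "- q (- x) \<le> q x"
proof -
  have "q 0 = 0" using assms(1) by (auto simp: sublinear_def dest!: spec[of _ "0::real"])
  moreover have "q (x + (- x)) \<le> q x + q (- x)"
    using assms unfolding sublinear_def by (metis X_simps(4))
  ultimately show ?thesis by simp
qed

text \<open>Lowering \<open>q\<close> along the ray spanned by \<open>a\<close>. For a minimal \<open>q\<close> this changes nothing, which
  makes \<open>q\<close> additive.\<close>

definition lower :: "('v \<Rightarrow> real) \<Rightarrow> 'v \<Rightarrow> 'v \<Rightarrow> real" where
  "lower q a x = (if x \<in> X then INF t\<in>{0..}. q (x + s (of_real t) a) - t * q a else 0)"

lemma lower_bdd:
  assumes q: "sublinear q" "x \<in> X" "a \<in> X" "0 \<le> t"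
  shows "- q (- x) \<le> q (x + s (of_real t) a) - t * q a"
proof -
  have add: "q (y + z) \<le> q y + q z" if "y \<in> X" "z \<in> X" for y z
    using q(1) that by (simp add: sublinear_def)
  have "q ((x + s (of_real t) a) + - x) \<le> q (x + s (of_real t) a) + q (- x)"
    using q by (intro add) simp_all
  moreover have "q (s (of_real t) a) = t * q a"
    using q by (simp add: sublinear_def)
  ultimately show ?thesis by simp
qed

lemma lower_le:
  assumes "sublinear q" "x \<in> X" "a \<in> X" "0 \<le> t"
  shows "lower q a x \<le> q (x + s (of_real t) a) - t * q a"
proof -
  have "bdd_below ((\<lambda>t. q (x + s (of_real t) a) - t * q a) ` {0..})"
    using lower_bdd[OF assms(1-3)] by (intro bdd_belowI2[where m = "- q (- x)"]) simp
  from cINF_lower[OF this, of t] show ?thesis using assms by (simp add: lower_def)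
qed

lemma lower_less:
  assumes "x \<in> X" "lower q a x < r"
  shows "\<exists>t\<ge>0. q (x + s (of_real t) a) - t * q a < r"
proof (rule ccontr)
  assume "\<not> ?thesis"
  then have "r \<le> lower q a x"
    using assms(1) by (auto simp: lower_def not_less intro!: cINF_greatest)
  then show False using assms(2) by simp
qed

text \<open>Nearly optimal parameters \<open>t\<close> for \<open>x\<close> and \<open>t'\<close>
  for \<open>y\<close> add up to the parameter \<open>t + t'\<close> for \<open>x + y\<close>.
  Scaling by \<open>r > 0\<close> replaces \<open>t\<close> by \<open>r * t\<close>, which gives one
  inequality; applied to \<open>1 / r\<close> it gives the other.\<close>

lemma sublinear_lower:
  assumes q: "sublinear q" and a: "a \<in> X"
  shows "sublinear (lower q a)"
  unfolding sublinear_def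
proof (intro conjI allI ballI impI)
  have qadd: "q (x + y) \<le> q x + q y" if "x \<in> X" "y \<in> X" for x y
    using q that by (simp add: sublinear_def)
  have qs: "q (s (of_real r) x) = r * q x" if "x \<in> X" "0 \<le> r" for r x
    using q that by (simp add: sublinear_def)
  show "lower q a (x + y) \<le> lower q a x + lower q a y" if xy: "x \<in> X" "y \<in> X" for x y
  proof (rule field_le_epsilon)
    fix e :: real assume "0 < e"
    then obtain t t' where t: "0 \<le> t" "q (x + s (of_real t) a) - t * q a < lower q a x + e/2"
      and t': "0 \<le> t'" "q (y + s (of_real t') a) - t' * q a < lower q a y + e/2"
      using lower_less[of x q a "lower q a x + e/2"] lower_less[of y q a "lower q a y + e/2"] xy by auto
    have "lower q a (x + y) \<le> q (x + y + s (of_real (t + t')) a) - (t + t') * q a"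
      using q a xy t t' by (intro lower_le) auto
    moreover have "x + y + s (of_real (t + t')) a = (x + s (of_real t) a) + (y + s (of_real t') a)"
      by (simp add: algebra_simps)
    ultimately show "lower q a (x + y) \<le> lower q a x + lower q a y + e"
      using qadd[of "x + s (of_real t) a" "y + s (of_real t') a"] xy a t t'
      by (simp add: algebra_simps)
  qed
  have le: "lower q a (s (of_real r) x) \<le> r * lower q a x" if r: "0 < r" and x: "x \<in> X" for r x
  proof (rule field_le_epsilon)
    fix e :: real assume "0 < e"
    then obtain t where t: "0 \<le> t" "q (x + s (of_real t) a) - t * q a < lower q a x + e/r"
      using lower_less[of x q a "lower q a x + e/r"] x r by auto
    have "lower q a (s (of_real r) x) \<le> q (s (of_real r) x + s (of_real (r * t)) a) - (r * t) * q a"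
      using q a x t r by (intro lower_le) auto
    also have "s (of_real r) x + s (of_real (r * t)) a = s (of_real r) (x + s (of_real t) a)"
      by (simp add: algebra_simps)
    also have "q \<dots> - (r * t) * q a = r * (q (x + s (of_real t) a) - t * q a)"
      using qs[of "x + s (of_real t) a" r] x a r by (simp add: algebra_simps)
    also have "\<dots> \<le> r * (lower q a x + e/r)" using t r by simp
    also have "\<dots> = r * lower q a x + e" using r by (simp add: field_simps)
    finally show "lower q a (s (of_real r) x) \<le> r * lower q a x + e" .
  qed
  show "lower q a (s (of_real r) x) = r * lower q a x" if r: "0 \<le> r" and x: "x \<in> X" for r x
  proof (cases "r = 0")
    case True
    have "q (s (of_real t) a) - t * q a = 0" if "0 \<le> t" for t using qs a that by simp
    then have "lower q a 0 = (INF t\<in>{0::real..}. 0)"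
      unfolding lower_def by (auto intro!: INF_cong)
    then show ?thesis using True by simp
  next
    case False
    then have "0 < r" using r by simp
    moreover have "lower q a (s (of_real (1/r)) (s (of_real r) x)) \<le> 1/r * lower q a (s (of_real r) x)"
      using \<open>0 < r\<close> x by (intro le) auto
    ultimately show ?thesis using le[of r x] x by (simp add: field_simps)
  qed
  show "lower q a x = 0" if "x \<notin> X" for x using that by (simp add: lower_def)
qed

lemma lower_le_self:
  assumes "sublinear q" "a \<in> X" "x \<in> X"
  shows "lower q a x \<le> q x"
  using lower_le[of q x a 0] assms by simp

text \<open>A chain is bounded below by its pointwise infimum. Subadditivity survives because two
  members, nearly optimal at \<open>x\<close> and at \<open>y\<close>, are comparable, and the
  smaller one serves both points.\<close>

lemma ex_minimal_sublinear:
  assumes q: "sublinear q"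
  shows "\<exists>u. sublinear u \<and> u \<le> q \<and> (\<forall>v. sublinear v \<longrightarrow> v \<le> u \<longrightarrow> v = u)"
proof -
  define A where "A = {u. sublinear u \<and> u \<le> q}"
  have "\<exists>m\<in>A. \<forall>a\<in>A. m \<ge> a \<longrightarrow> a = m"
  proof (rule predicate_Zorn)
    show "partial_order_on A (relation_of (\<lambda>x y. x \<ge> y) A)"
      by (rule partial_order_on_relation_ofI) auto
    fix C assume C: "C \<in> Chains (relation_of (\<lambda>x y. x \<ge> y) A)"
    then have sub: "C \<subseteq> A" by (auto simp: Chains_def relation_of_def)
    have lin: "f \<le> g \<or> g \<le> f" if "f \<in> C" "g \<in> C" for f g
      using C that by (auto simp: Chains_def relation_of_def)
    show "\<exists>u\<in>A. \<forall>a\<in>C. a \<ge> u"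
    proof (cases "C = {}")
      case True
      then show ?thesis using q by (auto simp: A_def)
    next
      case False
      define u where "u x = (INF f\<in>C. f x)" for x
      have bdd: "bdd_below ((\<lambda>f. f x) ` C)" for x
      proof (rule bdd_belowI2)
        fix f assume "f \<in> C"
        then have f: "sublinear f" "f \<le> q" using sub by (auto simp: A_def)
        \<comment> \<open>The 0 covers the points outside \<open>X\<close>, where every member of
          the chain vanishes.\<close>
        show "min 0 (- q (- x)) \<le> f x"
        proof (cases "x \<in> X")
          case True
          have "- q (- x) \<le> - f (- x)" using f(2) by (auto simp: le_fun_def)
          also have "\<dots> \<le> f x" using sublinear_neg f(1) True by simp
          finally show ?thesis by simp
        next
          case False
          then show ?thesis using f by (simp add: sublinear_def)
        qed
      qed
      have le: "u x \<le> f x" if "f \<in> C" for f x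
        unfolding u_def using bdd that by (intro cINF_lower)
      have less: "\<exists>f\<in>C. f x < r" if "u x < r" for x r
        using that False bdd by (auto simp: u_def cINF_less_iff)
      have "sublinear u"
        unfolding sublinear_def
      proof (intro conjI ballI allI impI)
        show "u (x + y) \<le> u x + u y" if "x \<in> X" "y \<in> X" for x y
        proof (rule field_le_epsilon)
          fix e :: real assume e: "0 < e"
          obtain f g where fg: "f \<in> C" "f x < u x + e/2" "g \<in> C" "g y < u y + e/2"
            using less[of x "u x + e/2"] less[of y "u y + e/2"] e by auto
          from lin[OF fg(1,3)] show "u (x + y) \<le> u x + u y + e"
          proof
            assume "f \<le> g"
            then have "f y \<le> g y" by (simp add: le_fun_def)
            moreover have "f (x + y) \<le> f x + f y"
              using fg(1) sub that by (auto simp: A_def sublinear_def)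
            ultimately show ?thesis using le[OF fg(1), of "x + y"] fg by simp
          next
            assume "g \<le> f"
            then have "g x \<le> f x" by (simp add: le_fun_def)
            moreover have "g (x + y) \<le> g x + g y"
              using fg(3) sub that by (auto simp: A_def sublinear_def)
            ultimately show ?thesis using le[OF fg(3), of "x + y"] fg by simp
          qed
        qed
        show "u (s (of_real r) x) = r * u x" if r: "0 \<le> r" and x: "x \<in> X" for r x
        proof -
          have "(\<lambda>f. f (s (of_real r) x)) ` C = (\<lambda>y. r * y) ` (\<lambda>f. f x) ` C"
            unfolding image_image using sub r x by (intro image_cong) (auto simp: A_def sublinear_def)
          moreover have "r * Inf ((\<lambda>f. f x) ` C) = Inf ((\<lambda>y. r * y) ` (\<lambda>f. f x) ` C)"
            using False bdd[of x] r
            by (intro continuous_at_Inf_mono) (auto intro!: monoI mult_left_mono continuous_intros)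
          ultimately show ?thesis by (simp add: u_def)
        qed
        show "u x = 0" if "x \<notin> X" for x
        proof -
          have "u x = (INF f\<in>C. 0)" unfolding u_def
            using sub that by (intro INF_cong) (auto simp: A_def sublinear_def)
          then show ?thesis using False by simp
        qed
      qed
      moreover have "u \<le> q"
      proof (rule le_funI)
        fix x
        obtain f where "f \<in> C" using False by blast
        then have "f \<le> q" using sub by (auto simp: A_def)
        then show "u x \<le> q x" using le[OF \<open>f \<in> C\<close>, of x] by (auto simp: le_fun_def intro: order_trans)
      qed
      ultimately show ?thesis using le by (intro bexI[of _ u]) (auto simp: A_def le_fun_def)
    qed
  qed
  then show ?thesis unfolding A_def by (auto dest: order_trans)
qed

text \<open>A minimal sublinear \<open>u\<close> equals \<open>lower u y\<close> for each
  \<open>y\<close>, which gives \<open>u x + u y \<le> u (x + y)\<close>, so \<open>u\<close> is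
  additive. Starting from \<open>lower p x0\<close> instead of \<open>p\<close> forces
  \<open>u (- x0) \<le> - N x0\<close>, by the parameter \<open>t = 1\<close>, so that the value at
  \<open>x0\<close> is the largest possible.\<close>

lemma ex_real_functional:
  assumes x0: "x0 \<in> X"
  shows "\<exists>u. (\<forall>x\<in>X. \<forall>y\<in>X. u (x + y) = u x + u y) \<and> (\<forall>r. \<forall>x\<in>X. u (s (of_real r) x) = r * u x)
     \<and> (\<forall>x\<in>X. u x \<le> N x) \<and> u x0 = N x0"
proof -
  define p where "p x = (if x \<in> X then N x else 0)" for x
  have p: "sublinear p" by (auto simp: sublinear_def p_def N_add N_scale)
  then obtain u where u: "sublinear u" and up: "u \<le> lower p x0"
    and min: "\<And>v. sublinear v \<Longrightarrow> v \<le> u \<Longrightarrow> v = u"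
    using ex_minimal_sublinear[OF sublinear_lower[OF p x0]] by blast
  have add: "u (x + y) = u x + u y" if xy: "x \<in> X" "y \<in> X" for x y
  proof -
    have "lower u y \<le> u"
    proof (rule le_funI)
      show "lower u y z \<le> u z" for z
        using lower_le_self[OF u xy(2), of z] u by (cases "z \<in> X") (auto simp: lower_def sublinear_def)
    qed
    then have "lower u y = u" using u xy by (intro min sublinear_lower)
    then have "u x \<le> u (x + y) - u y" using lower_le[OF u xy, of 1] by simp
    then show ?thesis using u xy unfolding sublinear_def by (metis add.commute le_diff_eq order_antisym)
  qed
  have neg: "u (- x) = - u x" if "x \<in> X" for x
    using add[of x "- x"] add[of 0 0] that by simp
  have scale: "u (s (of_real r) x) = r * u x" if x: "x \<in> X" for r x
  proof (cases "0 \<le> r")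
    case True
    then show ?thesis using u x by (simp add: sublinear_def)
  next
    case False
    have "u (s (of_real t) x) = t * u x" if "0 \<le> t" for t using u x that by (simp add: sublinear_def)
    from this[of "- r"] have "u (s (of_real (- r)) x) = - r * u x" using False by simp
    then show ?thesis using neg[of "s (of_real r) x"] x by simp
  qed
  have le: "u x \<le> N x" if x: "x \<in> X" for x
  proof -
    have "u x \<le> lower p x0 x" using up by (simp add: le_fun_def)
    also have "\<dots> \<le> p x" using p x0 x by (rule lower_le_self)
    finally show ?thesis using x by (simp add: p_def)
  qed
  have "u (- x0) \<le> lower p x0 (- x0)" using up by (simp add: le_fun_def)
  also have "\<dots> \<le> p (- x0 + s (of_real 1) x0) - 1 * p x0"
    using p x0 by (intro lower_le) auto
  finally have "N x0 \<le> u x0" using neg[OF x0] x0 by (simp add: p_def)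
  then show ?thesis using add scale le[OF x0] le by (intro exI[of _ u]) auto
qed

text \<open>The real functional \<open>u\<close> is complexified by
  \<open>u x - i * u (i x)\<close>, which reduces to \<open>u\<close> when \<open>i = 0\<close>. For
  the norm bound, \<open>x\<close> is rotated by a scalar \<open>b\<close> of modulus 1 that makes
  \<open>\<phi>\<close> real and nonnegative; there \<open>\<phi>\<close> agrees with
  \<open>u\<close>.\<close>

theorem hahn_banach_point:
  assumes x0: "x0 \<in> X"
  shows "\<exists>\<phi>. (\<forall>x\<in>X. \<forall>y\<in>X. \<phi> (x + y) = \<phi> x + \<phi> y) \<and> (\<forall>a. \<forall>x\<in>X. \<phi> (s a x) = a * \<phi> x)
     \<and> (\<forall>x\<in>X. norm (\<phi> x) \<le> N x) \<and> \<phi> x0 = of_real (N x0)"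
proof -
  obtain u where add: "\<And>x y. x \<in> X \<Longrightarrow> y \<in> X \<Longrightarrow> u (x + y) = u x + u y"
    and scale: "\<And>r x. x \<in> X \<Longrightarrow> u (s (of_real r) x) = r * u x"
    and le: "\<And>x. x \<in> X \<Longrightarrow> u x \<le> N x" and ux0: "u x0 = N x0"
    using ex_real_functional[OF x0] by metis
  obtain i :: 'k and re where ii: "i = 0 \<or> i * i = - 1" and rei: "re i = 0" and re1: "re 1 = 1"
    and reA: "\<And>a b. re (a + b) = re a + re b" and reR: "\<And>r a. re (r *\<^sub>R a) = r * re a"
    and dec: "\<And>a::'k. a = of_real (re a) - i * of_real (re (i * a))"
    and re: "\<And>a. re a = norm a \<longrightarrow> a = of_real (norm a)" and rele: "\<And>a. \<bar>re a\<bar> \<le> norm a"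
    using scalar_structure[where 'k = 'k] by metis
  interpret re: additive re by standard (rule reA)
  define \<phi> where "\<phi> x = of_real (u x) - i * of_real (u (s i x))" for x
  have re_real: "re (of_real r) = r" for r using reR[of r 1] by (simp add: re1 of_real_def)
  have re_\<phi>: "re (\<phi> x) = u x" for x
  proof -
    have "i * of_real (u (s i x)) = u (s i x) *\<^sub>R i" by (simp add: scaleR_conv_of_real)
    then show ?thesis by (simp add: \<phi>_def re.diff re_real reR rei)
  qed
  have \<phi>_add: "\<phi> (x + y) = \<phi> x + \<phi> y" if "x \<in> X" "y \<in> X" for x y
    using that by (simp add: \<phi>_def add scale_right_distrib algebra_simps)
  have \<phi>_real: "\<phi> (s (of_real r) x) = of_real r * \<phi> x" if "x \<in> X" for r x
  proof -
    have "s i (s (of_real r) x) = s (of_real r) (s i x)" by (simp add: mult.commute)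
    then have "u (s i (s (of_real r) x)) = r * u (s i x)" using that by (simp only: scale X_simps)
    then show ?thesis using that by (simp add: \<phi>_def scale algebra_simps del: scale_scale)
  qed
  have u0: "u 0 = 0" using scale[of 0 0] by simp
  have um: "u (- x) = - u x" if "x \<in> X" for x using scale[of x "-1"] that by simp
  have \<phi>_i: "\<phi> (s i x) = i * \<phi> x" if "x \<in> X" for x
    using ii
  proof
    assume "i = 0"
    then show ?thesis by (simp add: \<phi>_def u0)
  next
    assume i: "i * i = - 1"
    then have "i * (i * z) = - z" for z by (metis mult.assoc mult_minus1)
    then show ?thesis using that i by (simp add: \<phi>_def um right_diff_distrib)
  qed
  have \<phi>_scale: "\<phi> (s a x) = a * \<phi> x" if x: "x \<in> X" for a x
  proof -
    define r t where "r = re a" and "t = - re (i * a)"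
    have a: "a = of_real r + i * of_real t" using dec[of a] by (simp add: r_def t_def)
    have "s a x = s (of_real r) x + s (of_real t) (s i x)"
      by (subst a) (simp add: scale_left_distrib mult.commute)
    then have "\<phi> (s a x) = of_real r * \<phi> x + of_real t * (i * \<phi> x)"
      using x by (simp add: \<phi>_add \<phi>_real \<phi>_i del: scale_scale)
    also have "\<dots> = (of_real r + i * of_real t) * \<phi> x" by (simp add: algebra_simps)
    finally show ?thesis by (simp only: a[symmetric])
  qed
  have \<phi>_le: "norm (\<phi> x) \<le> N x" if x: "x \<in> X" for x
  proof (cases "\<phi> x = 0")
    case True
    then show ?thesis using N_nonneg[OF x] by simp
  next
    case False
    define b where "b = of_real (norm (\<phi> x)) / \<phi> x"
    have b: "norm b = 1" using False by (simp add: b_def norm_divide)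
    have "\<phi> (s b x) = of_real (norm (\<phi> x))" using False x by (simp add: \<phi>_scale b_def)
    then have "u (s b x) = norm (\<phi> x)" using re_\<phi>[of "s b x"] by (simp add: re_real)
    then show ?thesis using le[of "s b x"] x by (simp add: N_scale b)
  qed
  have "norm (\<phi> x0) = N x0"
    using \<phi>_le[OF x0] rele[of "\<phi> x0"] by (simp add: re_\<phi> ux0)
  then have "\<phi> x0 = of_real (N x0)" using re[of "\<phi> x0"] by (simp add: re_\<phi> ux0)
  then show ?thesis using \<phi>_add \<phi>_scale \<phi>_le by blast
qed

text \<open>The norming functional is taken for the quotient seminorm \<open>q\<close>, the distance
  to \<open>M\<close>. It vanishes on \<open>M\<close> because \<open>q\<close> does, and
  \<open>q x0\<close> is at least \<open>d\<close>.\<close>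

lemma hahn_banach_separation:
  assumes M: "subspace M" "M \<subseteq> X" and x0: "x0 \<in> X" and d: "0 \<le> d" "\<And>m. m \<in> M \<Longrightarrow> d \<le> N (x0 + m)"
  shows "\<exists>\<phi>. (\<forall>x\<in>X. \<forall>y\<in>X. \<phi> (x + y) = \<phi> x + \<phi> y) \<and> (\<forall>a. \<forall>x\<in>X. \<phi> (s a x) = a * \<phi> x)
     \<and> (\<forall>x\<in>X. norm (\<phi> x) \<le> N x) \<and> (\<forall>m\<in>M. \<phi> m = 0) \<and> d \<le> norm (\<phi> x0)"
proof -
  define q where "q x = (INF m\<in>M. N (x + m))" for x
  have M0: "M \<noteq> {}" using M(1) subspace_0 by auto
  have MX: "m \<in> X" if "m \<in> M" for m using M(2) that by blast
  have q_le: "q x \<le> N (x + m)" if "x \<in> X" "m \<in> M" for x m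
    unfolding q_def using that MX by (intro cINF_lower bdd_belowI2[of _ 0] N_nonneg) auto
  have q_ge: "r \<le> q x" if "\<And>m. m \<in> M \<Longrightarrow> r \<le> N (x + m)" for r x
    unfolding q_def using M0 that by (intro cINF_greatest)
  have q_less: "\<exists>m\<in>M. N (x + m) < r" if "q x < r" for r x
    using that q_ge[of r x] by (meson not_less)
  have q_scale_le: "q (s a x) \<le> norm a * q x" if x: "x \<in> X" and a: "a \<noteq> 0" for a x
  proof (rule field_le_epsilon)
    fix e :: real assume "0 < e"
    then obtain m where m: "m \<in> M" "N (x + m) < q x + e / norm a"
      using q_less[of x "q x + e / norm a"] a by auto
    have "q (s a x) \<le> N (s a x + s a m)"
      using x m subspace_scale[OF M(1)] by (intro q_le) auto
    also have "\<dots> = norm a * N (x + m)"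
      using x m MX by (simp add: N_scale flip: scale_right_distrib)
    also have "\<dots> \<le> norm a * (q x + e / norm a)" using m by (intro mult_left_mono) auto
    also have "\<dots> = norm a * q x + e" using a by (simp add: field_simps)
    finally show "q (s a x) \<le> norm a * q x + e" .
  qed
  interpret q: seminormed_over s q X
  proof
    show "subspace X" by (rule X)
    show "q (x + y) \<le> q x + q y" if xy: "x \<in> X" "y \<in> X" for x y
    proof (rule field_le_epsilon)
      fix e :: real assume "0 < e"
      then obtain m m' where m: "m \<in> M" "N (x + m) < q x + e/2" "m' \<in> M" "N (y + m') < q y + e/2"
        using q_less[of x "q x + e/2"] q_less[of y "q y + e/2"] by auto
      have "q (x + y) \<le> N ((x + y) + (m + m'))"
        using xy m subspace_add[OF M(1)] by (intro q_le) auto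
      also have "\<dots> = N ((x + m) + (y + m'))" by (simp add: algebra_simps)
      also have "\<dots> \<le> N (x + m) + N (y + m')" using xy m MX by (intro N_add) auto
      finally show "q (x + y) \<le> q x + q y + e" using m by simp
    qed
    show "q (s a x) = norm a * q x" if x: "x \<in> X" for a x
    proof (cases "a = 0")
      case True
      have "q 0 \<le> 0" using q_le[of 0 0] subspace_0[OF M(1)] by simp
      moreover have "0 \<le> q 0" by (rule q_ge) (simp add: N_nonneg MX)
      ultimately show ?thesis using True by simp
    next
      case False
      have "q x \<le> norm (1/a) * q (s a x)"
        using q_scale_le[of "s a x" "1/a"] x False by simp
      then show ?thesis using q_scale_le[OF x False] False by (simp add: norm_divide field_simps)
    qed
  qed
  obtain \<phi> where \<phi>: "\<forall>x\<in>X. \<forall>y\<in>X. \<phi> (x + y) = \<phi> x + \<phi> y" "\<forall>a. \<forall>x\<in>X. \<phi> (s a x) = a * \<phi> x"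
    "\<forall>x\<in>X. norm (\<phi> x) \<le> q x" "\<phi> x0 = of_real (q x0)"
    using q.hahn_banach_point[OF x0] by blast
  have "norm (\<phi> x) \<le> N x" if "x \<in> X" for x
    using \<phi>(3) q_le[of x 0] that subspace_0[OF M(1)] by force
  moreover have "\<phi> m = 0" if "m \<in> M" for m
  proof -
    have "q m \<le> N (m + - m)" using that MX subspace_neg[OF M(1)] by (intro q_le) auto
    moreover have "norm (\<phi> m) \<le> q m" using \<phi>(3) that MX by blast
    ultimately have "norm (\<phi> m) \<le> N (m + - m)" by linarith
    then show ?thesis by simp
  qed
  moreover have "d \<le> q x0" using d(2) by (rule q_ge)
  then have "d \<le> norm (\<phi> x0)" by (simp add: \<phi>(4))
  ultimately show ?thesis using \<phi>(1,2) by blast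
qed

end


section \<open>Dual norms\<close>

lemma dual_norm_cong:
  assumes "\<And>x. x \<in> X \<Longrightarrow> \<phi> x = \<psi> x"
  shows "dual_norm N X \<phi> = dual_norm N X \<psi>"
  unfolding dual_norm_def using assms by (intro SUP_cong) auto

context seminormed_over
begin

text \<open>Membership in the dual without the normalization off \<open>X\<close>. This form passes
  to smaller carriers and holds for composites written as plain functions.\<close>

definition functional :: "('v \<Rightarrow> 'k) \<Rightarrow> bool" where
  "functional \<phi> \<longleftrightarrow> (\<forall>x\<in>X. \<forall>y\<in>X. \<phi> (x + y) = \<phi> x + \<phi> y)
     \<and> (\<forall>a. \<forall>x\<in>X. \<phi> (s a x) = a * \<phi> x) \<and> (\<exists>C. \<forall>x\<in>X. norm (\<phi> x) \<le> C * N x)"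

lemma dual_space_iff: "\<phi> \<in> dual_space s N X \<longleftrightarrow> functional \<phi> \<and> (\<forall>x. x \<notin> X \<longrightarrow> \<phi> x = 0)"
  by (auto simp: dual_space_def functional_def)

lemma functional_if_mem [simp]:
  "functional (\<lambda>x. if x \<in> X then \<phi> x else 0) \<longleftrightarrow> functional \<phi>"
  by (simp add: functional_def)

lemma functional_add: "functional \<phi> \<Longrightarrow> x \<in> X \<Longrightarrow> y \<in> X \<Longrightarrow> \<phi> (x + y) = \<phi> x + \<phi> y"
  and functional_scale: "functional \<phi> \<Longrightarrow> x \<in> X \<Longrightarrow> \<phi> (s a x) = a * \<phi> x"
  by (auto simp: functional_def)

lemma functional_0: "functional \<phi> \<Longrightarrow> \<phi> 0 = 0"
  using functional_scale[of \<phi> 0 0] by simp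

lemma functional_neg: "functional \<phi> \<Longrightarrow> x \<in> X \<Longrightarrow> \<phi> (- x) = - \<phi> x"
  using functional_scale[of \<phi> x "- 1"] by simp

lemma functional_diff: "functional \<phi> \<Longrightarrow> x \<in> X \<Longrightarrow> y \<in> X \<Longrightarrow> \<phi> (x - y) = \<phi> x - \<phi> y"
  using functional_add[of \<phi> x "- y"] by (simp add: functional_neg)

lemma functional_boundE:
  assumes "functional \<phi>"
  obtains C where "0 \<le> C" "\<And>x. x \<in> X \<Longrightarrow> norm (\<phi> x) \<le> C * N x"
proof -
  obtain C where C: "\<And>x. x \<in> X \<Longrightarrow> norm (\<phi> x) \<le> C * N x"
    using assms unfolding functional_def by blast
  have "norm (\<phi> x) \<le> \<bar>C\<bar> * N x" if "x \<in> X" for x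
    using C[OF that] mult_right_mono[OF abs_ge_self[of C] N_nonneg[OF that]] by linarith
  then show ?thesis using that[of "\<bar>C\<bar>"] by simp
qed

lemma functionalI:
  assumes "\<And>x y. x \<in> X \<Longrightarrow> y \<in> X \<Longrightarrow> \<phi> (x + y) = \<phi> x + \<phi> y"
    and "\<And>a x. x \<in> X \<Longrightarrow> \<phi> (s a x) = a * \<phi> x"
    and "\<And>x. x \<in> X \<Longrightarrow> norm (\<phi> x) \<le> C * N x"
  shows "functional \<phi>"
  using assms unfolding functional_def by blast

lemma functional_plus:
  assumes \<phi>: "functional \<phi>" and \<psi>: "functional \<psi>"
  shows "functional (\<phi> + \<psi>)"
proof -
  obtain C C' where C: "\<And>x. x \<in> X \<Longrightarrow> norm (\<phi> x) \<le> C * N x" "\<And>x. x \<in> X \<Longrightarrow> norm (\<psi> x) \<le> C' * N x"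
    using assms by (meson functional_boundE)
  show ?thesis
  proof (rule functionalI)
    show "norm ((\<phi> + \<psi>) x) \<le> (C + C') * N x" if "x \<in> X" for x
      using norm_triangle_ineq[of "\<phi> x" "\<psi> x"] C[OF that] by (simp add: distrib_right)
  qed (simp_all add: functional_add[OF \<phi>] functional_add[OF \<psi>] functional_scale[OF \<phi>]
      functional_scale[OF \<psi>] algebra_simps)
qed

lemma functional_fun_scale:
  assumes \<phi>: "functional \<phi>"
  shows "functional (fun_scale (*) a \<phi>)"
proof -
  obtain C where C: "\<And>x. x \<in> X \<Longrightarrow> norm (\<phi> x) \<le> C * N x"
    using assms by (meson functional_boundE)
  show ?thesis
  proof (rule functionalI)
    show "norm (fun_scale (*) a \<phi> x) \<le> (norm a * C) * N x" if "x \<in> X" for x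
      using C[OF that] by (simp add: fun_scale_def norm_mult mult_left_mono mult.assoc)
  qed (simp_all add: fun_scale_def functional_add[OF \<phi>] functional_scale[OF \<phi>] algebra_simps)
qed

lemma functional_minus:
  assumes "functional \<phi>" "functional \<psi>"
  shows "functional (\<phi> - \<psi>)"
proof -
  have "\<phi> - \<psi> = \<phi> + fun_scale (*) (- 1) \<psi>" by (simp add: fun_scale_def fun_eq_iff)
  then show ?thesis using functional_plus[OF assms(1) functional_fun_scale[OF assms(2)]] by metis
qed

lemma functional_bdd:
  assumes "functional \<phi>"
  shows "bdd_above ((\<lambda>x. norm (\<phi> x)) ` {x \<in> X. N x \<le> 1})"
proof -
  obtain C where C: "0 \<le> C" "\<And>x. x \<in> X \<Longrightarrow> norm (\<phi> x) \<le> C * N x"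
    using functional_boundE[OF assms] by blast
  show ?thesis
  proof (rule bdd_aboveI2)
    fix x assume "x \<in> {x \<in> X. N x \<le> 1}"
    then show "norm (\<phi> x) \<le> C"
      using C(2)[of x] mult_left_mono[OF _ C(1), of "N x" 1] by auto
  qed
qed

lemma dual_norm_upper:
  assumes "functional \<phi>" "x \<in> X" "N x \<le> 1"
  shows "norm (\<phi> x) \<le> dual_norm N X \<phi>"
  unfolding dual_norm_def using assms functional_bdd by (intro cSUP_upper) auto

lemma dual_norm_least:
  assumes "\<And>x. x \<in> X \<Longrightarrow> N x \<le> 1 \<Longrightarrow> norm (\<phi> x) \<le> b"
  shows "dual_norm N X \<phi> \<le> b"
  unfolding dual_norm_def
proof (rule cSUP_least)
  show "{x \<in> X. N x \<le> 1} \<noteq> {}" by (auto intro!: exI[of _ 0])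
qed (use assms in auto)

lemma dual_norm_nonneg: "functional \<phi> \<Longrightarrow> 0 \<le> dual_norm N X \<phi>"
  using dual_norm_upper[of \<phi> 0] by (simp add: functional_0)

lemma norm_le_dual_norm:
  assumes \<phi>: "functional \<phi>" and x: "x \<in> X"
  shows "norm (\<phi> x) \<le> dual_norm N X \<phi> * N x"
proof (cases "N x = 0")
  case True
  obtain D where "norm (\<phi> x) \<le> D * N x" using functional_boundE[OF \<phi>] x by metis
  then show ?thesis using True by simp
next
  case False
  then have "0 < N x" using N_nonneg[OF x] by simp
  then have "norm (\<phi> (s (of_real (1 / N x)) x)) \<le> dual_norm N X \<phi>"
    using x by (intro dual_norm_upper[OF \<phi>]) (auto simp: N_scale norm_divide)
  then show ?thesis
    using \<open>0 < N x\<close> \<phi> x by (simp add: functional_scale norm_mult norm_divide field_simps)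
qed

lemma dual_norm_diff_le:
  assumes "functional \<phi>" "functional \<psi>"
  shows "dual_norm N X \<phi> \<le> dual_norm N X \<psi> + dual_norm N X (\<phi> - \<psi>)"
proof (rule dual_norm_least)
  have f: "functional (\<phi> - \<psi>)" using assms by (rule functional_minus)
  fix x assume "x \<in> X" "N x \<le> 1"
  then show "norm (\<phi> x) \<le> dual_norm N X \<psi> + dual_norm N X (\<phi> - \<psi>)"
    using dual_norm_upper[OF assms(2), of x] dual_norm_upper[OF f, of x]
      norm_triangle_ineq[of "\<psi> x" "(\<phi> - \<psi>) x"] by simp
qed

lemma dual_space_add:
  "\<phi> \<in> dual_space s N X \<Longrightarrow> \<psi> \<in> dual_space s N X \<Longrightarrow> \<phi> + \<psi> \<in> dual_space s N X"
  by (simp add: dual_space_iff functional_plus)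

lemma dual_space_diff:
  "\<phi> \<in> dual_space s N X \<Longrightarrow> \<psi> \<in> dual_space s N X \<Longrightarrow> \<phi> - \<psi> \<in> dual_space s N X"
  by (simp add: dual_space_iff functional_minus)

lemma dual_space_eq_0:
  assumes "\<phi> \<in> dual_space s N X" "dual_norm N X \<phi> \<le> 0"
  shows "\<phi> = 0"
proof
  fix x
  show "\<phi> x = 0 x"
  proof (cases "x \<in> X")
    case True
    then have "norm (\<phi> x) \<le> dual_norm N X \<phi> * N x"
      using assms(1) by (intro norm_le_dual_norm) (auto simp: dual_space_iff)
    also have "\<dots> \<le> 0" by (rule mult_nonpos_nonneg[OF assms(2) N_nonneg[OF True]])
    finally show ?thesis by simp
  next
    case False
    then show ?thesis using assms(1) by (simp add: dual_space_iff)
  qed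
qed

lemma seminormed_subspace:
  assumes "subspace J" "J \<subseteq> X"
  shows "seminormed_over s N J"
proof unfold_locales
  show "subspace J" by fact
  show "N (x + y) \<le> N x + N y" if "x \<in> J" "y \<in> J" for x y
    using assms(2) that by (intro N_add) auto
  show "N (s a x) = norm a * N x" if "x \<in> J" for a x
    using assms(2) that by (intro N_scale) auto
qed

text \<open>Rotating one of the two vectors by a unimodular scalar aligns the phases.\<close>

lemma dual_norm_add_le:
  assumes J: "subspace J" "J \<subseteq> X" and \<psi>: "functional \<psi>" and \<phi>: "functional \<phi>"
    and b: "\<And>j x. j \<in> J \<Longrightarrow> x \<in> X \<Longrightarrow> N j \<le> 1 \<Longrightarrow> N x \<le> 1 \<Longrightarrow> norm (\<phi> j + \<psi> x) \<le> b"
  shows "dual_norm N J \<phi> + dual_norm N X \<psi> \<le> b"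
proof -
  interpret J: seminormed_over s N J using J by (rule seminormed_subspace)
  have sum: "norm (\<phi> j) + norm (\<psi> x) \<le> b" if "j \<in> J" "x \<in> X" "N j \<le> 1" "N x \<le> 1" for j x
  proof -
    obtain a where a: "norm a = 1" "norm (a * \<phi> j + \<psi> x) = norm (\<phi> j) + norm (\<psi> x)"
      using ex_phase by blast
    have "j \<in> X" using that J(2) by auto
    then have "norm (\<phi> (s a j) + \<psi> x) \<le> b"
      using that a(1) by (intro b) (auto simp: N_scale)
    then show ?thesis using a(2) \<phi> \<open>j \<in> X\<close> by (simp add: functional_scale)
  qed
  have "dual_norm N X \<psi> \<le> b - dual_norm N J \<phi>"
  proof (rule dual_norm_least)
    fix x assume x: "x \<in> X" "N x \<le> 1"
    have "dual_norm N J \<phi> \<le> b - norm (\<psi> x)"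
      using sum x by (intro J.dual_norm_least) (auto simp: le_diff_eq)
    then show "norm (\<psi> x) \<le> b - dual_norm N J \<phi>" by simp
  qed
  then show ?thesis by simp
qed

end


section \<open>A criterion for M-ideals\<close>

text \<open>Weak-star limits along an ultrafilter of the adjoints of operators from \<open>X\<close> to \<open>J\<close> that
  approximate the identity on \<open>J\<close>.\<close>

locale approx_identity = seminormed_over s N X
  for s :: "'k::real_or_complex \<Rightarrow> 'v::ab_group_add \<Rightarrow> 'v" and N X +
  fixes J :: "'v set" and U :: "'d filter" and \<Theta> :: "'d \<Rightarrow> 'v \<Rightarrow> 'v" and C :: real
  assumes J: "J \<subseteq> X"
    and U: "ultra U"
    and \<Theta>_J: "\<And>d x. x \<in> X \<Longrightarrow> \<Theta> d x \<in> J"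
    and \<Theta>_add: "\<And>d x y. x \<in> X \<Longrightarrow> y \<in> X \<Longrightarrow> \<Theta> d (x + y) = \<Theta> d x + \<Theta> d y"
    and \<Theta>_scale: "\<And>d a x. x \<in> X \<Longrightarrow> \<Theta> d (s a x) = s a (\<Theta> d x)"
    and \<Theta>_bound: "\<forall>\<^sub>F d in U. \<forall>x\<in>X. N (\<Theta> d x) \<le> C * N x"
    and \<Theta>_tendsto: "\<And>j. j \<in> J \<Longrightarrow> ((\<lambda>d. N (\<Theta> d j - j)) \<longlongrightarrow> 0) U"
begin

definition lift :: "('v \<Rightarrow> 'k) \<Rightarrow> 'v \<Rightarrow> 'k" where
  "lift \<phi> x = (if x \<in> X then Lim U (\<lambda>d. \<phi> (\<Theta> d x)) else 0)"

lemma nb: "U \<noteq> bot"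
  using U by (simp add: ultra_def)

lemma \<Theta>_X: "x \<in> X \<Longrightarrow> \<Theta> d x \<in> X"
  using \<Theta>_J J by blast

lemma lift_tendsto:
  assumes \<phi>: "functional \<phi>" and x: "x \<in> X"
  shows "((\<lambda>d. \<phi> (\<Theta> d x)) \<longlongrightarrow> lift \<phi> x) U"
proof -
  have "\<forall>\<^sub>F d in U. norm (\<phi> (\<Theta> d x)) \<le> dual_norm N X \<phi> * (C * N x)"
    using \<Theta>_bound
  proof eventually_elim
    case (elim d)
    have "norm (\<phi> (\<Theta> d x)) \<le> dual_norm N X \<phi> * N (\<Theta> d x)"
      by (rule norm_le_dual_norm[OF \<phi> \<Theta>_X[OF x]])
    also have "\<dots> \<le> dual_norm N X \<phi> * (C * N x)"
      using elim x dual_norm_nonneg[OF \<phi>] by (intro mult_left_mono) auto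
    finally show ?case .
  qed
  from ultra_tendsto_Lim[OF U this] show ?thesis using x by (simp add: lift_def)
qed

lemma lift_eqI:
  assumes "functional \<phi>" "x \<in> X" "((\<lambda>d. \<phi> (\<Theta> d x)) \<longlongrightarrow> l) U"
  shows "lift \<phi> x = l"
  by (rule tendsto_unique[OF nb lift_tendsto[OF assms(1,2)] assms(3)])

text \<open>Since \<open>\<Theta> d x\<close> lies in \<open>J\<close>, the size of
  \<open>\<phi>\<close> on \<open>J\<close> alone controls the lift on all of
  \<open>X\<close>.\<close>

lemma norm_lift_le:
  assumes \<phi>: "functional \<phi>" and b: "\<And>j. j \<in> J \<Longrightarrow> norm (\<phi> j) \<le> b * N j" "0 \<le> b" and x: "x \<in> X"
  shows "norm (lift \<phi> x) \<le> b * (C * N x)"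
proof (rule tendsto_upperbound[OF tendsto_norm[OF lift_tendsto[OF \<phi> x]] _ nb])
  show "\<forall>\<^sub>F d in U. norm (\<phi> (\<Theta> d x)) \<le> b * (C * N x)"
    using \<Theta>_bound
  proof eventually_elim
    case (elim d)
    have "norm (\<phi> (\<Theta> d x)) \<le> b * N (\<Theta> d x)" by (rule b(1)[OF \<Theta>_J[OF x]])
    also have "\<dots> \<le> b * (C * N x)" using elim x b(2) by (intro mult_left_mono) auto
    finally show ?case .
  qed
qed

lemma functional_lift:
  assumes \<phi>: "functional \<phi>"
  shows "functional (lift \<phi>)"
  unfolding functional_def
proof (intro conjI allI ballI exI)
  show "lift \<phi> (x + y) = lift \<phi> x + lift \<phi> y" if "x \<in> X" "y \<in> X" for x y
    using tendsto_add[OF lift_tendsto[OF \<phi> that(1)] lift_tendsto[OF \<phi> that(2)]] that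
    by (intro lift_eqI[OF \<phi>]) (auto simp: \<Theta>_add functional_add[OF \<phi>] \<Theta>_X)
  show "lift \<phi> (s a x) = a * lift \<phi> x" if "x \<in> X" for a x
    using tendsto_mult_left[OF lift_tendsto[OF \<phi> that], of a] that
    by (intro lift_eqI[OF \<phi>]) (auto simp: \<Theta>_scale functional_scale[OF \<phi>] \<Theta>_X)
  show "norm (lift \<phi> x) \<le> (dual_norm N X \<phi> * C) * N x" if "x \<in> X" for x
    unfolding mult.assoc
    using norm_le_dual_norm[OF \<phi>] J by (intro norm_lift_le[OF \<phi> _ dual_norm_nonneg[OF \<phi>] that]) auto
qed

lemma lift_dual: "\<phi> \<in> dual_space s N X \<Longrightarrow> lift \<phi> \<in> dual_space s N X"
  using functional_lift by (auto simp: dual_space_iff lift_def)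

lemma lift_on_J:
  assumes \<phi>: "functional \<phi>" and j: "j \<in> J"
  shows "lift \<phi> j = \<phi> j"
proof (rule lift_eqI[OF \<phi>])
  show jX: "j \<in> X" using j J by blast
  have "((\<lambda>d. \<phi> (\<Theta> d j) - \<phi> j) \<longlongrightarrow> 0) U"
  proof (rule Lim_null_comparison)
    show "\<forall>\<^sub>F d in U. norm (\<phi> (\<Theta> d j) - \<phi> j) \<le> dual_norm N X \<phi> * N (\<Theta> d j - j)"
    proof (rule always_eventually, rule allI)
      show "norm (\<phi> (\<Theta> d j) - \<phi> j) \<le> dual_norm N X \<phi> * N (\<Theta> d j - j)" for d
        unfolding functional_diff[OF \<phi> \<Theta>_X[OF jX] jX, symmetric]
        using jX \<Theta>_X[OF jX] by (intro norm_le_dual_norm[OF \<phi>]) auto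
    qed
    show "((\<lambda>d. dual_norm N X \<phi> * N (\<Theta> d j - j)) \<longlongrightarrow> 0) U"
      using tendsto_mult_left[OF \<Theta>_tendsto[OF j], of "dual_norm N X \<phi>"] by simp
  qed
  then show "((\<lambda>d. \<phi> (\<Theta> d j)) \<longlongrightarrow> \<phi> j) U" by (rule LIM_zero_cancel)
qed

lemma lift_cong_on_J: "(\<And>j. j \<in> J \<Longrightarrow> \<phi> j = \<psi> j) \<Longrightarrow> lift \<phi> = lift \<psi>"
  using \<Theta>_J by (simp add: lift_def fun_eq_iff)

lemma lift_add:
  assumes "functional \<phi>" "functional \<psi>"
  shows "lift (\<phi> + \<psi>) = lift \<phi> + lift \<psi>"
proof
  fix x show "lift (\<phi> + \<psi>) x = (lift \<phi> + lift \<psi>) x"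
    using tendsto_Lim[OF nb tendsto_add[OF lift_tendsto[OF assms(1)] lift_tendsto[OF assms(2)]], of x x]
    by (cases "x \<in> X") (auto simp: lift_def[of "\<phi> + \<psi>"], auto simp: lift_def)
qed

lemma lift_scale:
  assumes "functional \<phi>"
  shows "lift (fun_scale (*) a \<phi>) = fun_scale (*) a (lift \<phi>)"
proof
  fix x show "lift (fun_scale (*) a \<phi>) x = fun_scale (*) a (lift \<phi>) x"
    using tendsto_Lim[OF nb tendsto_mult_left[OF lift_tendsto[OF assms]], of x a]
    by (cases "x \<in> X") (auto simp: lift_def[of "fun_scale (*) a \<phi>"] fun_scale_def, auto simp: lift_def)
qed

end

text \<open>The two families give complementary inequalities. The limit \<open>\<sigma>\<close> from
  \<open>\<Phi>\<close> satisfies: the norm of \<open>\<phi>\<close> on \<open>J\<close> plus the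
  norm of \<open>\<phi> - \<sigma> \<phi>\<close> is at most the norm of \<open>\<phi>\<close>; this
  is the dual form of \<open>max\<close>. The limit \<open>\<pi>\<close> from \<open>\<Psi>\<close>
  has norm at most that of \<open>\<phi>\<close> on \<open>J\<close>. For \<open>\<Phi>\<close> any
  constant \<open>C\<close> suffices, as it only makes the limits exist and be bounded.\<close>

theorem M_ideal_criterion:
  fixes s :: "'k::real_or_complex \<Rightarrow> 'v::ab_group_add \<Rightarrow> 'v" and G :: "'d filter"
  assumes X: "seminormed_over s N X" and J: "closed_subspace s N J X" and G: "G \<noteq> bot"
    and \<Phi>_J: "\<And>d x. x \<in> X \<Longrightarrow> \<Phi> d x \<in> J"
    and \<Phi>_add: "\<And>d x y. x \<in> X \<Longrightarrow> y \<in> X \<Longrightarrow> \<Phi> d (x + y) = \<Phi> d x + \<Phi> d y"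
    and \<Phi>_scale: "\<And>d a x. x \<in> X \<Longrightarrow> \<Phi> d (s a x) = s a (\<Phi> d x)"
    and \<Phi>_bound: "\<forall>\<^sub>F d in G. \<forall>x\<in>X. N (\<Phi> d x) \<le> C * N x"
    and \<Phi>_tendsto: "\<And>j. j \<in> J \<Longrightarrow> ((\<lambda>d. N (\<Phi> d j - j)) \<longlongrightarrow> 0) G"
    and \<Psi>_J: "\<And>d x. x \<in> X \<Longrightarrow> \<Psi> d x \<in> J"
    and \<Psi>_add: "\<And>d x y. x \<in> X \<Longrightarrow> y \<in> X \<Longrightarrow> \<Psi> d (x + y) = \<Psi> d x + \<Psi> d y"
    and \<Psi>_scale: "\<And>d a x. x \<in> X \<Longrightarrow> \<Psi> d (s a x) = s a (\<Psi> d x)"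
    and \<Psi>_bound: "\<And>\<epsilon>. 0 < \<epsilon> \<Longrightarrow> \<forall>\<^sub>F d in G. \<forall>x\<in>X. N (\<Psi> d x) \<le> (1 + \<epsilon>) * N x"
    and \<Psi>_tendsto: "\<And>j. j \<in> J \<Longrightarrow> ((\<lambda>d. N (\<Psi> d j - j)) \<longlongrightarrow> 0) G"
    and max: "\<And>j x \<epsilon>. j \<in> J \<Longrightarrow> x \<in> X \<Longrightarrow> N j \<le> 1 \<Longrightarrow> N x \<le> 1 \<Longrightarrow> 0 < \<epsilon> \<Longrightarrow>
      \<forall>\<^sub>F d in G. N (j + (x - \<Phi> d x)) \<le> 1 + \<epsilon>"
  shows "M_ideal s N J X"
proof -
  interpret seminormed_over s N X by (rule X)
  obtain U where U: "U \<le> G" "ultra U" using ex_ultra_le[OF G] by blast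
  note ev = filter_leD[OF U(1)] and lim = filterlim_mono[OF _ order_refl U(1)]
  have JX: "J \<subseteq> X" and sJ: "subspace J" using J by (auto simp: closed_subspace_def)
  interpret \<sigma>: approx_identity s N X J U \<Phi> C
    using JX U \<Phi>_J \<Phi>_add \<Phi>_scale ev[OF \<Phi>_bound] lim[OF \<Phi>_tendsto] by unfold_locales auto
  \<comment> \<open>The lift depends on the family and the ultrafilter but not on the constant, so
    the bounds for all \<open>\<epsilon>\<close> concern one and the same functional and
    \<open>\<epsilon>\<close> can tend to 0.\<close>
  have \<pi>: "approx_identity s N X J U \<Psi> (1 + \<epsilon>)" if "0 < \<epsilon>" for \<epsilon>
    using JX U \<Psi>_J \<Psi>_add \<Psi>_scale ev[OF \<Psi>_bound[OF that]] lim[OF \<Psi>_tendsto] by unfold_locales auto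
  interpret \<pi>: approx_identity s N X J U \<Psi> "1 + 1" by (rule \<pi>) simp
  interpret J: seminormed_over s N J using sJ JX by (rule seminormed_subspace)
  let ?D = "dual_space s N X"
  have fun_J: "J.functional \<phi>" if "functional \<phi>" for \<phi>
    using that JX unfolding functional_def J.functional_def by blast
  have \<pi>_le: "dual_norm N X (\<pi>.lift \<phi>) \<le> dual_norm N J \<phi>" if \<phi>: "functional \<phi>" for \<phi>
  proof (rule dual_norm_least)
    fix x assume x: "x \<in> X" "N x \<le> 1"
    have d0: "0 \<le> dual_norm N J \<phi>" by (rule J.dual_norm_nonneg[OF fun_J[OF \<phi>]])
    have "norm (\<pi>.lift \<phi> x) \<le> dual_norm N J \<phi> * ((1 + \<epsilon>) * N x)" if "0 < \<epsilon>" for \<epsilon>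
      by (rule approx_identity.norm_lift_le[OF \<pi>[OF that] \<phi> J.norm_le_dual_norm[OF fun_J[OF \<phi>]] d0 x(1)])
    moreover have "((\<lambda>\<epsilon>. dual_norm N J \<phi> * ((1 + \<epsilon>) * N x)) \<longlongrightarrow> dual_norm N J \<phi> * ((1 + 0) * N x))
        (at_right 0)"
      by (intro tendsto_intros)
    ultimately have "norm (\<pi>.lift \<phi> x) \<le> dual_norm N J \<phi> * ((1 + 0) * N x)"
      by (intro tendsto_lowerbound[where F = "at_right (0::real)"])
        (auto intro: eventually_mono[OF eventually_at_right_less])
    also have "\<dots> \<le> dual_norm N J \<phi>" using mult_left_mono[OF x(2) d0] by simp
    finally show "norm (\<pi>.lift \<phi> x) \<le> dual_norm N J \<phi>" .
  qed
  have \<sigma>_le: "dual_norm N J \<phi> + dual_norm N X (\<phi> - \<sigma>.lift \<phi>) \<le> dual_norm N X \<phi>"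
    if \<phi>: "\<phi> \<in> ?D" for \<phi>
  proof (rule dual_norm_add_le[OF sJ JX])
    have f: "functional \<phi>" using \<phi> by (simp add: dual_space_iff)
    then show "functional \<phi>" .
    have "\<phi> - \<sigma>.lift \<phi> \<in> ?D" using \<phi> \<sigma>.lift_dual by (intro dual_space_diff)
    then show "functional (\<phi> - \<sigma>.lift \<phi>)" by (simp add: dual_space_iff)
    fix j x assume j: "j \<in> J" "N j \<le> 1" and x: "x \<in> X" "N x \<le> 1"
    have jX: "j \<in> X" using j JX by blast
    have "((\<lambda>d. \<phi> j + (\<phi> x - \<phi> (\<Phi> d x))) \<longlongrightarrow> \<phi> j + (\<phi> x - \<sigma>.lift \<phi> x)) U"
      using \<sigma>.lift_tendsto[OF f x(1)] by (intro tendsto_intros)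
    then have t: "((\<lambda>d. norm (\<phi> (j + (x - \<Phi> d x)))) \<longlongrightarrow> norm (\<phi> j + (\<phi> x - \<sigma>.lift \<phi> x))) U"
      using jX x \<sigma>.\<Theta>_X[OF x(1)] by (auto simp: functional_add[OF f] functional_diff[OF f] intro: tendsto_norm)
    have "norm (\<phi> j + (\<phi> x - \<sigma>.lift \<phi> x)) \<le> dual_norm N X \<phi> * (1 + \<epsilon>)" if "0 < \<epsilon>" for \<epsilon>
    proof (rule tendsto_upperbound[OF t _ \<sigma>.nb])
      show "\<forall>\<^sub>F d in U. norm (\<phi> (j + (x - \<Phi> d x))) \<le> dual_norm N X \<phi> * (1 + \<epsilon>)"
        using ev[OF max[OF j(1) x(1) j(2) x(2) that]]
      proof eventually_elim
        case (elim d)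
        have "norm (\<phi> (j + (x - \<Phi> d x))) \<le> dual_norm N X \<phi> * N (j + (x - \<Phi> d x))"
          using jX x \<sigma>.\<Theta>_X[OF x(1)] by (intro norm_le_dual_norm[OF f]) auto
        also have "\<dots> \<le> dual_norm N X \<phi> * (1 + \<epsilon>)"
          using elim dual_norm_nonneg[OF f] by (rule mult_left_mono)
        finally show ?case .
      qed
    qed
    moreover have "((\<lambda>\<epsilon>. dual_norm N X \<phi> * (1 + \<epsilon>)) \<longlongrightarrow> dual_norm N X \<phi> * (1 + 0)) (at_right 0)"
      by (intro tendsto_intros)
    ultimately have "norm (\<phi> j + (\<phi> x - \<sigma>.lift \<phi> x)) \<le> dual_norm N X \<phi> * (1 + 0)"
      by (intro tendsto_lowerbound[where F = "at_right (0::real)"])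
        (auto intro: eventually_mono[OF eventually_at_right_less])
    then show "norm (\<phi> j + (\<phi> - \<sigma>.lift \<phi>) x) \<le> dual_norm N X \<phi>" by simp
  qed
  text \<open>Both limits extend \<open>\<phi>\<close> from \<open>J\<close>. Applied to \<open>\<pi>.lift \<phi>\<close>, whose norm is already attained on
    \<open>J\<close>, the inequality for \<open>\<sigma>\<close> shows that they agree.\<close>
  have eq: "\<pi>.lift \<phi> = \<sigma>.lift \<phi>" if \<phi>: "\<phi> \<in> ?D" for \<phi>
  proof -
    have f: "functional \<phi>" using \<phi> by (simp add: dual_space_iff)
    have on_J: "\<pi>.lift \<phi> j = \<phi> j" if "j \<in> J" for j using \<pi>.lift_on_J[OF f that] .
    have D: "\<pi>.lift \<phi> \<in> ?D" by (rule \<pi>.lift_dual[OF \<phi>])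
    have "dual_norm N J (\<pi>.lift \<phi>) = dual_norm N J \<phi>" by (rule dual_norm_cong) (rule on_J)
    with \<sigma>_le[OF D] \<pi>_le[OF f] have "dual_norm N X (\<pi>.lift \<phi> - \<sigma>.lift (\<pi>.lift \<phi>)) \<le> 0" by simp
    then have "\<pi>.lift \<phi> - \<sigma>.lift (\<pi>.lift \<phi>) = 0"
      using D \<sigma>.lift_dual by (intro dual_space_eq_0 dual_space_diff)
    moreover have "\<sigma>.lift (\<pi>.lift \<phi>) = \<sigma>.lift \<phi>" by (rule \<sigma>.lift_cong_on_J) (rule on_J)
    ultimately show ?thesis by simp
  qed
  have "linear_projection_on ?D \<pi>.lift"
    unfolding linear_projection_on_def
  proof (intro conjI ballI allI)
    fix \<phi> assume \<phi>: "\<phi> \<in> ?D"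
    then have f: "functional \<phi>" by (simp add: dual_space_iff)
    show "\<pi>.lift \<phi> \<in> ?D" using \<phi> by (rule \<pi>.lift_dual)
    show "\<pi>.lift (\<pi>.lift \<phi>) = \<pi>.lift \<phi>"
      by (rule \<pi>.lift_cong_on_J) (rule \<pi>.lift_on_J[OF f])
    show "\<pi>.lift (fun_scale (*) a \<phi>) = fun_scale (*) a (\<pi>.lift \<phi>)" for a
      using f by (rule \<pi>.lift_scale)
    show "\<pi>.lift (\<phi> + \<psi>) = \<pi>.lift \<phi> + \<pi>.lift \<psi>" if "\<psi> \<in> ?D" for \<psi>
      using f that by (intro \<pi>.lift_add) (auto simp: dual_space_iff)
  qed
  moreover have "{\<phi> \<in> ?D. \<pi>.lift \<phi> = 0} = annihilator s N X J"
  proof (intro equalityI subsetI)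
    fix \<phi> assume "\<phi> \<in> {\<phi> \<in> ?D. \<pi>.lift \<phi> = 0}"
    then show "\<phi> \<in> annihilator s N X J"
      using \<pi>.lift_on_J[of \<phi>] by (auto simp: annihilator_def dual_space_iff)
  next
    fix \<phi> assume \<phi>: "\<phi> \<in> annihilator s N X J"
    then have "\<pi>.lift \<phi> = \<pi>.lift 0" by (intro \<pi>.lift_cong_on_J) (auto simp: annihilator_def)
    also have "\<dots> = 0" by (rule ext) (simp add: \<pi>.lift_def tendsto_Lim[OF \<pi>.nb tendsto_const])
    finally show "\<phi> \<in> {\<phi> \<in> ?D. \<pi>.lift \<phi> = 0}" using \<phi> by (simp add: annihilator_def)
  qed
  moreover have "dual_norm N X \<phi> = dual_norm N X (\<pi>.lift \<phi>) + dual_norm N X (\<phi> - \<pi>.lift \<phi>)"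
    if \<phi>: "\<phi> \<in> ?D" for \<phi>
  proof (rule antisym)
    have f: "functional \<phi>" using \<phi> by (simp add: dual_space_iff)
    show "dual_norm N X \<phi> \<le> dual_norm N X (\<pi>.lift \<phi>) + dual_norm N X (\<phi> - \<pi>.lift \<phi>)"
      using f \<pi>.functional_lift[OF f] by (rule dual_norm_diff_le)
    show "dual_norm N X (\<pi>.lift \<phi>) + dual_norm N X (\<phi> - \<pi>.lift \<phi>) \<le> dual_norm N X \<phi>"
      using \<sigma>_le[OF \<phi>] \<pi>_le[OF f] eq[OF \<phi>] by simp
  qed
  ultimately show ?thesis using J unfolding M_ideal_def by blast
qed


section \<open>Bounded and compact operators\<close>

lemma vector_space_fun_scale:
  assumes "vector_space s"
  shows "vector_space (fun_scale s)"
proof -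
  interpret vector_space s by fact
  show ?thesis
    by unfold_locales (auto simp: fun_scale_def fun_eq_iff algebra_simps)
qed

context normed_space_over
begin

sublocale seminormed_over scale norm UNIV
  by unfold_locales (auto simp: norm_scale norm_triangle_ineq)

lemma bounded_ops_iff:
  "T \<in> bounded_ops scale \<longleftrightarrow> (\<forall>x y. T (x + y) = T x + T y) \<and> (\<forall>a x. T (scale a x) = scale a (T x))
     \<and> (\<exists>K. \<forall>x. norm (T x) \<le> K * norm x)"
proof
  assume "T \<in> bounded_ops scale"
  then show "(\<forall>x y. T (x + y) = T x + T y) \<and> (\<forall>a x. T (scale a x) = scale a (T x))
     \<and> (\<exists>K. \<forall>x. norm (T x) \<le> K * norm x)"
    using bounded_linear.bounded[of T]
    by (auto simp: bounded_ops_def Vector_Spaces.linear_iff mult.commute)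
next
  assume R: "(\<forall>x y. T (x + y) = T x + T y) \<and> (\<forall>a x. T (scale a x) = scale a (T x))
     \<and> (\<exists>K. \<forall>x. norm (T x) \<le> K * norm x)"
  then obtain K where "\<And>x. norm (T x) \<le> K * norm x" by blast
  moreover have "T (r *\<^sub>R x) = r *\<^sub>R T x" for r x
    using R scale_of_real by metis
  ultimately have "bounded_linear T"
    using R by (intro bounded_linear_intro[where K = K]) (auto simp: mult.commute)
  then show "T \<in> bounded_ops scale"
    using R vector_space_axioms by (simp add: bounded_ops_def Vector_Spaces.linear_iff)
qed

lemma bounded_opsI:
  assumes "\<And>x y. T (x + y) = T x + T y" "\<And>a x. T (scale a x) = scale a (T x)"
    "\<And>x. norm (T x) \<le> K * norm x"
  shows "T \<in> bounded_ops scale"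
  using assms unfolding bounded_ops_iff by blast

lemma op_add: "T \<in> bounded_ops scale \<Longrightarrow> T (x + y) = T x + T y"
  and op_scale: "T \<in> bounded_ops scale \<Longrightarrow> T (scale a x) = scale a (T x)"
  by (auto simp: bounded_ops_iff)

lemma op_bounded_linear: "T \<in> bounded_ops scale \<Longrightarrow> bounded_linear T"
  by (simp add: bounded_ops_def)

lemma op_0: "T \<in> bounded_ops scale \<Longrightarrow> T 0 = 0"
  using op_scale[of T 0 0] by simp

lemma op_minus: "T \<in> bounded_ops scale \<Longrightarrow> T (- x) = - T x"
  using op_scale[of T "- 1" x] by simp

lemma op_diff: "T \<in> bounded_ops scale \<Longrightarrow> T (x - y) = T x - T y"
  using op_add[of T x "- y"] by (simp add: op_minus)

lemma op_boundE:
  assumes "T \<in> bounded_ops scale"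
  obtains K where "0 \<le> K" "\<And>x. norm (T x) \<le> K * norm x"
  using bounded_linear.nonneg_bounded[OF op_bounded_linear[OF assms]] by (metis mult.commute)

lemma bounded_ops_add:
  assumes "S \<in> bounded_ops scale" "T \<in> bounded_ops scale"
  shows "S + T \<in> bounded_ops scale"
proof -
  obtain K L where K: "\<And>x. norm (S x) \<le> K * norm x" and L: "\<And>x. norm (T x) \<le> L * norm x"
    using assms by (metis op_boundE)
  show ?thesis
  proof (rule bounded_opsI)
    show "norm ((S + T) x) \<le> (K + L) * norm x" for x
      using norm_triangle_ineq[of "S x" "T x"] K[of x] L[of x] by (simp add: distrib_right)
  qed (use assms in \<open>simp_all add: op_add op_scale algebra_simps\<close>)
qed

lemma bounded_ops_fun_scale:
  assumes "T \<in> bounded_ops scale"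
  shows "fun_scale scale a T \<in> bounded_ops scale"
proof -
  obtain K where K: "\<And>x. norm (T x) \<le> K * norm x" using assms by (metis op_boundE)
  show ?thesis
  proof (rule bounded_opsI)
    show "norm (fun_scale scale a T x) \<le> (norm a * K) * norm x" for x
      using K[of x] by (simp add: fun_scale_def norm_scale mult.assoc mult_left_mono)
  qed (use assms in \<open>simp_all add: fun_scale_def op_add op_scale algebra_simps\<close>)
qed

lemma bounded_ops_id: "(\<lambda>x. x) \<in> bounded_ops scale"
  by (rule bounded_opsI[where K = 1]) auto

lemma bounded_ops_compose:
  assumes "S \<in> bounded_ops scale" "T \<in> bounded_ops scale"
  shows "S \<circ> T \<in> bounded_ops scale"
proof -
  obtain K L where K: "0 \<le> K" "\<And>x. norm (S x) \<le> K * norm x" and L: "\<And>x. norm (T x) \<le> L * norm x"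
    using assms by (metis op_boundE)
  show ?thesis
  proof (rule bounded_opsI)
    show "norm ((S \<circ> T) x) \<le> (K * L) * norm x" for x
      using order_trans[OF K(2)[of "T x"] mult_left_mono[OF L K(1)]] by (simp add: mult.assoc)
  qed (use assms in \<open>simp_all add: op_add op_scale\<close>)
qed

lemma subspace_bounded_ops: "module.subspace (fun_scale scale) (bounded_ops scale)"
proof -
  interpret F: vector_space "fun_scale scale" by (rule vector_space_fun_scale) (rule vector_space_axioms)
  show ?thesis
  proof (rule F.subspaceI)
    show "0 \<in> bounded_ops scale" by (rule bounded_opsI[where K = 0]) auto
  qed (auto intro: bounded_ops_add bounded_ops_fun_scale)
qed

lemma compact_opsI:
  assumes T: "T \<in> bounded_ops scale" and c: "\<And>B. bounded B \<Longrightarrow> \<exists>C. compact C \<and> T ` B \<subseteq> C"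
  shows "T \<in> compact_ops scale"
proof -
  have "compact (closure (T ` B))" if B: "bounded B" for B
  proof -
    obtain C where C: "compact C" "T ` B \<subseteq> C" using c[OF B] by blast
    then have "closure (T ` B) \<subseteq> C" by (simp add: closure_minimal compact_imp_closed)
    then show ?thesis using C(1) compact_Int_closed[of C "closure (T ` B)"] by (simp add: Int_absorb1)
  qed
  then show ?thesis using T by (simp add: compact_ops_def)
qed

lemma compact_ops_bounded: "T \<in> compact_ops scale \<Longrightarrow> T \<in> bounded_ops scale"
  by (simp add: compact_ops_def)

lemma compact_opsE:
  assumes "T \<in> compact_ops scale" "bounded B"
  obtains C where "compact C" "T ` B \<subseteq> C"
  using assms closure_subset[of "T ` B"] by (auto simp: compact_ops_def)

lemma compact_ops_compose_left:
  assumes S: "S \<in> bounded_ops scale" and T: "T \<in> compact_ops scale"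
  shows "S \<circ> T \<in> compact_ops scale"
proof (rule compact_opsI)
  show "S \<circ> T \<in> bounded_ops scale" using S T by (simp add: bounded_ops_compose compact_ops_bounded)
  fix B :: "'e set" assume B: "bounded B"
  obtain C where C: "compact C" "T ` B \<subseteq> C" using compact_opsE[OF T B] by blast
  have "continuous_on C S" using op_bounded_linear[OF S] by (rule linear_continuous_on)
  then have "compact (S ` C)" using C(1) by (rule compact_continuous_image)
  then show "\<exists>C. compact C \<and> (S \<circ> T) ` B \<subseteq> C" using C(2) by (intro exI[of _ "S ` C"]) auto
qed

lemma compact_ops_compose_right:
  assumes S: "S \<in> bounded_ops scale" and T: "T \<in> compact_ops scale"
  shows "T \<circ> S \<in> compact_ops scale"
proof (rule compact_opsI)
  show "T \<circ> S \<in> bounded_ops scale" using S T by (simp add: bounded_ops_compose compact_ops_bounded)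
  fix B :: "'e set" assume B: "bounded B"
  have "bounded (S ` B)" using B op_bounded_linear[OF S] by (rule bounded_linear_image)
  then obtain C where "compact C" "T ` (S ` B) \<subseteq> C" using compact_opsE[OF T] by metis
  then show "\<exists>C. compact C \<and> (T \<circ> S) ` B \<subseteq> C" by auto
qed

lemma subspace_compact_ops: "module.subspace (fun_scale scale) (compact_ops scale)"
proof -
  interpret F: vector_space "fun_scale scale" by (rule vector_space_fun_scale) (rule vector_space_axioms)
  show ?thesis
  proof (rule F.subspaceI)
    show "0 \<in> compact_ops scale"
      using F.subspace_0[OF subspace_bounded_ops] by (intro compact_opsI) (auto intro!: exI[of _ "{0}"])
    fix S T assume S: "S \<in> compact_ops scale" and T: "T \<in> compact_ops scale"
    show "S + T \<in> compact_ops scale"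
    proof (rule compact_opsI)
      show "S + T \<in> bounded_ops scale" using S T by (simp add: bounded_ops_add compact_ops_bounded)
      fix B :: "'e set" assume B: "bounded B"
      obtain C C' where "compact C" "S ` B \<subseteq> C" "compact C'" "T ` B \<subseteq> C'"
        using compact_opsE[OF S B] compact_opsE[OF T B] by metis
      then show "\<exists>C. compact C \<and> (S + T) ` B \<subseteq> C"
        by (intro exI[of _ "{x + y | x y. x \<in> C \<and> y \<in> C'}"] conjI compact_sums) (auto, blast)
    qed
  next
    fix a T assume T: "T \<in> compact_ops scale"
    have "(\<lambda>x. x) \<in> bounded_ops scale" by (rule bounded_ops_id)
    then have "fun_scale scale a (\<lambda>x. x) \<circ> T \<in> compact_ops scale"
      using T by (intro compact_ops_compose_left bounded_ops_fun_scale)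
    then show "fun_scale scale a T \<in> compact_ops scale" by (simp add: fun_scale_def comp_def)
  qed
qed

lemma continuous_scale_left: "continuous_on A (\<lambda>a. scale a z)"
proof (rule continuous_onI)
  fix a e assume "0 < (e::real)"
  then show "\<exists>d>0. \<forall>a'\<in>A. dist a' a < d \<longrightarrow> dist (scale a' z) (scale a z) \<le> e"
  proof (intro exI[of _ "e / (norm z + 1)"] conjI ballI impI)
    fix a' assume "dist a' a < e / (norm z + 1)"
    then have "dist a' a * (norm z + 1) \<le> e"
      by (simp add: pos_less_divide_eq add_nonneg_pos less_imp_le)
    moreover have "dist (scale a' z) (scale a z) = dist a' a * norm z"
      by (simp add: dist_norm norm_scale flip: scale_left_diff_distrib)
    moreover have "dist a' a * norm z \<le> dist a' a * (norm z + 1)" by (simp add: mult_left_mono)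
    ultimately show "dist (scale a' z) (scale a z) \<le> e" by linarith
  qed (auto simp: add_nonneg_pos)
qed

lemma rank_one_compact:
  assumes f: "functional f"
  shows "(\<lambda>x. scale (f x) z) \<in> compact_ops scale"
proof (rule compact_opsI)
  obtain C where C: "0 \<le> C" "\<And>x. norm (f x) \<le> C * norm x" using functional_boundE[OF f] by auto
  show "(\<lambda>x. scale (f x) z) \<in> bounded_ops scale"
  proof (rule bounded_opsI)
    show "norm (scale (f x) z) \<le> (C * norm z) * norm x" for x
      using mult_right_mono[OF C(2)[of x], of "norm z"] by (simp add: norm_scale mult_ac)
  qed (simp_all add: functional_add[OF f] functional_scale[OF f] scale_left_distrib)
  fix B :: "'e set" assume "bounded B"
  then obtain b where b: "\<And>x. x \<in> B \<Longrightarrow> norm x \<le> b" by (auto simp: bounded_iff)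
  have "f x \<in> cball 0 (C * b)" if "x \<in> B" for x
    using C(2)[of x] mult_left_mono[OF b[OF that] C(1)] by simp
  then show "\<exists>D. compact D \<and> (\<lambda>x. scale (f x) z) ` B \<subseteq> D"
    by (intro exI[of _ "(\<lambda>a. scale a z) ` cball 0 (C * b)"])
      (auto intro!: compact_continuous_image continuous_scale_left compact_cball_scalar)
qed

lemma dual_space_UNIV_iff: "\<phi> \<in> dual_space scale norm UNIV \<longleftrightarrow> functional \<phi>"
  by (simp add: dual_space_iff)

lemma ex_norming_functional:
  "\<exists>\<phi>. functional \<phi> \<and> (\<forall>x. norm (\<phi> x) \<le> norm x) \<and> \<phi> x0 = of_real (norm x0)"
proof -
  obtain \<phi> where "\<forall>x y. \<phi> (x + y) = \<phi> x + \<phi> y" "\<forall>a x. \<phi> (scale a x) = a * \<phi> x"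
    "\<forall>x. norm (\<phi> x) \<le> norm x" "\<phi> x0 = of_real (norm x0)"
    using hahn_banach_point[of x0] by auto
  then show ?thesis by (intro exI[of _ \<phi>]) (auto intro!: functionalI[where C = 1])
qed

end


section \<open>Projections of M-ideals\<close>

locale M_projection = seminormed_over s N X
  for s :: "'k::real_or_complex \<Rightarrow> 'v::ab_group_add \<Rightarrow> 'v" and N X +
  fixes J :: "'v set" and \<pi> :: "('v \<Rightarrow> 'k) \<Rightarrow> 'v \<Rightarrow> 'k"
  assumes J: "closed_subspace s N J X"
    and proj: "linear_projection_on (dual_space s N X) \<pi>"
    and ker: "{\<phi> \<in> dual_space s N X. \<pi> \<phi> = 0} = annihilator s N X J"
    and norm_sum: "\<And>\<phi>. \<phi> \<in> dual_space s N X \<Longrightarrow>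
      dual_norm N X \<phi> = dual_norm N X (\<pi> \<phi>) + dual_norm N X (\<phi> - \<pi> \<phi>)"
begin

abbreviation D where "D \<equiv> dual_space s N X"

lemma JX: "J \<subseteq> X" and subspace_J: "subspace J"
  using J by (auto simp: closed_subspace_def)

lemma proj_D: "\<phi> \<in> D \<Longrightarrow> \<pi> \<phi> \<in> D"
  and proj_proj: "\<phi> \<in> D \<Longrightarrow> \<pi> (\<pi> \<phi>) = \<pi> \<phi>"
  and proj_add: "\<phi> \<in> D \<Longrightarrow> \<psi> \<in> D \<Longrightarrow> \<pi> (\<phi> + \<psi>) = \<pi> \<phi> + \<pi> \<psi>"
  and proj_scale: "\<phi> \<in> D \<Longrightarrow> \<pi> (fun_scale (*) a \<phi>) = fun_scale (*) a (\<pi> \<phi>)"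
  using proj unfolding linear_projection_on_def by blast+

lemma proj_diff: "\<phi> \<in> D \<Longrightarrow> \<psi> \<in> D \<Longrightarrow> \<pi> (\<phi> - \<psi>) = \<pi> \<phi> - \<pi> \<psi>"
  using proj_add[of "\<phi> - \<psi>" \<psi>] dual_space_diff[of \<phi> \<psi>] by (simp add: algebra_simps)

lemma proj_eq_0_iff: "\<phi> \<in> D \<Longrightarrow> \<pi> \<phi> = 0 \<longleftrightarrow> (\<forall>j\<in>J. \<phi> j = 0)"
  using ker by (auto simp: annihilator_def)

lemma proj_on_J:
  assumes "\<phi> \<in> D" "j \<in> J"
  shows "\<pi> \<phi> j = \<phi> j"
proof -
  have "\<pi> (\<phi> - \<pi> \<phi>) = 0" using assms by (simp add: proj_diff proj_D proj_proj)
  moreover have "\<phi> - \<pi> \<phi> \<in> D" using assms by (simp add: dual_space_diff proj_D)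
  ultimately show ?thesis using assms(2) by (simp add: proj_eq_0_iff)
qed

text \<open>\<open>\<pi> \<phi>\<close> agrees with \<open>\<phi>\<close> on \<open>J\<close>, so it
  already has the full norm of \<open>\<phi>\<close>, and the norm identity leaves nothing for
  \<open>\<phi> - \<pi> \<phi>\<close>.\<close>

lemma proj_fixed:
  assumes \<phi>: "\<phi> \<in> D" and le: "dual_norm N X \<phi> \<le> dual_norm N J \<phi>"
  shows "\<pi> \<phi> = \<phi>"
proof -
  interpret J: seminormed_over s N J by (rule seminormed_subspace[OF subspace_J JX])
  have f: "functional (\<pi> \<phi>)" using proj_D[OF \<phi>] by (simp add: dual_space_iff)
  have "dual_norm N J \<phi> \<le> dual_norm N X (\<pi> \<phi>)"
  proof (rule J.dual_norm_least)
    fix j assume "j \<in> J" "N j \<le> 1"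
    then show "norm (\<phi> j) \<le> dual_norm N X (\<pi> \<phi>)"
      using dual_norm_upper[OF f, of j] JX proj_on_J[OF \<phi>] by auto
  qed
  then have "dual_norm N X (\<phi> - \<pi> \<phi>) \<le> 0" using le norm_sum[OF \<phi>] by simp
  then have "\<phi> - \<pi> \<phi> = 0" using \<phi> proj_D by (intro dual_space_eq_0 dual_space_diff)
  then show ?thesis by simp
qed

section \<open>Operators whose adjoints commute with the projection\<close>

text \<open>The adjoint of \<open>\<tau>\<close>, set to 0 off \<open>X\<close> so that it stays
  inside \<open>D\<close>.\<close>

definition pull :: "('v \<Rightarrow> 'v) \<Rightarrow> ('v \<Rightarrow> 'k) \<Rightarrow> 'v \<Rightarrow> 'k" where
  "pull \<tau> \<phi> = (\<lambda>x. if x \<in> X then \<phi> (\<tau> x) else 0)"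

text \<open>Bounded operators that leave \<open>J\<close> invariant: their adjoints preserve the
  annihilator of \<open>J\<close>, which is the kernel of \<open>\<pi>\<close>.\<close>

definition admissible :: "('v \<Rightarrow> 'v) \<Rightarrow> bool" where
  "admissible \<tau> \<longleftrightarrow> (\<forall>x\<in>X. \<tau> x \<in> X) \<and> (\<forall>x\<in>J. \<tau> x \<in> J)
     \<and> (\<forall>x\<in>X. \<forall>y\<in>X. \<tau> (x + y) = \<tau> x + \<tau> y) \<and> (\<forall>a. \<forall>x\<in>X. \<tau> (s a x) = s a (\<tau> x))
     \<and> (\<exists>C\<ge>0. \<forall>x\<in>X. N (\<tau> x) \<le> C * N x)"

lemma pull_D:
  assumes \<tau>: "admissible \<tau>" and \<phi>: "\<phi> \<in> D"
  shows "pull \<tau> \<phi> \<in> D"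
proof -
  have f: "functional \<phi>" using \<phi> by (simp add: dual_space_iff)
  obtain C where C: "\<And>x. x \<in> X \<Longrightarrow> N (\<tau> x) \<le> C * N x"
    using \<tau> unfolding admissible_def by blast
  obtain C' where C': "0 \<le> C'" "\<And>x. x \<in> X \<Longrightarrow> norm (\<phi> x) \<le> C' * N x"
    using functional_boundE[OF f] by blast
  have "functional (\<lambda>x. \<phi> (\<tau> x))"
  proof (rule functionalI)
    show "norm (\<phi> (\<tau> x)) \<le> (C' * C) * N x" if "x \<in> X" for x
      using order_trans[OF C'(2) mult_left_mono[OF C[OF that] C'(1)]] \<tau> that
      by (simp add: admissible_def mult.assoc)
  qed (use \<tau> in \<open>simp_all add: admissible_def functional_add[OF f] functional_scale[OF f]\<close>)
  then show ?thesis by (simp add: dual_space_iff pull_def)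
qed

lemma proj_pull_annihilator:
  assumes \<tau>: "admissible \<tau>" and \<phi>: "\<phi> \<in> D" "\<pi> \<phi> = 0"
  shows "\<pi> (pull \<tau> \<phi>) = 0"
  using \<phi> \<tau> proj_eq_0_iff[OF pull_D[OF \<tau> \<phi>(1)]] JX
  by (auto simp: pull_def admissible_def proj_eq_0_iff)

lemma dual_norm_pull_isometry:
  assumes \<tau>: "admissible \<tau>" and iso: "\<And>x. x \<in> X \<Longrightarrow> N (\<tau> x) = N x" and \<phi>: "\<phi> \<in> D"
  shows "dual_norm N X (pull \<tau> \<phi>) \<le> dual_norm N X \<phi>"
proof (rule dual_norm_least)
  have f: "functional \<phi>" using \<phi> by (simp add: dual_space_iff)
  fix x assume "x \<in> X" "N x \<le> 1"
  then show "norm (pull \<tau> \<phi> x) \<le> dual_norm N X \<phi>"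
    using \<tau> iso dual_norm_upper[OF f, of "\<tau> x"] by (simp add: pull_def admissible_def)
qed

definition commutes :: "('v \<Rightarrow> 'v) \<Rightarrow> bool" where
  "commutes \<tau> \<longleftrightarrow> admissible \<tau> \<and> (\<forall>\<phi>\<in>D. \<pi> (pull \<tau> \<phi>) = pull \<tau> (\<pi> \<phi>))"

text \<open>If \<open>\<psi>\<close> is in the range of \<open>\<pi>\<close>, then so is \<open>\<psi> \<circ> \<tau>\<close>: splitting \<open>\<psi> \<circ> \<tau>\<close> along \<open>\<pi>\<close> and
  pulling the two parts back by \<open>\<tau>\<close> leaves no norm for the part that annihilates \<open>J\<close>.\<close>

lemma commutes_involution:
  assumes \<tau>: "admissible \<tau>" and iso: "\<And>x. x \<in> X \<Longrightarrow> N (\<tau> x) = N x"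
    and inv: "\<And>x. x \<in> X \<Longrightarrow> \<tau> (\<tau> x) = x"
  shows "commutes \<tau>"
  unfolding commutes_def
proof (intro conjI ballI \<tau>)
  have \<tau>X: "\<tau> x \<in> X" if "x \<in> X" for x using \<tau> that by (simp add: admissible_def)
  have pull_pull: "pull \<tau> (pull \<tau> \<phi>) = \<phi>" if "\<phi> \<in> D" for \<phi>
    using that \<tau>X inv by (auto simp: pull_def dual_space_iff fun_eq_iff)
  have pull_diff: "pull \<tau> (\<phi> - \<psi>) = pull \<tau> \<phi> - pull \<tau> \<psi>" for \<phi> \<psi>
    by (auto simp: pull_def fun_eq_iff)
  have ran: "\<pi> (pull \<tau> \<psi>) = pull \<tau> \<psi>" if \<psi>: "\<psi> \<in> D" "\<pi> \<psi> = \<psi>" for \<psi>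
  proof -
    let ?\<xi> = "pull \<tau> \<psi>"
    define \<rho> where "\<rho> = ?\<xi> - \<pi> ?\<xi>"
    have \<xi>: "?\<xi> \<in> D" using \<tau> \<psi>(1) by (rule pull_D)
    have p\<xi>: "\<pi> ?\<xi> \<in> D" using \<xi> by (rule proj_D)
    have \<rho>: "\<rho> \<in> D" "\<pi> \<rho> = 0"
      using \<xi> p\<xi> by (simp_all add: \<rho>_def dual_space_diff proj_diff proj_proj)
    have "\<psi> = pull \<tau> (\<pi> ?\<xi>) + pull \<tau> \<rho>"
      using pull_pull[OF \<psi>(1)] by (simp add: \<rho>_def pull_diff)
    then have "\<psi> = \<pi> (pull \<tau> (\<pi> ?\<xi>)) + \<pi> (pull \<tau> \<rho>)"
      using \<psi>(2) proj_add[OF pull_D[OF \<tau> p\<xi>] pull_D[OF \<tau> \<rho>(1)]] by simp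
    then have "\<psi> = \<pi> (pull \<tau> (\<pi> ?\<xi>))"
      using proj_pull_annihilator[OF \<tau> \<rho>] by simp
    moreover have "dual_norm N X (\<pi> \<phi>) \<le> dual_norm N X \<phi>" if "\<phi> \<in> D" for \<phi>
      using norm_sum[OF that] dual_norm_nonneg[of "\<phi> - \<pi> \<phi>"] dual_space_diff[OF that proj_D[OF that]]
      by (simp add: dual_space_iff)
    ultimately have "dual_norm N X \<psi> \<le> dual_norm N X (pull \<tau> (\<pi> ?\<xi>))"
      using pull_D[OF \<tau> p\<xi>] by metis
    also have "\<dots> \<le> dual_norm N X (\<pi> ?\<xi>)" by (rule dual_norm_pull_isometry[OF \<tau> iso p\<xi>])
    finally have "dual_norm N X \<psi> \<le> dual_norm N X (\<pi> ?\<xi>)" .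
    moreover have "dual_norm N X ?\<xi> \<le> dual_norm N X \<psi>"
      by (rule dual_norm_pull_isometry[OF \<tau> iso \<psi>(1)])
    ultimately have "dual_norm N X \<rho> \<le> 0" using norm_sum[OF \<xi>] by (simp add: \<rho>_def)
    then have "\<rho> = 0" using \<rho>(1) by (rule dual_space_eq_0[rotated])
    then show ?thesis by (simp add: \<rho>_def)
  qed
  fix \<phi> assume \<phi>: "\<phi> \<in> D"
  have p: "\<pi> \<phi> \<in> D" and d: "\<phi> - \<pi> \<phi> \<in> D" using \<phi> by (simp_all add: proj_D dual_space_diff)
  \<comment> \<open>The adjoint preserves the range of \<open>\<pi>\<close> by \<open>ran\<close>
    and its kernel by admissibility; splitting \<open>\<phi>\<close> into the two parts gives
    commutation.\<close>
  have "\<pi> (pull \<tau> \<phi> - pull \<tau> (\<pi> \<phi>)) = 0"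
    using proj_pull_annihilator[OF \<tau> d] \<phi> p by (simp add: pull_diff proj_diff proj_proj)
  then show "\<pi> (pull \<tau> \<phi>) = pull \<tau> (\<pi> \<phi>)"
    using ran[OF p proj_proj[OF \<phi>]] \<phi> p \<tau> by (simp add: proj_diff pull_D)
qed

lemma commutes_compose:
  assumes \<sigma>: "commutes \<sigma>" and \<tau>: "commutes \<tau>"
  shows "commutes (\<lambda>x. \<sigma> (\<tau> x))"
proof -
  obtain C C' where C: "0 \<le> C" "\<And>x. x \<in> X \<Longrightarrow> N (\<sigma> x) \<le> C * N x"
    and C': "0 \<le> C'" "\<And>x. x \<in> X \<Longrightarrow> N (\<tau> x) \<le> C' * N x"
    using \<sigma> \<tau> unfolding commutes_def admissible_def by metis
  have \<tau>X: "\<tau> x \<in> X" if "x \<in> X" for x using \<tau> that by (simp add: commutes_def admissible_def)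
  have "N (\<sigma> (\<tau> x)) \<le> (C * C') * N x" if "x \<in> X" for x
    using order_trans[OF C(2)[OF \<tau>X[OF that]] mult_left_mono[OF C'(2)[OF that] C(1)]]
    by (simp add: mult.assoc)
  moreover have "0 \<le> C * C'" using C C' by simp
  ultimately have "admissible (\<lambda>x. \<sigma> (\<tau> x))"
    using \<sigma> \<tau> unfolding commutes_def admissible_def by auto
  moreover have "pull (\<lambda>x. \<sigma> (\<tau> x)) \<phi> = pull \<tau> (pull \<sigma> \<phi>)" for \<phi>
    using \<tau>X by (auto simp: pull_def fun_eq_iff)
  ultimately show ?thesis
    using \<sigma> \<tau> pull_D[of \<sigma>] proj_D unfolding commutes_def by metis
qed

text \<open>For an involution the average with the identity is the projection onto the fixed points.
  In this way commutation passes from isometries to compressions, which are not isometric.\<close>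

lemma commutes_average:
  assumes \<sigma>: "commutes \<sigma>"
  shows "commutes (\<lambda>x. s (1 / 2) (x + \<sigma> x))"
proof -
  have \<sigma>X: "\<sigma> x \<in> X" if "x \<in> X" for x using \<sigma> that by (simp add: commutes_def admissible_def)
  obtain C where C: "0 \<le> C" "\<And>x. x \<in> X \<Longrightarrow> N (\<sigma> x) \<le> C * N x"
    using \<sigma> unfolding commutes_def admissible_def by metis
  have "N (s (1 / 2) (x + \<sigma> x)) \<le> (1 / 2 * (1 + C)) * N x" if "x \<in> X" for x
  proof -
    have "N (s (1 / 2) (x + \<sigma> x)) = 1 / 2 * N (x + \<sigma> x)"
      using \<sigma>X[OF that] that N_scale[of "x + \<sigma> x" "1 / 2"] by (simp add: norm_divide)
    then show ?thesis
      using N_add[OF that \<sigma>X[OF that]] C(2)[OF that] by (simp add: distrib_right)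
  qed
  moreover have "0 \<le> 1 / 2 * (1 + C)" using C by simp
  ultimately have ad: "admissible (\<lambda>x. s (1 / 2) (x + \<sigma> x))"
    using \<sigma> subspace_add[OF subspace_J] subspace_scale[OF subspace_J]
    unfolding commutes_def admissible_def
    by (auto simp: scale_right_distrib add_ac mult.commute simp del: scale_scale intro: exI[of _ "1/2 * (1 + C)"])
       (auto simp: mult.commute)
  moreover have "\<pi> (pull (\<lambda>x. s (1 / 2) (x + \<sigma> x)) \<phi>) = pull (\<lambda>x. s (1 / 2) (x + \<sigma> x)) (\<pi> \<phi>)"
    if \<phi>: "\<phi> \<in> D" for \<phi>
  proof -
    have eq: "pull (\<lambda>x. s (1 / 2) (x + \<sigma> x)) \<psi> = fun_scale (*) (1 / 2) (\<psi> + pull \<sigma> \<psi>)"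
      if "\<psi> \<in> D" for \<psi>
    proof
      fix x
      have f: "functional \<psi>" using that by (simp add: dual_space_iff)
      show "pull (\<lambda>x. s (1 / 2) (x + \<sigma> x)) \<psi> x = fun_scale (*) (1 / 2) (\<psi> + pull \<sigma> \<psi>) x"
        using that \<sigma>X functional_scale[OF f, of "x + \<sigma> x" "1/2"]
        by (cases "x \<in> X") (auto simp: pull_def fun_scale_def functional_add[OF f] dual_space_iff simp del: scale_right_distrib)
    qed
    have "pull \<sigma> \<phi> \<in> D" using \<sigma> \<phi> by (auto simp: commutes_def intro: pull_D)
    then show ?thesis
      using \<sigma> \<phi> by (simp add: eq proj_D proj_scale proj_add dual_space_add commutes_def)
  qed
  ultimately show ?thesis by (simp add: commutes_def)
qed

end


section \<open>\<open>(M\<^sub>\<infinity>)\<close>-spaces\<close>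

lemma max_norm_scale:
  assumes "normed_space_over s"
  shows "max_norm (prod_scale s a p) = norm a * max_norm p"
proof -
  interpret normed_space_over s by fact
  show ?thesis by (simp add: max_norm_def prod_scale_def norm_scale max_mult_distrib_left)
qed

lemma max_norm_add: "max_norm (p + q) \<le> max_norm p + max_norm q"
  using norm_triangle_ineq[of "fst p" "fst q"] norm_triangle_ineq[of "snd p" "snd q"]
  by (auto simp: max_norm_def max_def)

lemma max_norm_nonneg: "0 \<le> max_norm p"
  by (simp add: max_norm_def le_max_iff_disj)

lemma normed_space_over_prod:
  assumes "normed_space_over s"
  shows "normed_space_over (prod_scale s)"
proof -
  interpret normed_space_over s by fact
  show ?thesis
  proof unfold_locales
    show "norm (prod_scale s a x) = norm a * norm x" for a x
    proof -
      have "norm (prod_scale s a x) = sqrt ((norm a)\<^sup>2 * ((norm (fst x))\<^sup>2 + (norm (snd x))\<^sup>2))"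
        by (simp add: norm_prod_def prod_scale_def norm_scale power_mult_distrib distrib_left)
      also have "\<dots> = norm a * norm x" by (simp add: real_sqrt_mult norm_prod_def)
      finally show ?thesis .
    qed
  qed (auto simp: prod_scale_def prod_eq_iff scale_of_real algebra_simps)
qed

locale M_infty = F: normed_space_over s
  for s :: "'k::real_or_complex \<Rightarrow> 'f::real_normed_vector \<Rightarrow> 'f" +
  fixes \<pi> :: "(('f \<times> 'f \<Rightarrow> 'f \<times> 'f) \<Rightarrow> 'k) \<Rightarrow> ('f \<times> 'f \<Rightarrow> 'f \<times> 'f) \<Rightarrow> 'k"
  assumes closed: "closed_subspace (fun_scale (prod_scale s)) (op_norm max_norm)
      (compact_ops (prod_scale s)) (bounded_ops (prod_scale s))"
    and proj: "linear_projection_on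
      (dual_space (fun_scale (prod_scale s)) (op_norm max_norm) (bounded_ops (prod_scale s))) \<pi>"
    and ker: "{\<phi> \<in> dual_space (fun_scale (prod_scale s)) (op_norm max_norm) (bounded_ops (prod_scale s)).
        \<pi> \<phi> = 0} = annihilator (fun_scale (prod_scale s)) (op_norm max_norm)
          (bounded_ops (prod_scale s)) (compact_ops (prod_scale s))"
    and norm_sum: "\<And>\<phi>. \<phi> \<in> dual_space (fun_scale (prod_scale s)) (op_norm max_norm)
        (bounded_ops (prod_scale s)) \<Longrightarrow>
      dual_norm (op_norm max_norm) (bounded_ops (prod_scale s)) \<phi>
      = dual_norm (op_norm max_norm) (bounded_ops (prod_scale s)) (\<pi> \<phi>)
        + dual_norm (op_norm max_norm) (bounded_ops (prod_scale s)) (\<phi> - \<pi> \<phi>)"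
begin

abbreviation "s2 \<equiv> prod_scale s"
abbreviation "L \<equiv> bounded_ops s2"
abbreviation "N \<equiv> op_norm (max_norm :: 'f \<times> 'f \<Rightarrow> real)"

sublocale P: normed_space_over s2
  by (rule normed_space_over_prod) (rule F.normed_space_over_axioms)

lemma op_norm_bdd:
  assumes "T \<in> L"
  shows "bdd_above ((\<lambda>p. max_norm (T p)) ` {p. max_norm p \<le> 1})"
proof -
  obtain K where K: "0 \<le> K" "\<And>p. norm (T p) \<le> K * norm p" using P.op_boundE[OF assms] by metis
  show ?thesis
  proof (rule bdd_aboveI2)
    fix p :: "'f \<times> 'f" assume "p \<in> {p. max_norm p \<le> 1}"
    then have "norm p \<le> 2" using max_norm_equivalent(2)[of p] by simp
    then have "K * norm p \<le> K * 2" using K(1) by (rule mult_left_mono)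
    then show "max_norm (T p) \<le> K * 2"
      using max_norm_equivalent(1)[of "T p"] K(2)[of p] by linarith
  qed
qed

lemma op_norm_upper: "T \<in> L \<Longrightarrow> max_norm p \<le> 1 \<Longrightarrow> max_norm (T p) \<le> N T"
  unfolding op_norm_def by (intro cSUP_upper op_norm_bdd) auto

lemma op_norm_least: "(\<And>p. max_norm p \<le> 1 \<Longrightarrow> max_norm (T p) \<le> b) \<Longrightarrow> N T \<le> b"
  unfolding op_norm_def by (rule cSUP_least) (auto simp: max_norm_def intro!: exI[of _ 0])

lemma max_norm_op_le:
  assumes T: "T \<in> L"
  shows "max_norm (T p) \<le> N T * max_norm p"
proof (cases "max_norm p = 0")
  case True
  then have "p = 0" using max_norm_equivalent(2)[of p] by simp
  then show ?thesis using P.op_0[OF T] by (simp add: max_norm_def)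
next
  case False
  then have pos: "0 < max_norm p" using max_norm_nonneg[of p] by simp
  then have "max_norm (T (s2 (of_real (1 / max_norm p)) p)) \<le> N T"
    by (intro op_norm_upper[OF T])
      (simp add: max_norm_scale[OF F.normed_space_over_axioms] norm_divide)
  then show ?thesis
    using pos by (simp add: P.op_scale[OF T] max_norm_scale[OF F.normed_space_over_axioms] norm_divide field_simps)
qed

lemma op_norm_fun_scale_le:
  assumes "T \<in> L"
  shows "N (fun_scale s2 a T) \<le> norm a * N T"
  using op_norm_upper[OF assms]
  by (intro op_norm_least) (simp add: fun_scale_def max_norm_scale[OF F.normed_space_over_axioms] mult_left_mono)

sublocale V: vector_space "fun_scale s2"
  by (rule vector_space_fun_scale) (rule P.vector_space_axioms)

sublocale M_projection "fun_scale s2" N L "compact_ops s2" \<pi>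
proof
  show "V.subspace L" by (rule P.subspace_bounded_ops)
  show "N (S + T) \<le> N S + N T" if "S \<in> L" "T \<in> L" for S T
  proof (rule op_norm_least)
    fix p :: "'f \<times> 'f" assume "max_norm p \<le> 1"
    then show "max_norm ((S + T) p) \<le> N S + N T"
      using max_norm_add[of "S p" "T p"] op_norm_upper[OF that(1), of p] op_norm_upper[OF that(2), of p]
      by simp
  qed
  show "N (fun_scale s2 a T) = norm a * N T" if T: "T \<in> L" for a T
  proof (cases "a = 0")
    case True
    have "N 0 \<le> 0" by (rule op_norm_least) (simp add: max_norm_def)
    moreover have "0 \<le> N 0"
      using op_norm_upper[OF V.subspace_0[OF P.subspace_bounded_ops], of 0] by (simp add: max_norm_def)
    ultimately show ?thesis using True by simp
  next
    case False
    have "N T \<le> norm (1 / a) * N (fun_scale s2 a T)"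
      using op_norm_fun_scale_le[OF P.bounded_ops_fun_scale[OF T], of "1 / a" a] False by simp
    then show ?thesis using op_norm_fun_scale_le[OF T, of a] False by (simp add: norm_divide field_simps)
  qed
qed (fact closed proj ker norm_sum)+

section \<open>Block operators on the direct sum\<close>

text \<open>As 2 by 2 operator matrices: \<open>flip_snd\<close> is diagonal with entries 1 and -1,
  \<open>swap\<close> exchanges the summands, \<open>corner S\<close> has \<open>S\<close> as upper
  left entry and \<open>corner2 S\<close> has \<open>S\<close> as upper right entry, all other
  entries being 0.\<close>

definition "flip_snd = (\<lambda>p::'f \<times> 'f. (fst p, - snd p))"
definition "swap = (\<lambda>p::'f \<times> 'f. (snd p, fst p))"
definition "corner S = (\<lambda>p::'f \<times> 'f. (S (fst p) :: 'f, 0 :: 'f))"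
definition "corner2 S = (\<lambda>p::'f \<times> 'f. (S (snd p) :: 'f, 0 :: 'f))"

lemma isometry_ops:
  assumes A: "A = flip_snd \<or> A = swap"
  shows "A \<in> L" "A (A p) = p" "max_norm (A p) = max_norm p"
proof -
  have "prod_scale s a p = (s a (fst p), s a (snd p))" for a p by (simp add: prod_scale_def)
  then show "A \<in> L"
    using A by (intro P.bounded_opsI[where K = 1])
      (auto simp: flip_snd_def swap_def prod_eq_iff norm_prod_def add.commute)
  show "A (A p) = p" "max_norm (A p) = max_norm p"
    using A by (auto simp: flip_snd_def swap_def max_norm_def)
qed

lemma commutes_left:
  assumes A: "A = flip_snd \<or> A = swap"
  shows "commutes (\<lambda>T. A \<circ> T)"
proof (rule commutes_involution)
  have N: "N (A \<circ> T) = N T" for T by (simp add: op_norm_def isometry_ops(3)[OF A])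
  show "admissible (\<lambda>T. A \<circ> T)"
    unfolding admissible_def
    using isometry_ops(1)[OF A]
    by (auto simp: N P.bounded_ops_compose P.compact_ops_compose_left fun_eq_iff fun_scale_def
        P.op_add P.op_scale intro: exI[of _ 1])
  show "N (A \<circ> T) = N T" for T by (rule N)
  show "A \<circ> (A \<circ> T) = T" for T by (simp add: fun_eq_iff isometry_ops(2)[OF A])
qed

lemma commutes_right:
  assumes A: "A = flip_snd \<or> A = swap"
  shows "commutes (\<lambda>T. T \<circ> A)"
proof (rule commutes_involution)
  have le: "N (T \<circ> A) \<le> N T" if "T \<in> L" for T
    using op_norm_upper[OF that] by (intro op_norm_least) (simp add: isometry_ops(3)[OF A])
  have inv: "T \<circ> A \<circ> A = T" for T :: "'f \<times> 'f \<Rightarrow> 'f \<times> 'f"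
    by (simp add: fun_eq_iff isometry_ops(2)[OF A])
  have L: "T \<circ> A \<in> L" if "T \<in> L" for T
    using that isometry_ops(1)[OF A] by (rule P.bounded_ops_compose)
  show N: "N (T \<circ> A) = N T" if "T \<in> L" for T
    using le[OF that] le[OF L[OF that]] by (simp add: inv)
  show "admissible (\<lambda>T. T \<circ> A)"
    unfolding admissible_def
    using isometry_ops(1)[OF A]
    by (auto simp: N L P.compact_ops_compose_right fun_eq_iff fun_scale_def intro: exI[of _ 1])
  show "T \<circ> A \<circ> A = T" for T :: "'f \<times> 'f \<Rightarrow> 'f \<times> 'f" by (rule inv)
qed

text \<open>Averaging over right and then left multiplication by \<open>flip_snd\<close> removes
  every block except the upper left one. The formula is kept as a composition of two averages, the
  form to which the commutation lemmas apply.\<close>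

definition compress :: "('f \<times> 'f \<Rightarrow> 'f \<times> 'f) \<Rightarrow> 'f \<times> 'f \<Rightarrow> 'f \<times> 'f" where
  "compress T = fun_scale s2 (1 / 2)
     (fun_scale s2 (1 / 2) (T + (T \<circ> flip_snd)) + (flip_snd \<circ> fun_scale s2 (1 / 2) (T + (T \<circ> flip_snd))))"

lemma commutes_compress: "commutes compress"
  using commutes_compose[OF commutes_average[OF commutes_left[OF disjI1[OF refl]]]
      commutes_average[OF commutes_right[OF disjI1[OF refl]]]]
  unfolding compress_def .

lemma half_add: "s (1 / 2) (x + x) = x"
proof -
  have "s (1 / 2) (x + x) = s (1 / 2 + 1 / 2) x" by (simp only: F.scale_right_distrib F.scale_left_distrib)
  then show ?thesis by simp
qed

lemma compress_eq:
  assumes T: "T \<in> L"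
  shows "compress T = corner (\<lambda>x. fst (T (x, 0)))"
proof
  fix p :: "'f \<times> 'f"
  define R where "R = fun_scale s2 (1 / 2) (T + (T \<circ> flip_snd))"
  have "R p = s2 (1 / 2) (T (p + flip_snd p))" using T by (simp add: R_def fun_scale_def P.op_add)
  also have "p + flip_snd p = (fst p + fst p, 0)" by (simp add: flip_snd_def prod_eq_iff)
  also have "s2 (1 / 2) (T (fst p + fst p, 0)) = T (s2 (1 / 2) (fst p + fst p, 0))"
    using T by (simp only: P.op_scale)
  also have "s2 (1 / 2) (fst p + fst p, 0) = (fst p, 0)" by (simp add: prod_scale_def half_add)
  finally have "R p = T (fst p, 0)" .
  moreover have "compress T p = s2 (1 / 2) (R p + flip_snd (R p))"
    unfolding compress_def R_def[symmetric] by (simp add: fun_scale_def)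
  ultimately have "compress T p = s2 (1 / 2) (T (fst p, 0) + flip_snd (T (fst p, 0)))" by simp
  then show "compress T p = corner (\<lambda>x. fst (T (x, 0))) p"
    by (simp add: flip_snd_def prod_scale_def half_add corner_def)
qed

lemma corner_L: "S \<in> bounded_ops s \<Longrightarrow> corner S \<in> L"
  and corner2_L: "S \<in> bounded_ops s \<Longrightarrow> corner2 S \<in> L"
proof -
  assume S: "S \<in> bounded_ops s"
  obtain K where K: "0 \<le> K" "\<And>x. norm (S x) \<le> K * norm x" using F.op_boundE[OF S] by metis
  show "corner S \<in> L"
  proof (rule P.bounded_opsI)
    show "norm (corner S p) \<le> K * norm p" for p
      using K(2)[of "fst p"] mult_left_mono[OF norm_fst_le[of "fst p" "snd p"] K(1)]
      by (simp add: corner_def norm_Pair)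
  qed (use S in \<open>simp_all add: corner_def prod_scale_def F.op_add F.op_scale\<close>)
  then have "corner S \<circ> swap \<in> L" using isometry_ops(1)[of swap] by (intro P.bounded_ops_compose) auto
  moreover have "corner S \<circ> swap = corner2 S" by (simp add: corner_def corner2_def swap_def fun_eq_iff)
  ultimately show "corner2 S \<in> L" by simp
qed

lemma first_block_compact:
  assumes T: "T \<in> compact_ops s2"
  shows "(\<lambda>x. fst (T (x, 0))) \<in> compact_ops s"
proof (rule F.compact_opsI)
  have TL: "T \<in> L" using T by (rule P.compact_ops_bounded)
  obtain K where K: "0 \<le> K" "\<And>p. norm (T p) \<le> K * norm p" using P.op_boundE[OF TL] by metis
  show "(\<lambda>x. fst (T (x, 0))) \<in> bounded_ops s"
  proof (rule F.bounded_opsI)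
    show "norm (fst (T (x, 0))) \<le> K * norm x" for x
      using K(2)[of "(x, 0)"] norm_fst_le[of "fst (T (x, 0))" "snd (T (x, 0))"] by (simp add: norm_Pair)
    show "fst (T (x + y, 0)) = fst (T (x, 0)) + fst (T (y, 0))" for x y
      using P.op_add[OF TL, of "(x, 0)" "(y, 0)"] by simp
    show "fst (T (s a x, 0)) = s a (fst (T (x, 0)))" for a x
      using P.op_scale[OF TL, of a "(x, 0)"] by (simp add: prod_scale_def)
  qed
  fix B :: "'f set" assume "bounded B"
  then have "bounded (B \<times> {0::'f})" by (intro bounded_Times) auto
  then obtain C where C: "compact C" "T ` (B \<times> {0}) \<subseteq> C" using P.compact_opsE[OF T] by metis
  have "compact (fst ` C)" using C(1) by (intro compact_continuous_image continuous_intros)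
  then show "\<exists>C. compact C \<and> (\<lambda>x. fst (T (x, 0))) ` B \<subseteq> C"
    using C(2) by (intro exI[of _ "fst ` C"]) force
qed

text \<open>A functional \<open>T \<mapsto> f (fst (T (c, 0)))\<close> attains its norm on rank one operators,
  so it is fixed by \<open>\<pi>\<close>.\<close>

lemma proj_point_functional:
  assumes f: "F.functional f"
  shows "\<pi> (\<lambda>T. if T \<in> L then f (fst (T (c, 0))) else 0) = (\<lambda>T. if T \<in> L then f (fst (T (c, 0))) else 0)"
    and "(\<lambda>T. if T \<in> L then f (fst (T (c, 0))) else 0) \<in> D"
proof -
  let ?\<chi> = "\<lambda>T::'f \<times> 'f \<Rightarrow> 'f \<times> 'f. if T \<in> L then f (fst (T (c, 0))) else 0"
  let ?d = "dual_norm norm UNIV f"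
  have d0: "0 \<le> ?d" using f by (rule F.dual_norm_nonneg)
  have cn: "max_norm (c, 0) = norm c" by (simp add: max_norm_def)
  have le: "norm (?\<chi> T) \<le> (?d * norm c) * N T" if T: "T \<in> L" for T
  proof -
    have "norm (?\<chi> T) \<le> ?d * norm (fst (T (c, 0)))" using F.norm_le_dual_norm[OF f] T by simp
    also have "\<dots> \<le> ?d * max_norm (T (c, 0))"
      by (rule mult_left_mono[OF _ d0]) (simp add: max_norm_def)
    also have "\<dots> \<le> ?d * (N T * norm c)"
      using max_norm_op_le[OF T, of "(c, 0)"] d0 unfolding cn by (rule mult_left_mono)
    finally show ?thesis by (simp add: mult_ac)
  qed
  show D: "?\<chi> \<in> D"
    unfolding dual_space_iff functional_if_mem
    using le by (auto simp: F.functional_add[OF f] F.functional_scale[OF f] fun_scale_def prod_scale_def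
        intro!: functionalI[where C = "?d * norm c"])
  obtain g where g: "F.functional g" "\<And>x. norm (g x) \<le> norm x" "g c = of_real (norm c)"
    using F.ex_norming_functional[of c] by blast
  interpret J: seminormed_over "fun_scale s2" N "compact_ops s2"
    by (rule seminormed_subspace[OF subspace_J JX])
  have fJ: "J.functional ?\<chi>"
    using D JX unfolding dual_space_iff functional_def J.functional_def by blast
  have attained: "norm (f z) * norm c \<le> dual_norm N (compact_ops s2) ?\<chi>" if z: "norm z \<le> 1" for z
  proof -
    \<comment> \<open>With \<open>g\<close> norming \<open>c\<close>, this rank one operator has
      norm at most 1 and maps \<open>(c, 0)\<close> to \<open>norm c\<close> times
      \<open>(z, 0)\<close>; varying \<open>z\<close> recovers the full norm of the functional from
      compact operators.\<close>
    let ?R = "\<lambda>p::'f \<times> 'f. s2 (g (fst p)) (z, 0)"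
    have "P.functional (\<lambda>p. g (fst p))"
    proof (rule P.functionalI)
      show "norm (g (fst p)) \<le> 1 * norm p" for p
        using g(2)[of "fst p"] norm_fst_le[of "fst p" "snd p"] by simp
    qed (simp_all add: F.functional_add[OF g(1)] F.functional_scale[OF g(1)] prod_scale_def)
    then have R: "?R \<in> compact_ops s2" by (rule P.rank_one_compact)
    have "N ?R \<le> 1"
    proof (rule op_norm_least)
      fix p :: "'f \<times> 'f" assume "max_norm p \<le> 1"
      then have "norm (g (fst p)) \<le> 1" using g(2)[of "fst p"] by (simp add: max_norm_def)
      then show "max_norm (?R p) \<le> 1"
        using z by (simp add: max_norm_def prod_scale_def F.norm_scale mult_le_one)
    qed
    then have "norm (?\<chi> ?R) \<le> dual_norm N (compact_ops s2) ?\<chi>"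
      using R by (intro J.dual_norm_upper[OF fJ])
    moreover have "?\<chi> ?R = of_real (norm c) * f z"
      using P.compact_ops_bounded[OF R] g(3) by (simp add: prod_scale_def F.functional_scale[OF f])
    ultimately show ?thesis by (simp add: norm_mult mult.commute)
  qed
  have "?d * norm c \<le> dual_norm N (compact_ops s2) ?\<chi>"
  proof (cases "c = 0")
    case True
    then show ?thesis using J.dual_norm_nonneg[OF fJ] by simp
  next
    case False
    then have "?d \<le> dual_norm N (compact_ops s2) ?\<chi> / norm c"
      using attained by (intro F.dual_norm_least) (simp add: field_simps)
    then show ?thesis using False by (simp add: field_simps)
  qed
  moreover have "dual_norm N L ?\<chi> \<le> ?d * norm c"
  proof (rule dual_norm_least)
    fix T assume "T \<in> L" "N T \<le> 1"
    then show "norm (?\<chi> T) \<le> ?d * norm c"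
      using le[of T] mult_left_mono[of "N T" 1 "?d * norm c"] d0 by simp
  qed
  ultimately show "\<pi> ?\<chi> = ?\<chi>" using D by (intro proj_fixed) auto
qed

text \<open>The bound makes \<open>g\<close> depend only on the values on \<open>C\<close>. Peeling
  off one point \<open>c\<close> writes \<open>g v\<close> as a functional of \<open>v c\<close>
  plus a functional of the remaining values, so the map is a finite sum of point functionals, each
  fixed by \<open>\<pi>\<close>.\<close>

lemma proj_evaluation_functional:
  fixes g :: "('f \<Rightarrow> 'f) \<Rightarrow> 'k"
  assumes "finite C" and "\<And>v w. g (v + w) = g v + g w" and "\<And>a v. g (fun_scale s a v) = a * g v"
    and "\<And>v. norm (g v) \<le> M * (\<Sum>c\<in>C. norm (v c))" and "0 \<le> M"
  shows "(\<lambda>T. if T \<in> L then g (\<lambda>x. fst (T (x, 0))) else 0) \<in> D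
    \<and> \<pi> (\<lambda>T. if T \<in> L then g (\<lambda>x. fst (T (x, 0))) else 0)
      = (\<lambda>T. if T \<in> L then g (\<lambda>x. fst (T (x, 0))) else 0)"
  using assms
proof (induction C arbitrary: g rule: finite_induct)
  case empty
  then have "(\<lambda>T. if T \<in> L then g (\<lambda>x. fst (T (x, 0))) else 0) = 0" by (simp add: fun_eq_iff)
  moreover have "0 \<in> D" by (auto simp: dual_space_iff functional_def zero_fun_def intro: exI[of _ 0])
  moreover from this have "\<pi> 0 = 0" by (simp add: proj_eq_0_iff)
  ultimately show ?case by (simp only:)
next
  case (insert c C)
  note g = insert.prems
  define \<delta> where "\<delta> z = (\<lambda>x. if x = c then z else 0)" for z :: 'f
  define f where "f z = g (\<delta> z)" for z
  define g' where "g' v = g (v(c := 0))" for v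
  have split: "g v = f (v c) + g' v" for v
  proof -
    have "v = \<delta> (v c) + v(c := 0)" by (auto simp: \<delta>_def fun_eq_iff)
    then have "g v = g (\<delta> (v c) + v(c := 0))" by (rule arg_cong)
    then show ?thesis by (simp only: g(1) f_def g'_def)
  qed
  have f: "F.functional f"
  proof (rule F.functionalI)
    show "f (x + y) = f x + f y" for x y
    proof -
      have "\<delta> (x + y) = \<delta> x + \<delta> y" by (auto simp: \<delta>_def fun_eq_iff)
      then show ?thesis by (simp add: f_def g(1))
    qed
    show "f (s a x) = a * f x" for a x
    proof -
      have "\<delta> (s a x) = fun_scale s a (\<delta> x)" by (auto simp: \<delta>_def fun_scale_def fun_eq_iff)
      then show ?thesis by (simp add: f_def g(2))
    qed
    show "norm (f x) \<le> M * norm x" for x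
    proof -
      have "(\<Sum>y\<in>C. norm (\<delta> x y)) = 0" using insert.hyps by (intro sum.neutral) (auto simp: \<delta>_def)
      then show ?thesis using g(3)[of "\<delta> x"] insert.hyps by (simp add: f_def \<delta>_def)
    qed
  qed
  have "(\<lambda>T. if T \<in> L then g' (\<lambda>x. fst (T (x, 0))) else 0) \<in> D
    \<and> \<pi> (\<lambda>T. if T \<in> L then g' (\<lambda>x. fst (T (x, 0))) else 0)
      = (\<lambda>T. if T \<in> L then g' (\<lambda>x. fst (T (x, 0))) else 0)"
  proof (rule insert.IH)
    show "g' (v + w) = g' v + g' w" for v w
    proof -
      have "(v + w)(c := 0) = v(c := 0) + w(c := 0)" by (auto simp: fun_eq_iff)
      then show ?thesis by (simp only: g'_def g(1))
    qed
    show "g' (fun_scale s a v) = a * g' v" for a v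
    proof -
      have "(fun_scale s a v)(c := 0) = fun_scale s a (v(c := 0))" by (auto simp: fun_scale_def fun_eq_iff)
      then show ?thesis by (simp only: g'_def g(2))
    qed
    show "norm (g' v) \<le> M * (\<Sum>c\<in>C. norm (v c))" for v
    proof -
      have "norm (g' v) \<le> M * (\<Sum>x\<in>insert c C. norm ((v(c := 0)) x))"
        unfolding g'_def by (rule g(3))
      also have "(\<Sum>x\<in>insert c C. norm ((v(c := 0)) x)) = (\<Sum>x\<in>C. norm (v x))"
        using insert.hyps by (auto intro!: sum.cong)
      finally show ?thesis .
    qed
  qed (rule g)
  moreover have "(\<lambda>T. if T \<in> L then g (\<lambda>x. fst (T (x, 0))) else 0)
    = (\<lambda>T. if T \<in> L then f (fst (T (c, 0))) else 0) + (\<lambda>T. if T \<in> L then g' (\<lambda>x. fst (T (x, 0))) else 0)"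
    by (auto simp: fun_eq_iff split)
  moreover note proj_point_functional[OF f, of c]
  ultimately show ?case by (metis (lifting) proj_add dual_space_add)
qed

text \<open>The tuple \<open>(S c - c)\<close>, \<open>c \<in> C\<close>, is recorded by the function \<open>S - id\<close>. If no \<open>S\<close> as claimed
  existed, a functional on pairs of an operator and a function would separate \<open>(corner2 id, - id)\<close>
  from the subspace of all \<open>(corner S - corner2 S, S)\<close> with \<open>S\<close> compact. Its first component
  \<open>\<phi>\<close> satisfies \<open>\<parallel>\<pi> \<phi>\<parallel> + \<parallel>\<phi> - \<pi> \<phi>\<parallel> \<le> 1\<close>, which bounds the value at that point.\<close>

lemma ex_compact_combination:
  fixes C :: "'f set"
  assumes C: "finite C" and \<epsilon>: "0 < \<epsilon>"
  shows "\<exists>S\<in>compact_ops s. (\<forall>x y. norm (S x + (y - S y)) \<le> (1 + \<epsilon>) * max (norm x) (norm y))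
    \<and> (\<forall>c\<in>C. norm (S c - c) \<le> \<epsilon>)"
proof -
  \<comment> \<open>With this weight, \<open>p < 1 + \<epsilon>\<close> bounds the operator norm by
    \<open>1 + \<epsilon>\<close> and at the same time forces the sum of the errors on
    \<open>C\<close> to be at most \<open>\<epsilon>\<close>.\<close>
  define M where "M = (1 + \<epsilon>) / \<epsilon>"
  have M: "0 < M" using \<epsilon> by (simp add: M_def)
  define sP :: "'k \<Rightarrow> ('f \<times> 'f \<Rightarrow> 'f \<times> 'f) \<times> ('f \<Rightarrow> 'f) \<Rightarrow> _"
    where "sP a v = (fun_scale s2 a (fst v), fun_scale s a (snd v))" for a v
  define p where "p v = N (fst v) + M * (\<Sum>c\<in>C. norm (snd v c))"
    for v :: "('f \<times> 'f \<Rightarrow> 'f \<times> 'f) \<times> ('f \<Rightarrow> 'f)"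
  interpret G: vector_space "fun_scale s" by (rule vector_space_fun_scale) (rule F.vector_space_axioms)
  interpret Q: vector_space sP
    by unfold_locales (auto simp: sP_def prod_eq_iff G.scale_right_distrib G.scale_left_distrib
        V.scale_right_distrib V.scale_left_distrib)
  interpret Q: seminormed_over sP p "L \<times> UNIV"
  proof
    show "Q.subspace (L \<times> UNIV)"
      using P.subspace_bounded_ops
      by (intro Q.subspaceI) (auto simp: sP_def P.bounded_ops_fun_scale P.bounded_ops_add zero_prod_def)
    show "p (v + w) \<le> p v + p w" if "v \<in> L \<times> UNIV" "w \<in> L \<times> UNIV" for v w
    proof -
      have "(\<Sum>c\<in>C. norm (snd (v + w) c)) \<le> (\<Sum>c\<in>C. norm (snd v c)) + (\<Sum>c\<in>C. norm (snd w c))"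
        by (auto simp: norm_triangle_ineq simp flip: sum.distrib intro!: sum_mono)
      then have "M * (\<Sum>c\<in>C. norm (snd (v + w) c)) \<le> M * ((\<Sum>c\<in>C. norm (snd v c)) + (\<Sum>c\<in>C. norm (snd w c)))"
        using M by (intro mult_left_mono) auto
      moreover have "N (fst v + fst w) \<le> N (fst v) + N (fst w)" using that by (intro N_add) auto
      ultimately show ?thesis by (simp add: p_def distrib_left)
    qed
    show "p (sP a v) = norm a * p v" if "v \<in> L \<times> UNIV" for a v
    proof -
      have "(\<Sum>c\<in>C. norm (s a (snd v c))) = norm a * (\<Sum>c\<in>C. norm (snd v c))"
        by (simp add: F.norm_scale sum_distrib_left)
      moreover have "N (fun_scale s2 a (fst v)) = norm a * N (fst v)" using that by (intro N_scale) auto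
      ultimately show ?thesis by (simp add: p_def sP_def fun_scale_def[of s] distrib_left mult_ac)
    qed
  qed
  define \<iota> where "\<iota> S = (corner S - corner2 S, S)" for S
  define x0 where "x0 = (corner2 (\<lambda>x. x), - (\<lambda>x::'f. x))"
  have x0: "x0 \<in> L \<times> UNIV" by (simp add: x0_def corner2_L F.bounded_ops_id)
  have \<iota>X: "\<iota> S \<in> L \<times> UNIV" if "S \<in> compact_ops s" for S
    using corner_L[OF F.compact_ops_bounded[OF that]] corner2_L[OF F.compact_ops_bounded[OF that]]
    by (simp add: \<iota>_def)
  have "\<exists>S\<in>compact_ops s. p (x0 + \<iota> S) < 1 + \<epsilon>"
  proof (rule ccontr)
    assume "\<not> ?thesis"
    then have far: "1 + \<epsilon> \<le> p (x0 + \<iota> S)" if "S \<in> compact_ops s" for S using that by force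
    have sub: "Q.subspace (\<iota> ` compact_ops s)"
    proof (rule Q.subspaceI)
      show "0 \<in> \<iota> ` compact_ops s"
        using G.subspace_0[OF F.subspace_compact_ops]
        by (intro image_eqI[of _ _ 0]) (auto simp: \<iota>_def corner_def corner2_def zero_prod_def fun_eq_iff)
      show "v + w \<in> \<iota> ` compact_ops s" if vw: "v \<in> \<iota> ` compact_ops s" "w \<in> \<iota> ` compact_ops s" for v w
      proof -
        from vw obtain S S' where "S \<in> compact_ops s" "v = \<iota> S" "S' \<in> compact_ops s" "w = \<iota> S'" by blast
        then show ?thesis
          using G.subspace_add[OF F.subspace_compact_ops]
          by (intro image_eqI[of _ _ "S + S'"]) (auto simp: \<iota>_def corner_def corner2_def fun_eq_iff)
      qed
      show "sP a v \<in> \<iota> ` compact_ops s" if v: "v \<in> \<iota> ` compact_ops s" for a v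
      proof -
        from v obtain S where "S \<in> compact_ops s" "v = \<iota> S" by blast
        then show ?thesis
          using G.subspace_scale[OF F.subspace_compact_ops]
          by (intro image_eqI[of _ _ "fun_scale s a S"])
            (auto simp: \<iota>_def corner_def corner2_def sP_def fun_scale_def prod_scale_def algebra_simps fun_eq_iff)
      qed
    qed
    obtain \<Lambda> where \<Lambda>add: "\<forall>v\<in>L \<times> UNIV. \<forall>w\<in>L \<times> UNIV. \<Lambda> (v + w) = \<Lambda> v + \<Lambda> w"
      and \<Lambda>scale: "\<forall>a. \<forall>v\<in>L \<times> UNIV. \<Lambda> (sP a v) = a * \<Lambda> v"
      and \<Lambda>le: "\<forall>v\<in>L \<times> UNIV. norm (\<Lambda> v) \<le> p v"
      and \<Lambda>M: "\<forall>m\<in>\<iota> ` compact_ops s. \<Lambda> m = 0" and \<Lambda>x0: "1 + \<epsilon> \<le> norm (\<Lambda> x0)"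
    proof -
      have "0 \<le> 1 + \<epsilon>" using \<epsilon> by simp
      moreover have "\<iota> ` compact_ops s \<subseteq> L \<times> UNIV" using \<iota>X by (rule image_subsetI)
      moreover have "1 + \<epsilon> \<le> p (x0 + m)" if "m \<in> \<iota> ` compact_ops s" for m using that far by auto
      ultimately have "\<exists>\<Lambda>. (\<forall>x\<in>L \<times> UNIV. \<forall>y\<in>L \<times> UNIV. \<Lambda> (x + y) = \<Lambda> x + \<Lambda> y)
         \<and> (\<forall>a. \<forall>x\<in>L \<times> UNIV. \<Lambda> (sP a x) = a * \<Lambda> x) \<and> (\<forall>x\<in>L \<times> UNIV. norm (\<Lambda> x) \<le> p x)
         \<and> (\<forall>m\<in>\<iota> ` compact_ops s. \<Lambda> m = 0) \<and> 1 + \<epsilon> \<le> norm (\<Lambda> x0)"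
        by (intro Q.hahn_banach_separation[OF sub _ x0])
      then show ?thesis by (elim exE conjE) (rule that)
    qed
    note \<Lambda>add = bspec[OF bspec[OF \<Lambda>add]] and \<Lambda>scale = bspec[OF spec[OF \<Lambda>scale]]
      and \<Lambda>le = bspec[OF \<Lambda>le] and \<Lambda>M = bspec[OF \<Lambda>M, OF imageI]
    define \<phi> where "\<phi> T = (if T \<in> L then \<Lambda> (T, 0) else 0)" for T
    define g where "g v = \<Lambda> (0, v)" for v
    define \<Psi> where "\<Psi> = (\<lambda>T. if T \<in> L then g (\<lambda>x. fst (T (x, 0))) else 0)"
    have L0: "0 \<in> L" using V.subspace_0[OF P.subspace_bounded_ops] .
    have split: "\<Lambda> (T, v) = \<phi> T + g v" if "T \<in> L" for T v
      using \<Lambda>add[of "(T, 0)" "(0, v)"] that L0 by (simp add: \<phi>_def g_def)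
    have f\<phi>: "functional (\<lambda>T. \<Lambda> (T, 0))"
    proof (rule functionalI)
      show "\<Lambda> (S + T, 0) = \<Lambda> (S, 0) + \<Lambda> (T, 0)" if "S \<in> L" "T \<in> L" for S T
        using \<Lambda>add[of "(S, 0)" "(T, 0)"] that by simp
      show "\<Lambda> (fun_scale s2 a T, 0) = a * \<Lambda> (T, 0)" if "T \<in> L" for a T
        using \<Lambda>scale[of "(T, 0)" a] that by (simp add: sP_def)
      show "norm (\<Lambda> (T, 0)) \<le> 1 * N T" if "T \<in> L" for T
        using \<Lambda>le[of "(T, 0)"] that by (simp add: p_def)
    qed
    have \<phi>D: "\<phi> \<in> D" using f\<phi> by (simp add: dual_space_iff \<phi>_def[abs_def])
    have f: "functional \<phi>" using \<phi>D by (simp add: dual_space_iff)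
    have \<phi>1: "dual_norm N L \<phi> \<le> 1"
    proof (rule dual_norm_least)
      fix T assume "T \<in> L" "N T \<le> 1"
      then show "norm (\<phi> T) \<le> 1" using \<Lambda>le[of "(T, 0)"] by (simp add: p_def \<phi>_def)
    qed
    have \<Psi>: "\<Psi> \<in> D" "\<pi> \<Psi> = \<Psi>"
    proof -
      have "\<Psi> \<in> D \<and> \<pi> \<Psi> = \<Psi>"
        unfolding \<Psi>_def
      proof (rule proj_evaluation_functional[OF C])
        show "g (v + w) = g v + g w" for v w
          using \<Lambda>add[of "(0, v)" "(0, w)"] L0 by (simp add: g_def)
        show "g (fun_scale s a v) = a * g v" for a v
          using \<Lambda>scale[of "(0, v)" a] L0 by (simp add: g_def sP_def)
        show "norm (g v) \<le> M * (\<Sum>c\<in>C. norm (v c))" for v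
          using \<Lambda>le[of "(0, v)"] L0 by (simp add: g_def p_def)
      qed (use M in simp)
      then show "\<Psi> \<in> D" "\<pi> \<Psi> = \<Psi>" by auto
    qed
    have comm: "commutes compress" "commutes (\<lambda>T. T \<circ> swap)" by (auto intro: commutes_compress commutes_right)
    then have ad: "admissible compress" "admissible (\<lambda>T. T \<circ> swap)" by (auto simp: commutes_def)
    \<comment> \<open>If \<open>S\<close> is the upper left block of \<open>T\<close>, this
      functional takes \<open>T\<close> to
      \<open>\<psi> (corner S) - \<psi> (corner2 S) + g S\<close>. For
      \<open>\<psi> = \<phi>\<close> it vanishes on compact operators. Since \<open>\<pi>\<close>
      commutes with both adjoints and fixes \<open>\<Psi>\<close>, it vanishes on all bounded
      operators for \<open>\<psi> = \<pi> \<phi>\<close>, in particular at the identity, which need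
      not be compact.\<close>
    let ?\<theta> = "\<lambda>\<psi>. pull compress \<psi> - pull compress (pull (\<lambda>T. T \<circ> swap) \<psi>) + \<Psi>"
    have \<theta>: "?\<theta> \<psi> T = \<psi> (corner (\<lambda>x. fst (T (x, 0)))) - \<psi> (corner2 (\<lambda>x. fst (T (x, 0)))) + g (\<lambda>x. fst (T (x, 0)))"
      if "T \<in> L" for \<psi> T
    proof -
      have "compress T \<in> L" using ad(1) that by (simp add: admissible_def)
      moreover have "compress T \<circ> swap = corner2 (\<lambda>x. fst (T (x, 0)))"
        using that by (simp add: compress_eq corner_def corner2_def swap_def fun_eq_iff)
      ultimately show ?thesis using that by (simp add: pull_def \<Psi>_def compress_eq)
    qed
    have "?\<theta> \<phi> T = 0" if T: "T \<in> compact_ops s2" for T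
    proof -
      let ?S = "\<lambda>x. fst (T (x, 0))"
      have S: "?S \<in> compact_ops s" using T by (rule first_block_compact)
      then have SL: "corner ?S \<in> L" "corner2 ?S \<in> L"
        by (auto intro: corner_L corner2_L F.compact_ops_bounded)
      have "\<Lambda> (corner ?S - corner2 ?S, ?S) = 0" using \<Lambda>M[OF S] by (simp add: \<iota>_def)
      then have "\<phi> (corner ?S - corner2 ?S) + g ?S = 0"
        using split[of "corner ?S - corner2 ?S" ?S] SL by simp
      then show ?thesis
        using \<theta>[OF P.compact_ops_bounded[OF T], of \<phi>] SL by (simp add: functional_diff[OF f])
    qed
    moreover have pD: "pull compress \<phi> \<in> D" "pull compress (pull (\<lambda>T. T \<circ> swap) \<phi>) \<in> D"
      "pull (\<lambda>T. T \<circ> swap) \<phi> \<in> D"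
      using \<phi>D ad by (auto intro!: pull_D)
    moreover have "?\<theta> \<phi> \<in> D" using pD \<Psi> by (intro dual_space_add dual_space_diff) auto
    ultimately have "\<pi> (?\<theta> \<phi>) = 0" using proj_eq_0_iff[of "?\<theta> \<phi>"] by simp
    moreover have "\<pi> (?\<theta> \<phi>) = ?\<theta> (\<pi> \<phi>)"
      using pD \<Psi> comm \<phi>D by (simp add: proj_add proj_diff dual_space_diff commutes_def)
    ultimately have "?\<theta> (\<pi> \<phi>) (\<lambda>q. q) = 0" by simp
    then have key: "\<pi> \<phi> (corner (\<lambda>x. x)) - \<pi> \<phi> (corner2 (\<lambda>x. x)) + g (\<lambda>x. x) = 0"
      using \<theta>[OF P.bounded_ops_id] by simp
    have cL: "corner (\<lambda>x. x) \<in> L" "corner2 (\<lambda>x. x) \<in> L"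
      using F.bounded_ops_id by (auto intro: corner_L corner2_L)
    have gm: "g (- (\<lambda>x. x)) = - g (\<lambda>x. x)"
      using \<Lambda>scale[of "(0, \<lambda>x. x)" "- 1"] L0 by (simp add: g_def sP_def)
    have "\<Lambda> x0 = \<phi> (corner2 (\<lambda>x. x)) - g (\<lambda>x. x)"
      using split[OF cL(2)] by (simp add: x0_def gm)
    \<comment> \<open>The two parts of \<open>\<phi>\<close> are evaluated at different operators of
      norm at most 1, so the norm identity gives \<open>norm (\<Lambda> x0) \<le> 1\<close>, against
      the separation by \<open>1 + \<epsilon>\<close>.\<close>
    then have "\<Lambda> x0 = \<pi> \<phi> (corner (\<lambda>x. x)) + (\<phi> - \<pi> \<phi>) (corner2 (\<lambda>x. x))"
      using key unfolding add_eq_0_iff by simp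
    moreover have "N (corner (\<lambda>x. x)) \<le> 1" "N (corner2 (\<lambda>x. x)) \<le> 1"
      by (auto intro!: op_norm_least simp: corner_def corner2_def max_norm_def)
    moreover have "functional (\<pi> \<phi>)" "functional (\<phi> - \<pi> \<phi>)"
      using \<phi>D proj_D[OF \<phi>D] dual_space_diff by (auto simp: dual_space_iff)
    ultimately have "norm (\<pi> \<phi> (corner (\<lambda>x. x))) \<le> dual_norm N L (\<pi> \<phi>)"
      "norm ((\<phi> - \<pi> \<phi>) (corner2 (\<lambda>x. x))) \<le> dual_norm N L (\<phi> - \<pi> \<phi>)"
      "norm (\<Lambda> x0) \<le> norm (\<pi> \<phi> (corner (\<lambda>x. x))) + norm ((\<phi> - \<pi> \<phi>) (corner2 (\<lambda>x. x)))"
      using cL norm_triangle_ineq by (simp_all only: dual_norm_upper)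
    then show False using norm_sum[OF \<phi>D] \<phi>1 \<Lambda>x0 \<epsilon> by simp
  qed
  then obtain S where S: "S \<in> compact_ops s" and lt: "p (x0 + \<iota> S) < 1 + \<epsilon>" by blast
  \<comment> \<open>This operator maps \<open>(x, y)\<close> to \<open>(S x + (y - S y), 0)\<close>,
    so a bound on its norm is the required inequality.\<close>
  let ?T = "corner2 (\<lambda>x. x) + (corner S - corner2 S)"
  have TL: "?T \<in> L"
    using corner_L[OF F.compact_ops_bounded[OF S]] corner2_L[OF F.compact_ops_bounded[OF S]]
      corner2_L[OF F.bounded_ops_id] by simp
  have p: "p (x0 + \<iota> S) = N ?T + M * (\<Sum>c\<in>C. norm (S c - c))"
    by (simp add: p_def x0_def \<iota>_def)
  have NT: "N ?T \<le> 1 + \<epsilon>"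
  proof -
    have "0 \<le> M * (\<Sum>c\<in>C. norm (S c - c))" using M by (simp add: sum_nonneg)
    then show ?thesis using lt unfolding p by linarith
  qed
  have "M * (\<Sum>c\<in>C. norm (S c - c)) \<le> 1 + \<epsilon>" using lt N_nonneg[OF TL] unfolding p by simp
  then have "(1 + \<epsilon>) * (\<Sum>c\<in>C. norm (S c - c)) \<le> (1 + \<epsilon>) * \<epsilon>"
    using \<epsilon> by (simp add: M_def field_simps)
  then have sum: "(\<Sum>c\<in>C. norm (S c - c)) \<le> \<epsilon>" using \<epsilon> by simp
  show ?thesis
  proof (intro bexI[OF _ S] conjI allI ballI)
    fix x y
    have "max_norm (?T (x, y)) \<le> N ?T * max_norm (x, y)" using TL by (rule max_norm_op_le)
    also have "\<dots> \<le> (1 + \<epsilon>) * max_norm (x, y)" using NT max_norm_nonneg by (rule mult_right_mono)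
    finally show "norm (S x + (y - S y)) \<le> (1 + \<epsilon>) * max (norm x) (norm y)"
      by (simp add: max_norm_def corner_def corner2_def algebra_simps)
  next
    fix c assume "c \<in> C"
    then have "norm (S c - c) \<le> (\<Sum>c\<in>C. norm (S c - c))" using C by (intro member_le_sum) auto
    then show "norm (S c - c) \<le> \<epsilon>" using sum by simp
  qed
qed

end

lemma M_infty_space_compact_combination:
  fixes s :: "'k::real_or_complex \<Rightarrow> 'f::real_normed_vector \<Rightarrow> 'f"
  assumes "normed_space_over s" "M_infty_space s" "finite C" "0 < \<epsilon>"
  shows "\<exists>S\<in>compact_ops s. (\<forall>x y. norm (S x + (y - S y)) \<le> (1 + \<epsilon>) * max (norm x) (norm y))
    \<and> (\<forall>c\<in>C. norm (S c - c) \<le> \<epsilon>)"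
proof -
  obtain \<pi> where "M_infty s \<pi>"
    using assms(1,2) unfolding M_infty_space_def M_ideal_def M_infty_def M_infty_axioms_def by blast
  then show ?thesis using assms(3,4) by (rule M_infty.ex_compact_combination)
qed


section \<open>Polynomials\<close>

text \<open>Homogeneity is separated from continuity: components and differences are formed
  algebraically, and continuity is recovered afterwards from boundedness on the unit ball.\<close>

definition alg_hom ::
  "('k::real_or_complex \<Rightarrow> 'e::real_normed_vector \<Rightarrow> 'e) \<Rightarrow> ('k \<Rightarrow> 'f::real_normed_vector \<Rightarrow> 'f) \<Rightarrow>
   nat \<Rightarrow> ('e \<Rightarrow> 'f) \<Rightarrow> bool" where
  "alg_hom sE sF n f \<longleftrightarrow> (\<exists>A. multilinear sE sF n A \<and> (\<forall>x. f x = A (replicate n x)))"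

text \<open>Polynomials of degree less than \<open>m\<close>, without continuity.\<close>

definition alg_poly ::
  "('k::real_or_complex \<Rightarrow> 'e::real_normed_vector \<Rightarrow> 'e) \<Rightarrow> ('k \<Rightarrow> 'f::real_normed_vector \<Rightarrow> 'f) \<Rightarrow>
   nat \<Rightarrow> ('e \<Rightarrow> 'f) \<Rightarrow> bool" where
  "alg_poly sE sF m f \<longleftrightarrow> (\<exists>h. (\<forall>k<m. alg_hom sE sF k (h k)) \<and> (\<forall>x. f x = (\<Sum>k<m. h k x)))"

lemma hom_polys_iff: "P \<in> hom_polys sE sF n \<longleftrightarrow> alg_hom sE sF n P \<and> continuous_on UNIV P"
  by (simp add: hom_polys_def alg_hom_def)

lemma alg_hom_compose_left:
  assumes f: "alg_hom sE sF n f" and S: "Vector_Spaces.linear sF sG S"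
  shows "alg_hom sE sG n (\<lambda>x. S (f x))"
proof -
  obtain A where A: "multilinear sE sF n A" "\<And>x. f x = A (replicate n x)"
    using f by (auto simp: alg_hom_def)
  have "multilinear sE sG n (\<lambda>xs. S (A xs))"
    using A(1) S unfolding multilinear_def Vector_Spaces.linear_iff by auto
  then show ?thesis unfolding alg_hom_def using A(2) by (intro exI[of _ "\<lambda>xs. S (A xs)"]) auto
qed

lemma alg_poly_compose_left:
  assumes f: "alg_poly sE sF n f" and S: "Vector_Spaces.linear sF sG S"
  shows "alg_poly sE sG n (\<lambda>x. S (f x))"
proof -
  interpret S: Vector_Spaces.linear sF sG S by fact
  obtain h where "\<forall>k<n. alg_hom sE sF k (h k)" "\<And>x. f x = (\<Sum>k<n. h k x)"
    using f by (auto simp: alg_poly_def)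
  then show ?thesis
    unfolding alg_poly_def
    by (intro exI[of _ "\<lambda>k x. S (h k x)"]) (auto simp: S.sum intro: alg_hom_compose_left[OF _ S])
qed

lemma alg_hom_compose_right:
  assumes f: "alg_hom sE sF n f" and T: "Vector_Spaces.linear sE sE T"
  shows "alg_hom sE sF n (\<lambda>x. f (T x))"
proof -
  obtain A where A: "multilinear sE sF n A" "\<And>x. f x = A (replicate n x)"
    using f by (auto simp: alg_hom_def)
  have "Vector_Spaces.linear sE sF (\<lambda>x. A (map T (xs[i := x])))" if "length xs = n" "i < n" for xs i
  proof -
    have "Vector_Spaces.linear sE sF (\<lambda>x. A ((map T xs)[i := x]))"
      using A(1) that by (simp add: multilinear_def)
    then show ?thesis using T unfolding Vector_Spaces.linear_iff by (simp add: map_update)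
  qed
  then have "multilinear sE sF n (\<lambda>xs. A (map T xs))" by (simp add: multilinear_def)
  then show ?thesis unfolding alg_hom_def using A(2) by (intro exI[of _ "\<lambda>xs. A (map T xs)"]) auto
qed

locale poly_spaces = E: normed_space_over sE + F: normed_space_over sF
  for sE :: "'k::real_or_complex \<Rightarrow> 'e::real_normed_vector \<Rightarrow> 'e"
    and sF :: "'k \<Rightarrow> 'f::real_normed_vector \<Rightarrow> 'f"
begin

lemma linearI:
  assumes "\<And>x y. f (x + y) = f x + f y" "\<And>a x. f (sE a x) = sF a (f x)"
  shows "Vector_Spaces.linear sE sF f"
  using assms E.vector_space_axioms F.vector_space_axioms by (simp add: Vector_Spaces.linear_iff)

section \<open>Translates and differences of polynomials\<close>

lemma multilinear_slot:
  assumes "multilinear sE sF n A" "length xs + length ys + 1 = n"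
  shows "A (xs @ (x + y) # ys) = A (xs @ x # ys) + A (xs @ y # ys)"
    and "A (xs @ sE a x # ys) = sF a (A (xs @ x # ys))"
proof -
  have "Vector_Spaces.linear sE sF (\<lambda>z. A ((xs @ x # ys)[length xs := z]))"
    using assms(1)[unfolded multilinear_def, rule_format, of "xs @ x # ys" "length xs"] assms(2) by simp
  then show "A (xs @ (x + y) # ys) = A (xs @ x # ys) + A (xs @ y # ys)"
    "A (xs @ sE a x # ys) = sF a (A (xs @ x # ys))"
    by (auto simp: Vector_Spaces.linear_iff)
qed

lemma alg_hom_scale:
  assumes "alg_hom sE sF n f"
  shows "f (sE a x) = sF (a ^ n) (f x)"
proof -
  obtain A where A: "multilinear sE sF n A" "\<And>x. f x = A (replicate n x)"
    using assms by (auto simp: alg_hom_def)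
  have "A (replicate j (sE a x) @ replicate m x) = sF (a ^ j) (A (replicate n x))" if "j + m = n" for j m
    using that
  proof (induction j arbitrary: m)
    case (Suc j)
    have "A (replicate (Suc j) (sE a x) @ replicate m x)
        = A (replicate j (sE a x) @ sE a x # replicate m x)"
      by (simp flip: replicate_append_same)
    also have "\<dots> = sF a (A (replicate j (sE a x) @ x # replicate m x))"
      using Suc.prems by (intro multilinear_slot[OF A(1)]) simp
    also have "\<dots> = sF a (A (replicate j (sE a x) @ replicate (Suc m) x))" by simp
    finally show ?case using Suc.IH[of "Suc m"] Suc.prems by simp
  qed simp
  from this[of n 0] show ?thesis by (simp add: A(2))
qed

lemma alg_hom_scaleR:
  assumes "alg_hom sE sF n f"
  shows "f (r *\<^sub>R x) = r ^ n *\<^sub>R f x"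
  using alg_hom_scale[OF assms, of "of_real r" x] by (simp add: E.scale_of_real F.scale_of_real flip: of_real_power)

lemma alg_hom_0_arg: "alg_hom sE sF n f \<Longrightarrow> 0 < n \<Longrightarrow> f 0 = 0"
  using alg_hom_scaleR[of n f 0 0] by (simp add: zero_power)

lemma alg_hom_zero: "alg_hom sE sF n (\<lambda>x. 0)"
  unfolding alg_hom_def multilinear_def by (intro exI[of _ "\<lambda>x. 0"]) (auto intro!: linearI)

lemma alg_hom_add:
  assumes "alg_hom sE sF n f" "alg_hom sE sF n g"
  shows "alg_hom sE sF n (\<lambda>x. f x + g x)"
proof -
  obtain A B where A: "multilinear sE sF n A" "\<And>x. f x = A (replicate n x)"
    and B: "multilinear sE sF n B" "\<And>x. g x = B (replicate n x)"
    using assms by (auto simp: alg_hom_def)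
  have "multilinear sE sF n (\<lambda>xs. A xs + B xs)"
    using A(1) B(1) unfolding multilinear_def Vector_Spaces.linear_iff by (simp add: algebra_simps)
  then show ?thesis unfolding alg_hom_def using A(2) B(2) by (intro exI[of _ "\<lambda>xs. A xs + B xs"]) auto
qed

lemma linear_sF: "Vector_Spaces.linear sF sF (sF a)"
  using F.vector_space_axioms
  by (simp add: Vector_Spaces.linear_iff F.scale_right_distrib mult.commute)

lemma alg_hom_cmult: "alg_hom sE sF n f \<Longrightarrow> alg_hom sE sF n (\<lambda>x. sF a (f x))"
  by (rule alg_hom_compose_left[OF _ linear_sF])

lemma alg_poly_zero: "alg_poly sE sF m (\<lambda>x. 0)"
  unfolding alg_poly_def by (intro exI[of _ "\<lambda>k x. 0"]) (simp add: alg_hom_zero)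

lemma alg_poly_add:
  assumes "alg_poly sE sF m f" "alg_poly sE sF m g"
  shows "alg_poly sE sF m (\<lambda>x. f x + g x)"
proof -
  obtain h h' where "\<forall>k<m. alg_hom sE sF k (h k)" "\<And>x. f x = (\<Sum>k<m. h k x)"
    "\<forall>k<m. alg_hom sE sF k (h' k)" "\<And>x. g x = (\<Sum>k<m. h' k x)"
    using assms by (auto simp: alg_poly_def)
  then show ?thesis
    unfolding alg_poly_def by (intro exI[of _ "\<lambda>k x. h k x + h' k x"]) (simp add: alg_hom_add sum.distrib)
qed

lemma alg_poly_Suc_iff:
  "alg_poly sE sF (Suc m) f \<longleftrightarrow> (\<exists>g h. alg_poly sE sF m g \<and> alg_hom sE sF m h \<and> (\<forall>x. f x = g x + h x))"
proof
  assume "alg_poly sE sF (Suc m) f"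
  then obtain h where "\<forall>k<Suc m. alg_hom sE sF k (h k)" "\<And>x. f x = (\<Sum>k<Suc m. h k x)"
    by (auto simp: alg_poly_def)
  then show "\<exists>g h. alg_poly sE sF m g \<and> alg_hom sE sF m h \<and> (\<forall>x. f x = g x + h x)"
    by (intro exI[of _ "\<lambda>x. \<Sum>k<m. h k x"] exI[of _ "h m"] conjI)
      (auto simp: alg_poly_def intro!: exI[of _ h])
next
  assume "\<exists>g h. alg_poly sE sF m g \<and> alg_hom sE sF m h \<and> (\<forall>x. f x = g x + h x)"
  then obtain h h' where h: "\<forall>k<m. alg_hom sE sF k (h k)" "alg_hom sE sF m h'"
    and f: "\<And>x. f x = (\<Sum>k<m. h k x) + h' x"
    by (auto simp: alg_poly_def)
  have "(\<Sum>k<m. h k x) = (\<Sum>k<m. (if k < m then h k else h') x)" for x by (intro sum.cong) auto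
  then show "alg_poly sE sF (Suc m) f"
    unfolding alg_poly_def using h f
    by (intro exI[of _ "\<lambda>k. if k < m then h k else h'"]) (auto simp: less_Suc_eq)
qed

lemma alg_poly_SucI: "alg_poly sE sF m f \<Longrightarrow> alg_poly sE sF (Suc m) f"
  unfolding alg_poly_Suc_iff using alg_hom_zero by (intro exI[of _ f] exI[of _ "\<lambda>x. 0"]) simp

lemma alg_poly_alg_hom: "alg_hom sE sF m f \<Longrightarrow> alg_poly sE sF (Suc m) f"
  unfolding alg_poly_Suc_iff using alg_poly_zero by (intro exI[of _ "\<lambda>x. 0"] exI[of _ f]) simp

lemma multilinear_insert:
  assumes A: "multilinear sE sF (Suc (j + n)) A"
  shows "multilinear sE sF (j + n) (\<lambda>zs. A (take j zs @ a # drop j zs))"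
  unfolding multilinear_def
proof (intro allI impI)
  fix xs :: "'e list" and i assume xs: "length xs = j + n" and i: "i < j + n"
  define ys where "ys = take j xs @ a # drop j xs"
  \<comment> \<open>The inserted \<open>a\<close> at position \<open>j\<close> shifts the later
    slots up by one.\<close>
  define i' where "i' = (if i < j then i else Suc i)"
  have "take j (xs[i := x]) @ a # drop j (xs[i := x]) = ys[i' := x]" for x
  proof (cases "i < j")
    case True
    then show ?thesis
      using xs by (simp add: ys_def i'_def take_update_swap list_update_append)
  next
    case False
    then have "drop j (xs[i := x]) = (drop j xs)[i - j := x]" "take j (xs[i := x]) = take j xs"
      by (simp_all add: drop_update_swap)
    moreover have "Suc i - j = Suc (i - j)" using False by simp
    ultimately show ?thesis
      using xs False by (simp add: ys_def i'_def list_update_append)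
  qed
  moreover have "Vector_Spaces.linear sE sF (\<lambda>x. A (ys[i' := x]))"
    using A xs i unfolding multilinear_def by (simp add: ys_def i'_def)
  ultimately show "Vector_Spaces.linear sE sF (\<lambda>x. A (take j (xs[i := x]) @ a # drop j (xs[i := x])))"
    by simp
qed

text \<open>A binomial expansion that works for nonsymmetric \<open>A\<close>: the first slot
  holding \<open>x + a\<close> is split. The summand with \<open>x\<close> increases
  \<open>j\<close>; the summand with \<open>a\<close> freezes that slot and leaves a form
  \<open>B\<close> in one variable fewer, so it only contributes terms of lower degree.\<close>

lemma multilinear_translate:
  assumes "multilinear sE sF (j + n) A"
  shows "\<exists>h. alg_poly sE sF (j + n) h \<and>
    (\<forall>x. A (replicate j x @ replicate n (x + a)) = A (replicate (j + n) x) + h x)"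
  using assms
proof (induction n arbitrary: j A)
  case 0
  then show ?case using alg_poly_zero by (intro exI[of _ "\<lambda>x. 0"]) simp
next
  case (Suc n)
  define B where "B zs = A (take j zs @ a # drop j zs)" for zs
  have A: "multilinear sE sF (Suc j + n) A" using Suc.prems by simp
  then have B: "multilinear sE sF (j + n) B" unfolding B_def by (intro multilinear_insert) simp
  obtain h1 where h1: "alg_poly sE sF (Suc j + n) h1"
    "\<And>x. A (replicate (Suc j) x @ replicate n (x + a)) = A (replicate (Suc j + n) x) + h1 x"
    using Suc.IH[OF A] by blast
  obtain h2 where h2: "alg_poly sE sF (j + n) h2"
    "\<And>x. B (replicate j x @ replicate n (x + a)) = B (replicate (j + n) x) + h2 x"
    using Suc.IH[OF B] by blast
  have "A (replicate j x @ replicate (Suc n) (x + a))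
      = A (replicate (j + Suc n) x) + (h1 x + (h2 x + B (replicate (j + n) x)))" for x
  proof -
    have "A (replicate j x @ replicate (Suc n) (x + a)) = A (replicate j x @ (x + a) # replicate n (x + a))"
      by simp
    also have "\<dots> = A (replicate j x @ x # replicate n (x + a)) + A (replicate j x @ a # replicate n (x + a))"
      using A by (intro multilinear_slot) auto
    also have "replicate j x @ x # replicate n (x + a) = replicate (Suc j) x @ replicate n (x + a)"
      by (simp flip: replicate_append_same)
    also have "A (replicate j x @ a # replicate n (x + a)) = B (replicate j x @ replicate n (x + a))"
      by (simp add: B_def)
    finally have "A (replicate j x @ replicate (Suc n) (x + a))
        = (A (replicate (Suc j + n) x) + h1 x) + (B (replicate (j + n) x) + h2 x)"
      by (simp only: h1(2) h2(2))
    then show ?thesis by (simp add: add_ac)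
  qed
  moreover have "alg_hom sE sF (j + n) (\<lambda>x. B (replicate (j + n) x))"
    using B by (auto simp: alg_hom_def)
  then have "alg_poly sE sF (Suc (j + n)) (\<lambda>x. h2 x + B (replicate (j + n) x))"
    using h2(1) unfolding alg_poly_Suc_iff by blast
  then have "alg_poly sE sF (j + Suc n) (\<lambda>x. h1 x + (h2 x + B (replicate (j + n) x)))"
    using alg_poly_add[of "Suc (j + n)" h1 "\<lambda>x. h2 x + B (replicate (j + n) x)"] h1(1) by simp
  ultimately show ?case by blast
qed

lemma alg_hom_difference:
  assumes "alg_hom sE sF n f"
  shows "alg_poly sE sF n (\<lambda>x. f (x + a) - f x)"
proof -
  obtain A where A: "multilinear sE sF n A" "\<And>x. f x = A (replicate n x)"
    using assms by (auto simp: alg_hom_def)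
  obtain h where "alg_poly sE sF n h" "\<And>x. A (replicate n (x + a)) = A (replicate n x) + h x"
    using multilinear_translate[of 0 n A a] A(1) by auto
  then show ?thesis by (simp add: A(2))
qed

lemma alg_poly_difference:
  assumes "alg_poly sE sF (Suc m) f"
  shows "alg_poly sE sF m (\<lambda>x. f (x + a) - f x)"
  using assms
proof (induction m arbitrary: f)
  case 0
  then obtain h where "alg_hom sE sF 0 h" "\<And>x. f x = h x" by (auto simp: alg_poly_def)
  then show ?case using alg_hom_difference[of 0 h a] by simp
next
  case (Suc m)
  then obtain g h where g: "alg_poly sE sF (Suc m) g" and h: "alg_hom sE sF (Suc m) h"
    and f: "\<And>x. f x = g x + h x"
    using alg_poly_Suc_iff[of "Suc m" f] by blast
  have "alg_poly sE sF (Suc m) (\<lambda>x. (g (x + a) - g x) + (h (x + a) - h x))"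
    by (rule alg_poly_add[OF alg_poly_SucI[OF Suc.IH[OF g]] alg_hom_difference[OF h]])
  then show ?case by (simp add: f algebra_simps)
qed

lemma alg_poly_translate:
  assumes "alg_poly sE sF m f"
  shows "alg_poly sE sF m (\<lambda>x. f (x + a))"
proof (cases m)
  case 0
  then show ?thesis using assms by (simp add: alg_poly_def)
next
  case (Suc k)
  then have "alg_poly sE sF m (\<lambda>x. f x + (f (x + a) - f x))"
    using assms alg_poly_difference[of k f a] by (intro alg_poly_add) (auto intro: alg_poly_SucI)
  then show ?thesis by simp
qed

end

text \<open>The components of a polynomial are controlled by the polynomial: \<open>f x - 2 ^ m f (x / 2)\<close>
  kills the component of degree \<open>m\<close> and multiplies the others by factors of modulus at least 1.\<close>

lemma homogeneous_components_bound:
  "\<exists>C\<ge>0. \<forall>(h :: nat \<Rightarrow> 'e::real_normed_vector \<Rightarrow> 'f::real_normed_vector) M.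
     (\<forall>k<m. \<forall>r x. h k (r *\<^sub>R x) = r ^ k *\<^sub>R h k x) \<longrightarrow>
     (\<forall>x. norm x \<le> 1 \<longrightarrow> norm (\<Sum>k<m. h k x) \<le> M) \<longrightarrow>
     (\<forall>k<m. \<forall>x. norm x \<le> 1 \<longrightarrow> norm (h k x) \<le> C * M)" (is "\<exists>C\<ge>0. ?Q m C")
proof (induction m)
  case 0
  then show ?case by (intro exI[of _ 0]) simp
next
  case (Suc m)
  then obtain C where C: "0 \<le> C" and Q: "?Q m C" by blast
  note IH = Q[rule_format]
  \<comment> \<open>The factor \<open>1 + 2 ^ m\<close> bounds \<open>f x - 2 ^ m f (x / 2)\<close>
    when \<open>f\<close> is bounded by 1 on the ball. The top component is \<open>f\<close> minus
    \<open>m\<close> lower ones, hence \<open>1 + m * D\<close>; the extra \<open>D\<close> lets one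
    constant cover both cases.\<close>
  define D where "D = C * (1 + 2 ^ m)"
  have D: "0 \<le> D" using C by (simp add: D_def)
  show ?case
  proof (intro exI[of _ "1 + D + real m * D"] conjI allI impI)
    fix h :: "nat \<Rightarrow> 'e \<Rightarrow> 'f" and M k and x :: 'e
    assume "\<forall>k<Suc m. \<forall>r x. h k (r *\<^sub>R x) = r ^ k *\<^sub>R h k x"
      and "\<forall>x. norm x \<le> 1 \<longrightarrow> norm (\<Sum>k<Suc m. h k x) \<le> M" and k: "k < Suc m" and x: "norm x \<le> 1"
    then have hom: "\<And>k r x. k < Suc m \<Longrightarrow> h k (r *\<^sub>R x) = r ^ k *\<^sub>R h k x"
      and M: "\<And>x. norm x \<le> 1 \<Longrightarrow> norm (\<Sum>k<Suc m. h k x) \<le> M" by blast+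
    have M0: "0 \<le> M" using M[of 0] norm_ge_zero order_trans norm_zero zero_le_one by metis
    have low: "norm (h k x) \<le> D * M" if k: "k < m" and x: "norm x \<le> 1" for k x
    proof -
      define c :: "nat \<Rightarrow> real" where "c k = 1 - 2 ^ m * (1 / 2) ^ k" for k
      have "norm (c k *\<^sub>R h k x) \<le> C * ((1 + 2 ^ m) * M)"
      proof (rule IH[where h = "\<lambda>k x. c k *\<^sub>R h k x", OF _ _ k x])
        show "c k *\<^sub>R h k (r *\<^sub>R x) = r ^ k *\<^sub>R c k *\<^sub>R h k x" if "k < m" for k r x
          using hom[of k r x] that by (simp add: mult.commute)
        fix x :: 'e assume x: "norm x \<le> 1"
        have "h k ((1 / 2) *\<^sub>R x) = (1 / 2) ^ k *\<^sub>R h k x" if "k < Suc m" for k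
          using hom[OF that] .
        then have "(\<Sum>k<Suc m. h k x) - 2 ^ m *\<^sub>R (\<Sum>k<Suc m. h k ((1 / 2) *\<^sub>R x))
            = (\<Sum>k<Suc m. c k *\<^sub>R h k x)"
          unfolding scaleR_sum_right sum_subtractf[symmetric]
          by (intro sum.cong refl) (simp add: c_def scaleR_diff_left)
        also have "\<dots> = (\<Sum>k<m. c k *\<^sub>R h k x)" by (simp add: c_def power_one_over)
        finally have eq: "(\<Sum>k<m. c k *\<^sub>R h k x)
            = (\<Sum>k<Suc m. h k x) - 2 ^ m *\<^sub>R (\<Sum>k<Suc m. h k ((1 / 2) *\<^sub>R x))" by (rule sym)
        have "norm (\<Sum>k<m. c k *\<^sub>R h k x) \<le> norm (\<Sum>k<Suc m. h k x)
            + norm (2 ^ m *\<^sub>R (\<Sum>k<Suc m. h k ((1 / 2) *\<^sub>R x)))"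
          unfolding eq by (rule norm_triangle_ineq4)
        also have "norm (2 ^ m *\<^sub>R (\<Sum>k<Suc m. h k ((1 / 2) *\<^sub>R x))) \<le> 2 ^ m * M"
          unfolding norm_scaleR using M[of "(1 / 2) *\<^sub>R x"] x by (intro mult_mono) auto
        finally show "norm (\<Sum>k<m. c k *\<^sub>R h k x) \<le> (1 + 2 ^ m) * M"
          using M[OF x] by (simp add: distrib_right)
      qed
      moreover have "1 \<le> \<bar>c k\<bar>"
      proof -
        have "(2::real) ^ m = 2 ^ (m - k) * 2 ^ k" using k by (simp flip: power_add)
        then have "(2::real) ^ m * (1 / 2) ^ k = 2 ^ (m - k)" by (simp add: power_one_over)
        moreover have "(2::real) ^ 1 \<le> 2 ^ (m - k)" using k by (intro power_increasing) auto
        ultimately show ?thesis by (simp add: c_def)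
      qed
      then have "norm (h k x) \<le> norm (c k *\<^sub>R h k x)"
        using mult_right_mono[of 1 "\<bar>c k\<bar>" "norm (h k x)"] by simp
      ultimately show ?thesis by (simp add: D_def mult.assoc)
    qed
    show "norm (h k x) \<le> (1 + D + real m * D) * M"
    proof (cases "k = m")
      case False
      then have "norm (h k x) \<le> D * M" using low k x by simp
      also have "\<dots> \<le> (1 + D + real m * D) * M" using M0 D by (intro mult_right_mono) auto
      finally show ?thesis .
    next
      case True
      have "h m x = (\<Sum>k<Suc m. h k x) - (\<Sum>k<m. h k x)" by simp
      then have "norm (h m x) \<le> norm (\<Sum>k<Suc m. h k x) + norm (\<Sum>k<m. h k x)"
        using norm_triangle_ineq4 by metis
      also have "norm (\<Sum>k<m. h k x) \<le> of_nat (card {..<m}) * (D * M)"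
        using low[OF _ x] by (intro sum_norm_bound) auto
      finally have "norm (h m x) \<le> M + real m * (D * M)" using M[OF x] by simp
      moreover have "0 \<le> D * M" using D M0 by simp
      ultimately show ?thesis using True by (simp add: algebra_simps)
    qed
  qed (use D in auto)
qed

section \<open>Boundedness, Lipschitz estimates and continuity of polynomials\<close>

context poly_spaces
begin

lemma alg_poly_components_bound:
  "\<exists>C\<ge>0. \<forall>h M. (\<forall>k<m. alg_hom sE sF k (h k)) \<longrightarrow> (\<forall>x. norm x \<le> 1 \<longrightarrow> norm (\<Sum>k<m. h k x) \<le> M) \<longrightarrow>
     (\<forall>k<m. \<forall>x. norm x \<le> 1 \<longrightarrow> norm (h k x) \<le> C * M)"
proof -
  obtain C where C: "0 \<le> C" and Q: "\<forall>(h :: nat \<Rightarrow> 'e \<Rightarrow> 'f) M.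
     (\<forall>k<m. \<forall>r x. h k (r *\<^sub>R x) = r ^ k *\<^sub>R h k x) \<longrightarrow>
     (\<forall>x. norm x \<le> 1 \<longrightarrow> norm (\<Sum>k<m. h k x) \<le> M) \<longrightarrow>
     (\<forall>k<m. \<forall>x. norm x \<le> 1 \<longrightarrow> norm (h k x) \<le> C * M)"
    using homogeneous_components_bound[of m, where 'e = 'e and 'f = 'f] by blast
  show ?thesis
    by (intro exI[of _ C] conjI C allI impI) (rule Q[rule_format]; simp add: alg_hom_scaleR)
qed

text \<open>Expanding \<open>f\<close> around \<open>x\<close> gives components whose bound on the
  unit ball depends only on \<open>m\<close> and on the bound of \<open>f\<close> on the ball of
  radius \<open>R + 1\<close>, hence not on \<open>x\<close>. The constant components cancel, and
  for degree \<open>k \<ge> 1\<close> the factor \<open>norm y ^ k\<close> is at most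
  \<open>norm y\<close>.\<close>

lemma alg_poly_Lipschitz:
  assumes f: "alg_poly sE sF m f" and bd: "\<And>x. norm x \<le> R + 1 \<Longrightarrow> norm (f x) \<le> M"
  shows "\<exists>L\<ge>0. \<forall>x y. norm x \<le> R \<longrightarrow> norm y \<le> 1 \<longrightarrow> norm (f (x + y) - f x) \<le> L * norm y"
proof -
  obtain C where C: "0 \<le> C" and Q: "\<forall>h M. (\<forall>k<m. alg_hom sE sF k (h k)) \<longrightarrow>
     (\<forall>x. norm x \<le> 1 \<longrightarrow> norm (\<Sum>k<m. h k x) \<le> M) \<longrightarrow>
     (\<forall>k<m. \<forall>x. norm x \<le> 1 \<longrightarrow> norm (h k x) \<le> C * M)"
    using alg_poly_components_bound[of m] by blast
  note comp = Q[rule_format]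
  define B where "B = max M 0"
  have "norm (f (x + y) - f x) \<le> (real m * (C * B)) * norm y" if x: "norm x \<le> R" and y: "norm y \<le> 1" for x y
  proof -
    obtain h where h: "\<And>k. k < m \<Longrightarrow> alg_hom sE sF k (h k)" "\<And>y. f (y + x) = (\<Sum>k<m. h k y)"
      using alg_poly_translate[OF f, of x] by (auto simp: alg_poly_def)
    have hom: "h k (r *\<^sub>R y) = r ^ k *\<^sub>R h k y" if "k < m" for k r y
      using h(1)[OF that] by (rule alg_hom_scaleR)
    have bound: "norm (h k z) \<le> C * B" if "k < m" "norm z \<le> 1" for k z
    proof (rule comp[OF h(1) _ that])
      show "norm (\<Sum>k<m. h k y) \<le> B" if "norm y \<le> 1" for y
        using bd[of "y + x"] norm_triangle_ineq[of y x] that x by (simp add: h(2) B_def)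
    qed
    have term_le: "norm (h k y - h k 0) \<le> (C * B) * norm y" if k: "k < m" for k
    proof (cases "k = 0 \<or> y = 0")
      case True
      then have "h k y = h k 0" using hom[of k 0 y] k by auto
      then show ?thesis using C by (simp add: B_def)
    next
      case False
      have z: "h k 0 = 0" using alg_hom_0_arg[OF h(1)[OF k]] False by simp
      have "h k y = h k (norm y *\<^sub>R ((1 / norm y) *\<^sub>R y))" using False by simp
      also have "\<dots> = norm y ^ k *\<^sub>R h k ((1 / norm y) *\<^sub>R y)" by (rule hom[OF k])
      finally have "norm (h k y) = norm y ^ k * norm (h k ((1 / norm y) *\<^sub>R y))" by simp
      also have "\<dots> \<le> norm y ^ 1 * (C * B)"
        using False y k by (intro mult_mono power_decreasing bound) auto
      finally show ?thesis by (simp add: z mult.commute)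
    qed
    have "f (x + y) - f x = (\<Sum>k<m. h k y - h k 0)"
      using h(2)[of y] h(2)[of 0] by (simp add: sum_subtractf add.commute)
    also have "norm \<dots> \<le> of_nat (card {..<m}) * ((C * B) * norm y)"
      using term_le by (intro sum_norm_bound) auto
    finally show ?thesis by (simp add: mult.assoc)
  qed
  moreover have "0 \<le> real m * (C * B)" using C by (simp add: B_def)
  ultimately show ?thesis by blast
qed

lemma alg_hom_bounded_ball:
  assumes P: "alg_hom sE sF n P" and B: "\<And>x. norm x \<le> 1 \<Longrightarrow> norm (P x) \<le> B"
  shows "norm (P x) \<le> B * norm x ^ n"
proof (cases "x = 0")
  case True
  show ?thesis
  proof (cases "n = 0")
    case False
    then show ?thesis using True alg_hom_0_arg[OF P] by (simp add: zero_power)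
  qed (use True B[of 0] in simp)
next
  case False
  have "P x = P (norm x *\<^sub>R ((1 / norm x) *\<^sub>R x))" using False by simp
  also have "\<dots> = norm x ^ n *\<^sub>R P ((1 / norm x) *\<^sub>R x)" by (rule alg_hom_scaleR[OF P])
  finally have "norm (P x) = norm x ^ n * norm (P ((1 / norm x) *\<^sub>R x))" by simp
  also have "\<dots> \<le> norm x ^ n * B" using False by (intro mult_left_mono B) auto
  finally show ?thesis by (simp add: mult.commute)
qed

lemma alg_poly_continuous:
  assumes f: "alg_poly sE sF m f" and bd: "\<And>R. \<exists>M. \<forall>x. norm x \<le> R \<longrightarrow> norm (f x) \<le> M"
  shows "continuous_on UNIV f"
  unfolding continuous_on_iff
proof (intro ballI allI impI)
  fix x :: 'e and e :: real assume e: "0 < e"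
  obtain M where "\<And>z. norm z \<le> norm x + 1 \<Longrightarrow> norm (f z) \<le> M" using bd[of "norm x + 1"] by blast
  then obtain L where L: "0 \<le> L" "\<And>z y. norm z \<le> norm x \<Longrightarrow> norm y \<le> 1 \<Longrightarrow> norm (f (z + y) - f z) \<le> L * norm y"
    using alg_poly_Lipschitz[OF f, of "norm x" M] by blast
  show "\<exists>d>0. \<forall>x'\<in>UNIV. dist x' x < d \<longrightarrow> dist (f x') (f x) < e"
  proof (intro exI[of _ "min 1 (e / (L + 1))"] conjI ballI impI)
    show "0 < min 1 (e / (L + 1))" using e L(1) by simp
    fix x' assume d: "dist x' x < min 1 (e / (L + 1))"
    have "norm (f (x + (x' - x)) - f x) \<le> L * norm (x' - x)" using d by (intro L) (auto simp: dist_norm)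
    also have "\<dots> \<le> (L + 1) * dist x' x" by (simp add: dist_norm distrib_right)
    also have "\<dots> < e" using d L(1) by (simp add: pos_less_divide_eq mult.commute)
    finally show "dist (f x') (f x) < e" by (simp add: dist_norm)
  qed
qed

lemma alg_hom_continuous:
  assumes P: "alg_hom sE sF n P" and B: "\<And>x. norm x \<le> 1 \<Longrightarrow> norm (P x) \<le> B"
  shows "continuous_on UNIV P"
proof (rule alg_poly_continuous[OF alg_poly_alg_hom[OF P]])
  fix R
  have "norm (P x) \<le> B * R ^ n" if "norm x \<le> R" for x
  proof -
    have "0 \<le> B" using order_trans[OF norm_ge_zero B[of 0]] by simp
    then have "B * norm x ^ n \<le> B * R ^ n" using that by (intro mult_left_mono power_mono) auto
    then show ?thesis using alg_hom_bounded_ball[OF P B, of x] by simp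
  qed
  then show "\<exists>M. \<forall>x. norm x \<le> R \<longrightarrow> norm (P x) \<le> M" by blast
qed

lemma hom_polys_bounded_ball:
  assumes "P \<in> hom_polys sE sF n"
  shows "\<exists>B. \<forall>x. norm x \<le> 1 \<longrightarrow> norm (P x) \<le> B"
proof -
  have P: "alg_hom sE sF n P" and c: "continuous_on UNIV P" using assms by (auto simp: hom_polys_iff)
  obtain d where d: "0 < d" "\<And>x. dist x 0 < d \<Longrightarrow> dist (P x) (P 0) < 1"
    using c unfolding continuous_on_iff by (meson UNIV_I zero_less_one)
  have "norm (P x) \<le> (2 / d) ^ n * (norm (P 0) + 1)" if "norm x \<le> 1" for x
  proof -
    have "norm x * d \<le> 1 * d" using that d(1) by (intro mult_right_mono) auto
    then have "dist ((d / 2) *\<^sub>R x) 0 < d" using d(1) by (simp add: dist_norm)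
    then have "norm (P ((d / 2) *\<^sub>R x)) \<le> norm (P 0) + 1"
      using d(2) norm_triangle_sub[of "P ((d / 2) *\<^sub>R x)" "P 0"] by (fastforce simp: dist_norm)
    moreover have "P x = (2 / d) ^ n *\<^sub>R P ((d / 2) *\<^sub>R x)"
      using alg_hom_scaleR[OF P, of "2 / d" "(d / 2) *\<^sub>R x"] d(1) by simp
    ultimately show ?thesis using d(1) by (simp add: mult_left_mono)
  qed
  then show ?thesis by blast
qed

lemma poly_norm_upper:
  assumes "P \<in> hom_polys sE sF n" "norm x \<le> 1"
  shows "norm (P x) \<le> poly_norm P"
  unfolding poly_norm_def
proof (rule cSUP_upper)
  obtain B where "\<And>x. norm x \<le> 1 \<Longrightarrow> norm (P x) \<le> B" using hom_polys_bounded_ball[OF assms(1)] by blast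
  then show "bdd_above ((\<lambda>x. norm (P x)) ` cball 0 1)" by (intro bdd_aboveI2[where M = B]) simp
qed (use assms in simp)

lemma poly_norm_nonneg: "P \<in> hom_polys sE sF n \<Longrightarrow> 0 \<le> poly_norm P"
  using order_trans[OF norm_ge_zero poly_norm_upper[of P n 0]] by simp

lemma norm_le_poly_norm:
  assumes "P \<in> hom_polys sE sF n"
  shows "norm (P x) \<le> poly_norm P * norm x ^ n"
  using assms poly_norm_upper[OF assms] by (intro alg_hom_bounded_ball) (auto simp: hom_polys_iff)

end

lemma poly_norm_least: "(\<And>x. norm x \<le> 1 \<Longrightarrow> norm (P x) \<le> b) \<Longrightarrow> poly_norm P \<le> b"
  unfolding poly_norm_def by (rule cSUP_least) auto

context poly_spaces
begin

lemma hom_polys_add: "P \<in> hom_polys sE sF n \<Longrightarrow> Q \<in> hom_polys sE sF n \<Longrightarrow> P + Q \<in> hom_polys sE sF n"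
  by (auto simp: hom_polys_iff plus_fun_def intro!: alg_hom_add continuous_intros)

lemma hom_polys_fun_scale:
  assumes "P \<in> hom_polys sE sF n"
  shows "fun_scale sF a P \<in> hom_polys sE sF n"
proof -
  have P: "alg_hom sE sF n P" using assms by (simp add: hom_polys_iff)
  have h: "alg_hom sE sF n (fun_scale sF a P)" unfolding fun_scale_def using P by (rule alg_hom_cmult)
  have "norm (fun_scale sF a P x) \<le> norm a * poly_norm P" if "norm x \<le> 1" for x
    using poly_norm_upper[OF assms that] by (simp add: fun_scale_def F.norm_scale mult_left_mono)
  from alg_hom_continuous[OF h this] show ?thesis using h by (simp add: hom_polys_iff)
qed

sublocale V: vector_space "fun_scale sF :: 'k \<Rightarrow> ('e \<Rightarrow> 'f) \<Rightarrow> 'e \<Rightarrow> 'f"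
  by (rule vector_space_fun_scale) (rule F.vector_space_axioms)

lemma seminormed_hom_polys: "seminormed_over (fun_scale sF) poly_norm (hom_polys sE sF n)"
proof unfold_locales
  show "V.subspace (hom_polys sE sF n)"
  proof (rule V.subspaceI)
    show "0 \<in> hom_polys sE sF n" by (simp add: hom_polys_iff zero_fun_def alg_hom_zero)
  qed (auto intro: hom_polys_add hom_polys_fun_scale)
  show "poly_norm (P + Q) \<le> poly_norm P + poly_norm Q"
    if "P \<in> hom_polys sE sF n" "Q \<in> hom_polys sE sF n" for P Q
  proof (rule poly_norm_least)
    fix x :: 'e assume "norm x \<le> 1"
    then show "norm ((P + Q) x) \<le> poly_norm P + poly_norm Q"
      using poly_norm_upper[OF that(1), of x] poly_norm_upper[OF that(2), of x]
        norm_triangle_ineq[of "P x" "Q x"] by simp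
  qed
  have le: "poly_norm (fun_scale sF a P) \<le> norm a * poly_norm P" if P: "P \<in> hom_polys sE sF n" for a P
    using poly_norm_upper[OF P]
    by (intro poly_norm_least) (simp add: fun_scale_def F.norm_scale mult_left_mono)
  show "poly_norm (fun_scale sF a P) = norm a * poly_norm P" if P: "P \<in> hom_polys sE sF n" for a P
  proof (cases "a = 0")
    case True
    have "poly_norm (fun_scale sF a P) \<le> 0" using le[OF P, of a] True by simp
    moreover have "0 \<le> poly_norm (fun_scale sF a P)" by (rule poly_norm_nonneg[OF hom_polys_fun_scale[OF P]])
    ultimately show ?thesis using True by simp
  next
    case False
    have "poly_norm (fun_scale sF (1 / a) (fun_scale sF a P)) \<le> norm (1 / a) * poly_norm (fun_scale sF a P)"
      by (rule le[OF hom_polys_fun_scale[OF P]])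
    then have "poly_norm P \<le> norm (1 / a) * poly_norm (fun_scale sF a P)" using False by simp
    then show ?thesis using le[OF P, of a] False by (simp add: norm_divide field_simps)
  qed
qed

end


section \<open>Weak continuity on bounded sets\<close>

lemma weakly_continuous_on_bounded_iff:
  "weakly_continuous_on_bounded s P \<longleftrightarrow> (\<forall>\<F> x. (\<exists>C. \<forall>\<^sub>F y in \<F>. norm y \<le> C)
     \<longrightarrow> (\<forall>\<phi> \<in> dual_space s norm UNIV. (\<phi> \<longlongrightarrow> \<phi> x) \<F>) \<longrightarrow> (P \<longlongrightarrow> P x) \<F>)"
  unfolding weakly_continuous_on_bounded_def
  by (simp add: tendsto_norm_zero_iff LIM_zero_iff)

context normed_space_over
begin

lemma weakly_continuousI:
  assumes "\<And>\<F> x C. (\<forall>\<^sub>F y in \<F>. norm y \<le> C) \<Longrightarrow>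
    (\<And>\<phi>. functional \<phi> \<Longrightarrow> (\<phi> \<longlongrightarrow> \<phi> x) \<F>) \<Longrightarrow> (P \<longlongrightarrow> P x) \<F>"
  shows "weakly_continuous_on_bounded scale P"
  unfolding weakly_continuous_on_bounded_iff using assms by (auto simp: dual_space_UNIV_iff)

lemma weakly_continuousD:
  assumes "weakly_continuous_on_bounded scale P" "\<forall>\<^sub>F y in \<F>. norm y \<le> C"
    and "\<And>\<phi>. functional \<phi> \<Longrightarrow> (\<phi> \<longlongrightarrow> \<phi> x) \<F>"
  shows "(P \<longlongrightarrow> P x) \<F>"
  using assms unfolding weakly_continuous_on_bounded_iff by (auto simp: dual_space_UNIV_iff)

section \<open>Weak neighbourhoods of 0 and weak total boundedness\<close>

text \<open>The neighbourhood filter of 0 in the weak topology.\<close>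

definition weak0 :: "'e filter" where
  "weak0 = (INF \<phi>\<in>{\<phi>. functional \<phi>}. filtercomap \<phi> (nhds 0))"

lemma functional_tendsto_weak0: "functional \<phi> \<Longrightarrow> (\<phi> \<longlongrightarrow> 0) weak0"
  unfolding weak0_def by (rule filterlim_INF'[of \<phi>]) (auto intro: filterlim_filtercomap)

lemma eventually_INF_filtercomap_nhds_0:
  fixes \<Phi> :: "('a \<Rightarrow> 'b::real_normed_vector) set"
  assumes "finite \<Phi>" "eventually Q (INF \<phi>\<in>\<Phi>. filtercomap \<phi> (nhds 0))"
  shows "\<exists>\<delta>>0. \<forall>y. (\<forall>\<phi>\<in>\<Phi>. norm (\<phi> y) < \<delta>) \<longrightarrow> Q y"
  using assms
proof (induction \<Phi> arbitrary: Q rule: finite_induct)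
  case empty
  then show ?case by (auto intro: exI[of _ 1])
next
  case (insert \<phi> \<Phi>)
  then obtain A B where A: "eventually A (filtercomap \<phi> (nhds 0))"
    and B: "eventually B (INF \<phi>\<in>\<Phi>. filtercomap \<phi> (nhds 0))" and Q: "\<And>y. A y \<Longrightarrow> B y \<Longrightarrow> Q y"
    by (auto simp: eventually_inf)
  obtain A' where A': "eventually A' (nhds 0)" "\<And>y. A' (\<phi> y) \<Longrightarrow> A y"
    using A by (auto simp: eventually_filtercomap)
  obtain d where d: "0 < d" "\<And>z. norm z < d \<Longrightarrow> A' z"
    using A'(1) by (auto simp: eventually_nhds_metric)
  obtain \<delta> where \<delta>: "0 < \<delta>" "\<And>y. (\<forall>\<phi>\<in>\<Phi>. norm (\<phi> y) < \<delta>) \<Longrightarrow> B y"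
    using insert.IH[OF B] by blast
  show ?case
    using d \<delta> A'(2) Q by (intro exI[of _ "min d \<delta>"]) auto
qed

lemma eventually_weak0D:
  assumes "eventually Q weak0"
  shows "\<exists>\<Phi> \<delta>. finite \<Phi> \<and> (\<forall>\<phi>\<in>\<Phi>. functional \<phi>) \<and> 0 < \<delta>
    \<and> (\<forall>y. (\<forall>\<phi>\<in>\<Phi>. norm (\<phi> y) < \<delta>) \<longrightarrow> Q y)"
proof -
  obtain \<Phi> where \<Phi>: "\<Phi> \<subseteq> {\<phi>. functional \<phi>}" "finite \<Phi>"
    and ev: "eventually Q (INF \<phi>\<in>\<Phi>. filtercomap \<phi> (nhds 0))"
    using assms unfolding weak0_def eventually_INF[of _ _ "{\<phi>. functional \<phi>}"] by blast
  then show ?thesis using eventually_INF_filtercomap_nhds_0[OF \<Phi>(2) ev] by blast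
qed

lemma weakly_continuous_weak0:
  assumes P: "weakly_continuous_on_bounded scale P" and "0 < \<epsilon>"
  shows "\<forall>\<^sub>F y in weak0. norm y \<le> R \<longrightarrow> dist (P y) (P 0) < \<epsilon>"
proof -
  let ?F = "inf weak0 (principal {y. norm y \<le> R})"
  have "(P \<longlongrightarrow> P 0) ?F"
  proof (rule weakly_continuousD[OF P])
    show "\<forall>\<^sub>F y in ?F. norm y \<le> R" by (simp add: eventually_inf_principal)
    show "(\<phi> \<longlongrightarrow> \<phi> 0) ?F" if "functional \<phi>" for \<phi>
      using filterlim_mono[OF functional_tendsto_weak0[OF that] order_refl, of ?F] functional_0[OF that]
      by simp
  qed
  then have "\<forall>\<^sub>F y in ?F. dist (P y) (P 0) < \<epsilon>" using \<open>0 < \<epsilon>\<close> by (rule tendstoD)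
  then show ?thesis by (simp add: eventually_inf_principal)
qed

text \<open>One functional at a time: the values of \<open>\<phi>\<close> lie in a compact ball of
  scalars, so finitely many sets \<open>B' z\<close> cover \<open>B\<close>, on each of which
  \<open>\<phi>\<close> varies by less than \<open>\<delta>\<close>. Nets for the other functionals
  are chosen inside each of these sets, so they remain good for \<open>\<phi>\<close>.\<close>

lemma weakly_totally_bounded:
  assumes "finite \<Phi>" "\<And>\<phi>. \<phi> \<in> \<Phi> \<Longrightarrow> functional \<phi>" "0 < \<delta>" "bounded B"
  shows "\<exists>A\<subseteq>B. finite A \<and> (\<forall>x\<in>B. \<exists>a\<in>A. \<forall>\<phi>\<in>\<Phi>. norm (\<phi> (x - a)) < \<delta>)"
  using assms
proof (induction \<Phi> arbitrary: B rule: finite_induct)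
  case empty
  then show ?case by (cases "B = {}") (auto intro: exI[of _ "{SOME x. x \<in> B}"] someI)
next
  case (insert \<phi> \<Phi>)
  have \<phi>: "functional \<phi>" using insert.prems by simp
  obtain C where C: "0 \<le> C" "\<And>x. norm (\<phi> x) \<le> C * norm x" using functional_boundE[OF \<phi>] by auto
  obtain b where b: "\<And>x. x \<in> B \<Longrightarrow> norm x \<le> b" using insert.prems(3) by (auto simp: bounded_iff)
  have "\<forall>e>0. \<exists>Z. finite Z \<and> cball (0::'k) (C * b) \<subseteq> (\<Union>z\<in>Z. ball z e)"
    using compact_cball_scalar[of "C * b"] unfolding compact_eq_totally_bounded by (rule conjunct2)
  then obtain Z :: "'k set" where Z: "finite Z" "cball 0 (C * b) \<subseteq> (\<Union>z\<in>Z. ball z (\<delta> / 2))"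
    using half_gt_zero[OF \<open>0 < \<delta>\<close>] by blast
  define B' where "B' z = {x \<in> B. \<phi> x \<in> ball z (\<delta> / 2)}" for z
  have "\<exists>A\<subseteq>B' z. finite A \<and> (\<forall>x\<in>B' z. \<exists>a\<in>A. \<forall>\<phi>\<in>\<Phi>. norm (\<phi> (x - a)) < \<delta>)" for z
    using insert.prems by (intro insert.IH) (auto simp: B'_def intro: bounded_subset)
  then obtain A where A: "\<And>z. A z \<subseteq> B' z" "\<And>z. finite (A z)"
    "\<And>z x. x \<in> B' z \<Longrightarrow> \<exists>a\<in>A z. \<forall>\<phi>\<in>\<Phi>. norm (\<phi> (x - a)) < \<delta>"
    by metis
  show ?case
  proof (intro exI[of _ "\<Union>z\<in>Z. A z"] conjI ballI)
    show "(\<Union>z\<in>Z. A z) \<subseteq> B" using A(1) by (auto simp: B'_def)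
    show "finite (\<Union>z\<in>Z. A z)" using Z(1) A(2) by simp
    fix x assume x: "x \<in> B"
    have "norm (\<phi> x) \<le> C * b" using C(2)[of x] mult_left_mono[OF b[OF x] C(1)] by simp
    then have "\<phi> x \<in> cball 0 (C * b)" by simp
    then obtain z where z: "z \<in> Z" "\<phi> x \<in> ball z (\<delta> / 2)" using Z(2) by blast
    then have "x \<in> B' z" using x by (simp add: B'_def)
    then obtain a where a: "a \<in> A z" "\<forall>\<phi>\<in>\<Phi>. norm (\<phi> (x - a)) < \<delta>" using A(3) by blast
    have "\<phi> a \<in> ball z (\<delta> / 2)" using a(1) A(1) by (auto simp: B'_def)
    then have "norm (\<phi> x - \<phi> a) < \<delta>"
      using z(2) dist_triangle_half_r[of z "\<phi> x" \<delta> "\<phi> a"] by (simp add: dist_norm)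
    then have "norm (\<phi> (x - a)) < \<delta>" using functional_diff[OF \<phi>, of x a] by simp
    then show "\<exists>a\<in>\<Union>z\<in>Z. A z. \<forall>\<phi>\<in>insert \<phi> \<Phi>. norm (\<phi> (x - a)) < \<delta>"
      using z(1) a by (intro bexI[of _ a]) auto
  qed
qed

text \<open>On a relatively compact set the weak topology is the norm topology.\<close>

lemma compact_op_weak_tendsto:
  assumes T: "T \<in> compact_ops scale" and bd: "\<forall>\<^sub>F y in \<F>. norm (g y) \<le> C"
    and weak: "\<And>\<psi>. functional \<psi> \<Longrightarrow> ((\<lambda>y. \<psi> (g y)) \<longlongrightarrow> \<psi> l) \<F>"
  shows "((\<lambda>y. T (g y)) \<longlongrightarrow> T l) \<F>"
proof (rule topological_tendstoI, rule ccontr)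
  fix S assume S: "open S" "T l \<in> S" and not: "\<not> (\<forall>\<^sub>F y in \<F>. T (g y) \<in> S)"
  \<comment> \<open>The images restricted to the points that miss \<open>S\<close>. Compactness
    gives them a cluster point \<open>z\<close> different from \<open>T l\<close>; a functional
    norming \<open>z - T l\<close>, composed with \<open>T\<close>, is again a functional, and weak
    convergence then contradicts the choice of \<open>z\<close>.\<close>
  define H where "H = filtermap (\<lambda>y. T (g y)) (inf \<F> (principal {y. T (g y) \<notin> S}))"
  have H: "H \<noteq> bot"
    using not by (simp add: H_def trivial_limit_def eventually_filtermap eventually_inf_principal)
  obtain B where B: "compact B" "T ` cball 0 C \<subseteq> B"
    using compact_opsE[OF T bounded_cball] by metis
  have "\<forall>\<^sub>F y in \<F>. T (g y) \<notin> S \<longrightarrow> T (g y) \<in> B"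
    using bd by eventually_elim (use B(2) in auto)
  then have "\<forall>\<^sub>F z in H. z \<in> B"
    by (simp add: H_def eventually_filtermap eventually_inf_principal)
  then obtain z where z: "inf (nhds z) H \<noteq> bot"
    using B(1) H unfolding compact_filter by blast
  have "z \<notin> S"
  proof
    assume "z \<in> S"
    then have "\<forall>\<^sub>F x in nhds z. x \<in> S" using S(1) by (simp add: eventually_nhds_in_open)
    moreover have "\<forall>\<^sub>F x in H. x \<notin> S"
      by (simp add: H_def eventually_filtermap eventually_inf_principal)
    ultimately have "eventually (\<lambda>_. False) (inf (nhds z) H)" unfolding eventually_inf by blast
    then show False using z by (simp add: trivial_limit_def)
  qed
  then have ne: "z - T l \<noteq> 0" using S(2) by auto
  obtain \<psi> where \<psi>: "functional \<psi>" "\<And>x. norm (\<psi> x) \<le> norm x" "\<psi> (z - T l) = of_real (norm (z - T l))"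
    using ex_norming_functional[of "z - T l"] by blast
  have TL: "T \<in> bounded_ops scale" using T by (rule compact_ops_bounded)
  obtain D where D: "\<And>x. norm (T x) \<le> D * norm x" using op_boundE[OF TL] by metis
  have "functional (\<lambda>x. \<psi> (T x))"
  proof (rule functionalI)
    show "norm (\<psi> (T x)) \<le> D * norm x" for x using order_trans[OF \<psi>(2) D] .
  qed (simp_all add: op_add[OF TL] op_scale[OF TL] functional_add[OF \<psi>(1)] functional_scale[OF \<psi>(1)])
  then have "((\<lambda>y. \<psi> (T (g y))) \<longlongrightarrow> \<psi> (T l)) \<F>" by (rule weak)
  then have "(\<psi> \<longlongrightarrow> \<psi> (T l)) H"
    unfolding H_def filterlim_filtermap by (rule filterlim_mono) auto
  then have l1: "(\<psi> \<longlongrightarrow> \<psi> (T l)) (inf (nhds z) H)" by (rule filterlim_mono) auto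
  have "(\<psi> \<longlongrightarrow> \<psi> z) (nhds z)"
  proof (rule LIM_zero_cancel, rule Lim_null_comparison)
    show "\<forall>\<^sub>F x in nhds z. norm (\<psi> x - \<psi> z) \<le> norm (x - z)"
      unfolding functional_diff[OF \<psi>(1) UNIV_I UNIV_I, symmetric] by (intro always_eventually allI \<psi>(2))
    show "((\<lambda>x. norm (x - z)) \<longlongrightarrow> 0) (nhds z)"
      by (intro tendsto_norm_zero) (simp add: LIM_zero_iff filterlim_ident)
  qed
  then have l2: "(\<psi> \<longlongrightarrow> \<psi> z) (inf (nhds z) H)" by (rule filterlim_mono) auto
  have "\<psi> z = \<psi> (T l)" using tendsto_unique[OF z l2 l1] .
  then show False using \<psi>(3) functional_diff[OF \<psi>(1), of z "T l"] ne by simp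
qed

lemma weakly_continuous_translate:
  assumes P: "weakly_continuous_on_bounded scale P"
  shows "weakly_continuous_on_bounded scale (\<lambda>x. P (x + a))"
proof (rule weakly_continuousI)
  fix \<F> x C
  assume bd: "\<forall>\<^sub>F y in \<F>. norm y \<le> C" and w: "\<And>\<phi>. functional \<phi> \<Longrightarrow> (\<phi> \<longlongrightarrow> \<phi> x) \<F>"
  have "(P \<longlongrightarrow> P (x + a)) (filtermap (\<lambda>y. y + a) \<F>)"
  proof (rule weakly_continuousD[OF P])
    show "\<forall>\<^sub>F y in filtermap (\<lambda>y. y + a) \<F>. norm y \<le> C + norm a"
      unfolding eventually_filtermap using bd
    proof eventually_elim
      case (elim y)
      then show ?case using norm_triangle_ineq[of y a] by simp
    qed
    show "(\<phi> \<longlongrightarrow> \<phi> (x + a)) (filtermap (\<lambda>y. y + a) \<F>)" if "functional \<phi>" for \<phi>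
      using w[OF that] by (auto simp: filterlim_filtermap functional_add[OF that] intro!: tendsto_intros)
  qed
  then show "((\<lambda>x. P (x + a)) \<longlongrightarrow> P (x + a)) \<F>" by (simp add: filterlim_filtermap)
qed

lemma weakly_continuous_diff:
  assumes "weakly_continuous_on_bounded scale P" "weakly_continuous_on_bounded scale Q"
  shows "weakly_continuous_on_bounded scale (\<lambda>x. P x - Q x)"
  using assms unfolding weakly_continuous_on_bounded_iff by (auto intro!: tendsto_diff)

end

section \<open>Weak uniform continuity, and closedness of the weakly continuous polynomials\<close>

context poly_spaces
begin

text \<open>Induction on the degree: if \<open>a\<close> runs through a finite weak net of the ball and \<open>u = x - a\<close>, then
  \<open>P (x + y) - P x = (\<Delta>\<^sub>a P (u + y) - \<Delta>\<^sub>a P u) + (P (u + y) - P u)\<close>, where \<open>\<Delta>\<^sub>a P\<close> has smaller degree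
  and \<open>u\<close> is weakly small.\<close>

lemma weakly_continuous_poly_uniform:
  assumes "alg_poly sE sF m P" "weakly_continuous_on_bounded sE P" "0 < \<epsilon>"
  shows "\<forall>\<^sub>F y in E.weak0. norm y \<le> R \<longrightarrow> (\<forall>x. norm x \<le> R \<longrightarrow> norm (P (x + y) - P x) < \<epsilon>)"
  using assms
proof (induction m arbitrary: P \<epsilon> R)
  case 0
  then show ?case by (simp add: alg_poly_def)
next
  case (Suc m)
  let ?\<Delta> = "\<lambda>a x. P (x + a) - P x"
  \<comment> \<open>Here \<open>u = x - a\<close> has norm at most \<open>2 * R\<close>, and
    \<open>u + y\<close> at most \<open>3 * R\<close>. Two errors of \<open>\<epsilon> / 4\<close>
    at these points bound \<open>P (u + y) - P u\<close>; the other half of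
    \<open>\<epsilon>\<close> is left for the difference of lower degree.\<close>
  have "\<forall>\<^sub>F y in E.weak0. norm y \<le> 3 * R \<longrightarrow> dist (P y) (P 0) < \<epsilon> / 4"
    using Suc.prems by (intro E.weakly_continuous_weak0) auto
  from E.eventually_weak0D[OF this] obtain \<Phi> \<delta>
    where \<Phi>: "finite \<Phi>" "\<forall>\<phi>\<in>\<Phi>. E.functional \<phi>" and \<delta>: "0 < \<delta>"
    and near: "\<forall>y. (\<forall>\<phi>\<in>\<Phi>. norm (\<phi> y) < \<delta>) \<longrightarrow> norm y \<le> 3 * R \<longrightarrow> dist (P y) (P 0) < \<epsilon> / 4"
    by blast
  note \<Phi> = \<Phi>(1) \<Phi>(2)[rule_format] and near = near[rule_format]
  obtain A where A: "A \<subseteq> cball 0 R" "finite A"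
    and net: "\<And>x::'e. norm x \<le> R \<Longrightarrow> \<exists>a\<in>A. \<forall>\<phi>\<in>\<Phi>. norm (\<phi> (x - a)) < \<delta> / 2"
    using E.weakly_totally_bounded[OF \<Phi>, of "\<delta> / 2" "cball 0 R"] \<delta> by auto
  have "\<forall>\<^sub>F y in E.weak0. \<forall>a\<in>A. norm y \<le> 2 * R \<longrightarrow>
      (\<forall>x. norm x \<le> 2 * R \<longrightarrow> norm (?\<Delta> a (x + y) - ?\<Delta> a x) < \<epsilon> / 2)"
    using A(2)
  proof (rule eventually_ball_finite, intro ballI)
    fix a assume "a \<in> A"
    show "\<forall>\<^sub>F y in E.weak0. norm y \<le> 2 * R \<longrightarrow>
        (\<forall>x. norm x \<le> 2 * R \<longrightarrow> norm (?\<Delta> a (x + y) - ?\<Delta> a x) < \<epsilon> / 2)"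
      using Suc.prems
      by (intro Suc.IH alg_poly_difference E.weakly_continuous_diff E.weakly_continuous_translate) auto
  qed
  moreover have "\<forall>\<^sub>F y in E.weak0. \<forall>\<phi>\<in>\<Phi>. norm (\<phi> y) < \<delta> / 2"
    using \<Phi>(1)
  proof (rule eventually_ball_finite, intro ballI)
    fix \<phi> assume "\<phi> \<in> \<Phi>"
    then have "(\<phi> \<longlongrightarrow> 0) E.weak0" using \<Phi>(2) by (intro E.functional_tendsto_weak0)
    from tendstoD[OF this, of "\<delta> / 2"] show "\<forall>\<^sub>F y in E.weak0. norm (\<phi> y) < \<delta> / 2" using \<delta> by simp
  qed
  ultimately show ?case
  proof eventually_elim
    case (elim y)
    show ?case
    proof (intro impI allI)
      fix x :: 'e assume y: "norm y \<le> R" and x: "norm x \<le> R"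
      obtain a where a: "a \<in> A" "\<forall>\<phi>\<in>\<Phi>. norm (\<phi> (x - a)) < \<delta> / 2" using net[OF x] by blast
      define u where "u = x - a"
      have u: "norm u \<le> 2 * R" using norm_triangle_ineq4[of x a] x a(1) A(1) by (auto simp: u_def)
      have R: "0 \<le> R" using norm_ge_zero[of x] x by linarith
      have "dist (P u) (P 0) < \<epsilon> / 4"
        using a(2) u R \<delta> by (intro near) (auto simp: u_def dest: bspec)
      moreover have "dist (P (u + y)) (P 0) < \<epsilon> / 4"
      proof -
        have "norm (\<phi> (u + y)) < \<delta>" if "\<phi> \<in> \<Phi>" for \<phi>
        proof -
          have "\<phi> (u + y) = \<phi> u + \<phi> y" using E.functional_add[OF \<Phi>(2)[OF that]] by simp
          moreover have "norm (\<phi> u) < \<delta> / 2" "norm (\<phi> y) < \<delta> / 2" using a(2) elim that by (auto simp: u_def)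
          ultimately show ?thesis using norm_triangle_ineq[of "\<phi> u" "\<phi> y"] by simp
        qed
        moreover have "norm (u + y) \<le> 3 * R" using norm_triangle_ineq[of u y] u y by simp
        ultimately show ?thesis using near by blast
      qed
      ultimately have "dist (P (u + y)) (P u) < \<epsilon> / 2"
        using dist_triangle2[of "P (u + y)" "P u" "P 0"] by simp
      then have "norm (P (u + y) - P u) < \<epsilon> / 2" by (simp add: dist_norm)
      moreover have "norm (?\<Delta> a (u + y) - ?\<Delta> a u) < \<epsilon> / 2" using elim(1) a(1) u y R by simp
      moreover have "P (x + y) - P x = (?\<Delta> a (u + y) - ?\<Delta> a u) + (P (u + y) - P u)"
        by (simp add: u_def algebra_simps)
      ultimately show "norm (P (x + y) - P x) < \<epsilon>"
        using norm_triangle_ineq[of "?\<Delta> a (u + y) - ?\<Delta> a u" "P (u + y) - P u"] by simp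
    qed
  qed
qed

lemma weak_hom_polys_subset: "weak_hom_polys sE sF n \<subseteq> hom_polys sE sF n"
  by (auto simp: weak_hom_polys_def)

lemma closed_subspace_weak_hom_polys:
  "closed_subspace (fun_scale sF) poly_norm (weak_hom_polys sE sF n) (hom_polys sE sF n)"
  unfolding closed_subspace_def
proof (intro conjI ballI impI)
  show "weak_hom_polys sE sF n \<subseteq> hom_polys sE sF n" by (rule weak_hom_polys_subset)
  interpret H: seminormed_over "fun_scale sF" poly_norm "hom_polys sE sF n" by (rule seminormed_hom_polys)
  show "V.subspace (weak_hom_polys sE sF n)"
  proof (rule V.subspaceI)
    show "0 \<in> weak_hom_polys sE sF n"
      using V.subspace_0[OF H.X]
      by (simp add: weak_hom_polys_def weakly_continuous_on_bounded_iff) (simp add: zero_fun_def)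
    show "P + Q \<in> weak_hom_polys sE sF n"
      if "P \<in> weak_hom_polys sE sF n" "Q \<in> weak_hom_polys sE sF n" for P Q
      using that hom_polys_add[of P n Q] unfolding weak_hom_polys_def weakly_continuous_on_bounded_iff
      by (auto simp: plus_fun_def intro!: tendsto_add)
    show "fun_scale sF a P \<in> weak_hom_polys sE sF n" if "P \<in> weak_hom_polys sE sF n" for a P
    proof -
      have "bounded_linear (sF a)"
        using F.op_bounded_linear[OF F.bounded_ops_fun_scale[OF F.bounded_ops_id, of a]]
        by (simp add: fun_scale_def)
      note lim = bounded_linear.tendsto[OF this]
      show ?thesis
        using that hom_polys_fun_scale[of P n a] unfolding weak_hom_polys_def weakly_continuous_on_bounded_iff
        by (auto simp: fun_scale_def intro!: lim)
    qed
  qed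
  fix P assume P: "P \<in> hom_polys sE sF n" and close: "\<forall>e>0. \<exists>Q\<in>weak_hom_polys sE sF n. poly_norm (P - Q) < e"
  have "weakly_continuous_on_bounded sE P"
  proof (rule E.weakly_continuousI)
    fix \<F> x C
    assume bd: "\<forall>\<^sub>F y in \<F>. norm y \<le> C" and w: "\<And>\<phi>. E.functional \<phi> \<Longrightarrow> (\<phi> \<longlongrightarrow> \<phi> x) \<F>"
    show "(P \<longlongrightarrow> P x) \<F>"
    proof (rule tendstoI)
      fix e :: real assume e: "0 < e"
      \<comment> \<open>\<open>B\<close> bounds \<open>x\<close> and eventually the points of the
        filter, and \<open>d\<close> is chosen so that \<open>P\<close> and \<open>Q\<close> differ
        by at most \<open>e / 3\<close> on the ball of radius \<open>B\<close>.\<close>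
      define B where "B = max 1 (max C (norm x))"
      define d where "d = e / (3 * B ^ n)"
      have B: "1 \<le> B" by (simp add: B_def)
      then have Bn: "0 < B ^ n" by simp
      then have d: "0 < d" using e by (simp add: d_def)
      obtain Q where Q: "Q \<in> weak_hom_polys sE sF n" "poly_norm (P - Q) < d" using close d by blast
      have "Q \<in> hom_polys sE sF n" using Q(1) weak_hom_polys_subset by blast
      then have PQ: "P - Q \<in> hom_polys sE sF n" by (rule V.subspace_diff[OF H.X P])
      have near: "dist (P y) (Q y) \<le> e / 3" if "norm y \<le> B" for y
      proof -
        have "norm ((P - Q) y) \<le> poly_norm (P - Q) * norm y ^ n" by (rule norm_le_poly_norm[OF PQ])
        also have "\<dots> \<le> d * B ^ n" using Q(2) that d by (intro mult_mono power_mono) auto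
        also have "\<dots> = e / 3" using B by (simp add: d_def)
        finally show ?thesis by (simp add: dist_norm)
      qed
      have "(Q \<longlongrightarrow> Q x) \<F>"
        using Q(1) by (intro E.weakly_continuousD[OF _ bd w]) (simp_all add: weak_hom_polys_def)
      then have "\<forall>\<^sub>F y in \<F>. dist (Q y) (Q x) < e / 3" using e by (intro tendstoD) auto
      then show "\<forall>\<^sub>F y in \<F>. dist (P y) (P x) < e" using bd
      proof eventually_elim
        case (elim y)
        have "dist (P y) (Q y) \<le> e / 3" "dist (P x) (Q x) \<le> e / 3"
          by (rule near, use elim in \<open>simp add: B_def\<close>)+
        then show ?case
          using elim(1) dist_triangle[of "P y" "P x" "Q y"] dist_triangle2[of "Q y" "P x" "Q x"] by simp
      qed
    qed
  qed
  then show "P \<in> weak_hom_polys sE sF n" using P by (simp add: weak_hom_polys_def)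
qed

end


section \<open>Polynomials at the critical degree\<close>

lemma normed_space_over_mult: "normed_space_over ((*) :: 'k::real_or_complex \<Rightarrow> 'k \<Rightarrow> 'k)"
  by unfold_locales (auto simp: algebra_simps norm_mult scaleR_conv_of_real)

context poly_spaces
begin

text \<open>Boundedness of \<open>f\<close> passes to its homogeneous components, which are
  therefore continuous. Those of degree between 1 and \<open>n - 1\<close> are weakly continuous on
  bounded sets because they lie below the critical degree; degree 0 is constant.\<close>

lemma scalar_poly_weakly_continuous:
  assumes cd: "\<And>k. 1 \<le> k \<Longrightarrow> k < n \<Longrightarrow> weak_hom_polys sE (*) k = hom_polys sE (*) k"
    and f: "alg_poly sE (*) n f" and bd: "\<And>x. norm x \<le> 1 \<Longrightarrow> norm (f x) \<le> M"
  shows "weakly_continuous_on_bounded sE f"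
proof -
  interpret S: poly_spaces sE "(*) :: 'k \<Rightarrow> 'k \<Rightarrow> 'k"
    using E.normed_space_over_axioms normed_space_over_mult by (simp add: poly_spaces_def)
  obtain h where h: "\<forall>k<n. alg_hom sE (*) k (h k)" "\<And>x. f x = (\<Sum>k<n. h k x)"
    using f by (auto simp: alg_poly_def)
  obtain C where C: "0 \<le> C" and Q: "\<forall>(h :: nat \<Rightarrow> 'e \<Rightarrow> 'k) M. (\<forall>k<n. alg_hom sE (*) k (h k)) \<longrightarrow>
     (\<forall>x. norm x \<le> 1 \<longrightarrow> norm (\<Sum>k<n. h k x) \<le> M) \<longrightarrow>
     (\<forall>k<n. \<forall>x. norm x \<le> 1 \<longrightarrow> norm (h k x) \<le> C * M)"
    using S.alg_poly_components_bound[of n] by blast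
  have wc: "weakly_continuous_on_bounded sE (h k)" if k: "k < n" for k
  proof (cases "k = 0")
    case True
    have "h k x = h k 0" for x
      using S.alg_hom_scaleR[of k "h k" 0 x] h(1) k True by simp
    then have const: "h k = (\<lambda>x. h k 0)" by blast
    show ?thesis by (subst const) (auto simp: weakly_continuous_on_bounded_iff)
  next
    case False
    have hk: "alg_hom sE (*) k (h k)" using h(1) k by simp
    have "norm (h k x) \<le> C * M" if "norm x \<le> 1" for x
      using Q[rule_format, of h M k x] h bd k that by simp
    from S.alg_hom_continuous[OF hk this] have "h k \<in> hom_polys sE (*) k"
      using hk by (simp add: hom_polys_iff)
    then have "h k \<in> weak_hom_polys sE (*) k" using cd[of k] False k by simp
    then show ?thesis by (simp add: weak_hom_polys_def)
  qed
  have "f = (\<lambda>x. \<Sum>k<n. h k x)" using h(2) by blast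
  then show ?thesis
    using wc unfolding weakly_continuous_on_bounded_iff by (auto intro!: tendsto_sum)
qed

text \<open>The difference loses one degree, and \<open>\<psi>\<close> makes it scalar valued, so
  that the hypothesis on lower degrees applies.\<close>

lemma hom_poly_difference_weak:
  assumes cd: "\<And>k. 1 \<le> k \<Longrightarrow> k < n \<Longrightarrow> weak_hom_polys sE (*) k = hom_polys sE (*) k"
    and Q: "Q \<in> hom_polys sE sF n" and \<psi>: "F.functional \<psi>"
  shows "weakly_continuous_on_bounded sE (\<lambda>x. \<psi> (Q (x + a) - Q x))"
proof -
  have lin: "Vector_Spaces.linear sF (*) \<psi>"
    using F.vector_space_axioms normed_space_over.axioms(1)[OF normed_space_over_mult]
    by (simp add: Vector_Spaces.linear_iff F.functional_add[OF \<psi>] F.functional_scale[OF \<psi>])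
  have "alg_poly sE sF n (\<lambda>x. Q (x + a) - Q x)"
    using Q by (intro alg_hom_difference) (simp add: hom_polys_iff)
  then have poly: "alg_poly sE (*) n (\<lambda>x. \<psi> (Q (x + a) - Q x))" using lin by (rule alg_poly_compose_left)
  obtain c where c: "0 \<le> c" "\<And>x. norm (\<psi> x) \<le> c * norm x" using F.functional_boundE[OF \<psi>] by auto
  show ?thesis
  proof (rule scalar_poly_weakly_continuous[OF cd poly])
    fix x :: 'e assume x: "norm x \<le> 1"
    have "norm (Q (x + a)) \<le> poly_norm Q * (1 + norm a) ^ n"
    proof -
      have "norm (x + a) \<le> 1 + norm a" using norm_triangle_ineq[of x a] x by simp
      then have "poly_norm Q * norm (x + a) ^ n \<le> poly_norm Q * (1 + norm a) ^ n"
        using poly_norm_nonneg[OF Q] by (intro mult_left_mono power_mono) auto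
      then show ?thesis using norm_le_poly_norm[OF Q, of "x + a"] by simp
    qed
    then have "norm (Q (x + a) - Q x) \<le> poly_norm Q * (1 + norm a) ^ n + poly_norm Q"
      using norm_triangle_ineq4[of "Q (x + a)" "Q x"] poly_norm_upper[OF Q x] by simp
    then have "c * norm (Q (x + a) - Q x) \<le> c * (poly_norm Q * (1 + norm a) ^ n + poly_norm Q)"
      using c(1) by (rule mult_left_mono)
    then show "norm (\<psi> (Q (x + a) - Q x)) \<le> c * (poly_norm Q * (1 + norm a) ^ n + poly_norm Q)"
      using c(2)[of "Q (x + a) - Q x"] by linarith
  qed
qed

lemma hom_polys_compose_left:
  assumes "S \<in> bounded_ops sF" "P \<in> hom_polys sE sF n"
  shows "(\<lambda>x. S (P x)) \<in> hom_polys sE sF n"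
proof -
  have "Vector_Spaces.linear sF sF S" "continuous_on UNIV S"
    using assms(1) by (auto simp: bounded_ops_def linear_continuous_on)
  then show ?thesis
    using assms(2) alg_hom_compose_left[of sE sF n P sF S] continuous_on_compose2[of UNIV S UNIV P]
    by (simp add: hom_polys_iff)
qed

lemma hom_polys_compose_right:
  assumes "T \<in> bounded_ops sE" "P \<in> hom_polys sE sF n"
  shows "(\<lambda>x. P (T x)) \<in> hom_polys sE sF n"
proof -
  have "Vector_Spaces.linear sE sE T" "continuous_on UNIV T"
    using assms(1) by (auto simp: bounded_ops_def linear_continuous_on)
  then show ?thesis
    using assms(2) alg_hom_compose_right[of sE sF n P T] continuous_on_compose2[of UNIV P UNIV T]
    by (simp add: hom_polys_iff)
qed

lemma compose_compact_weak:
  assumes K: "K \<in> compact_ops sE" and Q: "Q \<in> hom_polys sE sF n"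
  shows "(\<lambda>x. Q (K x)) \<in> weak_hom_polys sE sF n"
proof -
  have "weakly_continuous_on_bounded sE (\<lambda>x. Q (K x))"
  proof (rule E.weakly_continuousI)
    fix \<F> x C
    assume bd: "\<forall>\<^sub>F y in \<F>. norm y \<le> C" and w: "\<And>\<phi>. E.functional \<phi> \<Longrightarrow> (\<phi> \<longlongrightarrow> \<phi> x) \<F>"
    have "(K \<longlongrightarrow> K x) \<F>" using E.compact_op_weak_tendsto[OF K bd w] by simp
    moreover have "isCont Q (K x)"
      using Q by (simp add: hom_polys_iff continuous_on_eq_continuous_at)
    ultimately show "((\<lambda>x. Q (K x)) \<longlongrightarrow> Q (K x)) \<F>" by (rule isCont_tendsto_compose[rotated])
  qed
  then show ?thesis
    using hom_polys_compose_right[OF E.compact_ops_bounded[OF K] Q] by (simp add: weak_hom_polys_def)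
qed

text \<open>Since \<open>K\<close> maps weakly convergent bounded nets to norm convergent ones, \<open>K x\<close> may be treated
  as a constant \<open>a\<close>, and \<open>Q x - Q (x - a)\<close> has degree less than \<open>n\<close>.\<close>

lemma difference_compact_weak:
  assumes cd: "\<And>k. 1 \<le> k \<Longrightarrow> k < n \<Longrightarrow> weak_hom_polys sE (*) k = hom_polys sE (*) k"
    and K: "K \<in> compact_ops sE" and S: "S \<in> compact_ops sF" and Q: "Q \<in> hom_polys sE sF n"
  shows "(\<lambda>x. S (Q x - Q (x - K x))) \<in> weak_hom_polys sE sF n"
proof -
  have SL: "S \<in> bounded_ops sF" and KL: "K \<in> bounded_ops sE"
    using S K by (auto intro: F.compact_ops_bounded E.compact_ops_bounded)
  have IK: "(\<lambda>x. x - K x) \<in> bounded_ops sE"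
  proof -
    have "(\<lambda>x. x) + fun_scale sE (- 1) K \<in> bounded_ops sE"
      using KL by (intro E.bounded_ops_add E.bounded_ops_id E.bounded_ops_fun_scale)
    then show ?thesis by (simp add: plus_fun_def fun_scale_def)
  qed
  interpret H: seminormed_over "fun_scale sF" poly_norm "hom_polys sE sF n" by (rule seminormed_hom_polys)
  have "Q - (\<lambda>x. Q (x - K x)) \<in> hom_polys sE sF n"
    using Q hom_polys_compose_right[OF IK Q] by (rule V.subspace_diff[OF H.X])
  then have hom: "(\<lambda>x. S (Q x - Q (x - K x))) \<in> hom_polys sE sF n"
    using hom_polys_compose_left[OF SL] by (fastforce simp: fun_diff_def)
  have "weakly_continuous_on_bounded sE (\<lambda>x. S (Q x - Q (x - K x)))"
  proof (rule E.weakly_continuousI)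
    fix \<F> x C
    assume bd: "\<forall>\<^sub>F y in \<F>. norm y \<le> C" and w: "\<And>\<phi>. E.functional \<phi> \<Longrightarrow> (\<phi> \<longlongrightarrow> \<phi> x) \<F>"
    define a where "a = K x"
    \<comment> \<open>\<open>C'\<close> eventually bounds both \<open>y\<close> and
      \<open>y - a\<close>; one further unit leaves room for the Lipschitz estimate that moves
      \<open>y - a\<close> to \<open>y - K y\<close>.\<close>
    define C' where "C' = max C 0 + norm a"
    have Ka: "(K \<longlongrightarrow> a) \<F>" using E.compact_op_weak_tendsto[OF K bd w] by (simp add: a_def)
    have bound: "norm (Q y) \<le> poly_norm Q * (C' + 1) ^ n" if "norm y \<le> C' + 1" for y
      using norm_le_poly_norm[OF Q, of y] that poly_norm_nonneg[OF Q]
        mult_left_mono[OF power_mono[of "norm y" "C' + 1" n] poly_norm_nonneg[OF Q]] by simp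
    \<comment> \<open>With \<open>a\<close> fixed, the values \<open>Q y - Q (y - a)\<close> are
      bounded and converge weakly in \<open>F\<close>; the compact \<open>S\<close> makes this norm
      convergence.\<close>
    have "((\<lambda>y. S (Q y - Q (y + - a))) \<longlongrightarrow> S (Q x - Q (x + - a))) \<F>"
    proof (rule F.compact_op_weak_tendsto[OF S])
      show "\<forall>\<^sub>F y in \<F>. norm (Q y - Q (y + - a)) \<le> 2 * (poly_norm Q * (C' + 1) ^ n)"
        using bd
      proof eventually_elim
        case (elim y)
        have "norm y \<le> C' + 1" "norm (y + - a) \<le> C' + 1"
          using elim norm_triangle_ineq4[of y a] norm_ge_zero[of a] max.cobounded1[of C 0]
          unfolding C'_def add_uminus_conv_diff by linarith+
        then show ?case
          using bound[of y] bound[of "y + - a"] norm_triangle_ineq4[of "Q y" "Q (y + - a)"] by simp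
      qed
      fix \<psi> assume \<psi>: "F.functional \<psi>"
      have "((\<lambda>y. \<psi> (Q (y + - a) - Q y)) \<longlongrightarrow> \<psi> (Q (x + - a) - Q x)) \<F>"
        by (rule E.weakly_continuousD[OF hom_poly_difference_weak[OF cd Q \<psi>] bd w])
      from tendsto_minus[OF this]
      show "((\<lambda>y. \<psi> (Q y - Q (y + - a))) \<longlongrightarrow> \<psi> (Q x - Q (x + - a))) \<F>"
        using F.functional_diff[OF \<psi>] by simp
    qed
    \<comment> \<open>Replacing the constant \<open>a\<close> by \<open>K y\<close> costs at most a
      multiple of \<open>norm (K y - a)\<close>, which tends to 0.\<close>
    moreover have "((\<lambda>y. S (Q (y - a) - Q (y - K y))) \<longlongrightarrow> 0) \<F>"
    proof -
      obtain L where L: "0 \<le> L" "\<And>z y. norm z \<le> C' \<Longrightarrow> norm y \<le> 1 \<Longrightarrow> norm (Q (z + y) - Q z) \<le> L * norm y"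
        using alg_poly_Lipschitz[of "Suc n" Q C' "poly_norm Q * (C' + 1) ^ n"] bound Q
        by (auto simp: hom_polys_iff alg_poly_alg_hom)
      have "\<forall>\<^sub>F y in \<F>. norm (K y - a) < 1" using tendstoD[OF Ka, of 1] by (simp add: dist_norm)
      then have "\<forall>\<^sub>F y in \<F>. norm (Q (y - a) - Q (y - K y)) \<le> L * norm (K y - a)"
        using bd
      proof eventually_elim
        case (elim y)
        have "norm (y - a) \<le> C'" using elim norm_triangle_ineq4[of y a] by (auto simp: C'_def max_def)
        then have "norm (Q ((y - a) + (a - K y)) - Q (y - a)) \<le> L * norm (a - K y)"
          using elim by (intro L) (auto simp: norm_minus_commute)
        then show ?case by (simp add: norm_minus_commute)
      qed
      moreover have "((\<lambda>y. L * norm (K y - a)) \<longlongrightarrow> 0) \<F>"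
        using tendsto_mult_left[OF tendsto_norm_zero[OF LIM_zero[OF Ka]], of L] by simp
      ultimately have "((\<lambda>y. Q (y - a) - Q (y - K y)) \<longlongrightarrow> 0) \<F>" by (rule Lim_null_comparison)
      from bounded_linear.tendsto[OF F.op_bounded_linear[OF SL] this] show ?thesis
        by (simp add: F.op_0[OF SL])
    qed
    ultimately have "((\<lambda>y. S (Q y - Q (y + - a)) + S (Q (y - a) - Q (y - K y)))
        \<longlongrightarrow> S (Q x - Q (x + - a)) + 0) \<F>"
      by (rule tendsto_add)
    then show "((\<lambda>x. S (Q x - Q (x - K x))) \<longlongrightarrow> S (Q x - Q (x - K x))) \<F>"
      by (simp add: a_def F.op_diff[OF SL])
  qed
  then show ?thesis using hom by (simp add: weak_hom_polys_def)
qed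

section \<open>Convergence and norm estimates of the approximating operators\<close>

lemma poly_norm_tendsto_0:
  assumes "\<And>d. f d \<in> hom_polys sE sF n"
    and "\<And>\<epsilon>. 0 < \<epsilon> \<Longrightarrow> \<forall>\<^sub>F d in G. \<forall>x. norm x \<le> 1 \<longrightarrow> norm (f d x) \<le> \<epsilon>"
  shows "((\<lambda>d. poly_norm (f d)) \<longlongrightarrow> 0) G"
proof (rule tendstoI)
  fix e :: real assume "0 < e"
  then have "\<forall>\<^sub>F d in G. \<forall>x. norm x \<le> 1 \<longrightarrow> norm (f d x) \<le> e / 2" by (intro assms(2)) simp
  then show "\<forall>\<^sub>F d in G. dist (poly_norm (f d)) 0 < e"
  proof eventually_elim
    case (elim d)
    then have "poly_norm (f d) \<le> e / 2" by (intro poly_norm_least) blast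
    then show ?case using poly_norm_nonneg[OF assms(1)] \<open>0 < e\<close> by (simp add: dist_norm abs_of_nonneg)
  qed
qed

text \<open>The two approximations of the identity of \<open>\<P>\<^sub>w\<close> are \<open>Q \<mapsto> S \<circ> (Q - Q \<circ> (I - K))\<close>, which
  satisfies the estimate for the maximum norm, and \<open>Q \<mapsto> Q \<circ> K\<close>, which is asymptotically
  contractive. In the estimate, \<open>P\<close> is replaced by \<open>S \<circ> P \<circ> K\<close>, so that
  \<open>P + Q - S \<circ> (Q - Q \<circ> (I - K))\<close> becomes \<open>(I - S) \<circ> Q + S \<circ> (Q \<circ> (I - K) + P \<circ> K)\<close>.\<close>

theorem M_ideal_weak_hom_polys:
  fixes K :: "'d \<Rightarrow> 'e \<Rightarrow> 'e" and S :: "'d \<Rightarrow> 'f \<Rightarrow> 'f"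
  assumes n: "1 \<le> n" and cd: "\<And>k. 1 \<le> k \<Longrightarrow> k < n \<Longrightarrow> weak_hom_polys sE (*) k = hom_polys sE (*) k"
    and G: "G \<noteq> bot" and K: "\<And>d. K d \<in> compact_ops sE" and S: "\<And>d. S d \<in> compact_ops sF"
    and K_dual: "\<And>\<phi> \<epsilon>. E.functional \<phi> \<Longrightarrow> 0 < \<epsilon> \<Longrightarrow>
      \<forall>\<^sub>F d in G. \<forall>x. norm (\<phi> (K d x - x)) \<le> \<epsilon> * norm x"
    and K_norm: "\<And>\<epsilon>. 0 < \<epsilon> \<Longrightarrow>
      \<forall>\<^sub>F d in G. \<forall>x. norm (K d x) ^ n + norm (x - K d x) ^ n \<le> (1 + \<epsilon>) * norm x ^ n"
    and S_norm: "\<And>\<epsilon>. 0 < \<epsilon> \<Longrightarrow>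
      \<forall>\<^sub>F d in G. \<forall>x y. norm (S d x + (y - S d y)) \<le> (1 + \<epsilon>) * max (norm x) (norm y)"
    and S_id: "\<And>c \<epsilon>. 0 < \<epsilon> \<Longrightarrow> \<forall>\<^sub>F d in G. norm (S d c - c) \<le> \<epsilon>"
  shows "M_ideal (fun_scale sF) poly_norm (weak_hom_polys sE sF n) (hom_polys sE sF n)"
proof -
  let ?X = "hom_polys sE sF n" and ?J = "weak_hom_polys sE sF n"
  interpret H: seminormed_over "fun_scale sF" poly_norm ?X by (rule seminormed_hom_polys)
  note SL = F.compact_ops_bounded[OF S]
  have JX: "P \<in> ?X" if "P \<in> ?J" for P using that weak_hom_polys_subset by blast
  \<comment> \<open>The inequality with \<open>\<epsilon> = 1\<close> bounds the power by 2, and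
    \<open>2 \<le> 2 ^ n\<close> as \<open>n \<ge> 1\<close>, which bounds the norm itself.\<close>
  have K2: "\<forall>\<^sub>F d in G. \<forall>x. norm x \<le> 1 \<longrightarrow> norm (x - K d x) ^ n \<le> 2 \<and> norm (x - K d x) \<le> 2"
    using K_norm[OF zero_less_one]
  proof eventually_elim
    case (elim d)
    show ?case
    proof (intro allI impI)
      fix x :: 'e assume x: "norm x \<le> 1"
      have "norm (x - K d x) ^ n \<le> norm (K d x) ^ n + norm (x - K d x) ^ n" by simp
      also have "\<dots> \<le> (1 + 1) * norm x ^ n" using elim by blast
      also have "\<dots> \<le> 2" using power_le_one[OF norm_ge_zero x, of n] by simp
      finally have le: "norm (x - K d x) ^ n \<le> 2" .
      also have "(2::real) = 2 ^ 1" by simp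
      also have "\<dots> \<le> 2 ^ n" using n by (intro power_increasing) auto
      finally have "norm (x - K d x) ^ n \<le> 2 ^ n" .
      then have "norm (x - K d x) \<le> 2" using n by (simp add: power_mono_iff)
      with le show "norm (x - K d x) ^ n \<le> 2 \<and> norm (x - K d x) \<le> 2" by blast
    qed
  qed
  have S2: "\<forall>\<^sub>F d in G. \<forall>z. norm (S d z) \<le> 2 * norm z"
    using S_norm[OF zero_less_one]
  proof eventually_elim
    case (elim d)
    show ?case using elim[rule_format, of _ 0] F.op_0[OF SL[of d]] by simp
  qed
  \<comment> \<open>Norm convergence of the adjoints makes \<open>K d x - x\<close> weakly small
    uniformly over the unit ball: only finitely many functionals define a weak
    neighbourhood.\<close>
  have weakly_small: "\<forall>\<^sub>F d in G. \<forall>x. norm x \<le> 1 \<longrightarrow> W (K d x - x) \<and> W (x - K d x)"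
    if W: "eventually W E.weak0" for W
  proof -
    obtain \<Phi> \<delta> where \<Phi>: "finite \<Phi>" "\<forall>\<phi>\<in>\<Phi>. E.functional \<phi>" and \<delta>: "0 < \<delta>"
      and near: "\<forall>y. (\<forall>\<phi>\<in>\<Phi>. norm (\<phi> y) < \<delta>) \<longrightarrow> W y"
      using E.eventually_weak0D[OF W] by blast
    have "\<forall>\<^sub>F d in G. \<forall>\<phi>\<in>\<Phi>. \<forall>x. norm (\<phi> (K d x - x)) \<le> (\<delta> / 2) * norm x"
      using \<Phi> \<delta> by (intro eventually_ball_finite ballI K_dual) auto
    then show ?thesis
    proof eventually_elim
      case (elim d)
      show ?case
      proof (intro allI impI)
        fix x :: 'e assume x: "norm x \<le> 1"
        have lt: "norm (\<phi> (K d x - x)) < \<delta>" if "\<phi> \<in> \<Phi>" for \<phi>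
        proof -
          have "norm (\<phi> (K d x - x)) \<le> (\<delta> / 2) * norm x" using elim that by blast
          also have "\<dots> \<le> \<delta> / 2" using x \<delta> by simp
          finally show ?thesis using \<delta> by simp
        qed
        moreover have "norm (\<phi> (x - K d x)) < \<delta>" if "\<phi> \<in> \<Phi>" for \<phi>
          using lt[OF that] E.functional_neg[of \<phi> "K d x - x"] \<Phi>(2) that by simp
        ultimately show "W (K d x - x) \<and> W (x - K d x)" using near by blast
      qed
    qed
  qed
  \<comment> \<open>Weak uniform continuity on the ball of radius 2 is used twice: at
    \<open>x\<close> with increment \<open>K d x - x\<close>, and at 0 with increment
    \<open>x - K d x\<close>, where \<open>P 0 = 0\<close>.\<close>
  have uniform: "\<forall>\<^sub>F d in G. \<forall>x. norm x \<le> 1 \<longrightarrow> norm (P (K d x) - P x) \<le> \<epsilon> \<and> norm (P (x - K d x)) \<le> \<epsilon>"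
    if P: "P \<in> ?J" and \<epsilon>: "0 < \<epsilon>" for P \<epsilon>
  proof -
    have alg: "alg_hom sE sF n P" and wc: "weakly_continuous_on_bounded sE P"
      using P by (auto simp: weak_hom_polys_def hom_polys_iff)
    have "\<forall>\<^sub>F y in E.weak0. norm y \<le> 2 \<longrightarrow> (\<forall>x. norm x \<le> 2 \<longrightarrow> norm (P (x + y) - P x) < \<epsilon>)"
      by (rule weakly_continuous_poly_uniform[OF alg_poly_alg_hom[OF alg] wc \<epsilon>])
    from weakly_small[OF this] K2 show ?thesis
    proof eventually_elim
      case (elim d)
      show ?case
      proof (intro allI impI)
        fix x :: 'e assume x: "norm x \<le> 1"
        have le: "norm (x - K d x) \<le> 2" "norm (K d x - x) \<le> 2"
          using elim(2) x by (auto simp: norm_minus_commute)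
        have "\<forall>z. norm z \<le> 2 \<longrightarrow> norm (P (z + (K d x - x)) - P z) < \<epsilon>"
          "\<forall>z. norm z \<le> 2 \<longrightarrow> norm (P (z + (x - K d x)) - P z) < \<epsilon>"
          using elim(1) x le by blast+
        from this(1)[rule_format, of x] this(2)[rule_format, of 0]
        have "norm (P (x + (K d x - x)) - P x) < \<epsilon>" "norm (P (0 + (x - K d x)) - P 0) < \<epsilon>"
          using x by auto
        moreover have "P 0 = 0" using alg_hom_0_arg[OF alg] n by simp
        ultimately show "norm (P (K d x) - P x) \<le> \<epsilon> \<and> norm (P (x - K d x)) \<le> \<epsilon>" by simp
      qed
    qed
  qed
  have S_uniform: "\<forall>\<^sub>F d in G. \<forall>x. norm x \<le> 1 \<longrightarrow> norm (S d (P x) - P x) \<le> \<epsilon>"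
    if P: "P \<in> ?J" and \<epsilon>: "0 < \<epsilon>" for P \<epsilon>
  proof -
    \<comment> \<open>Up to \<open>\<delta>\<close>, one fixed \<open>K d0\<close> puts the values
      of \<open>P\<close> on the unit ball into a compact set, which has a finite net. With
      \<open>P x\<close> within \<open>2 * \<delta>\<close> of a net point \<open>c\<close>, the
      three error terms are at most \<open>4 * \<delta>\<close>, \<open>\<delta>\<close> and
      \<open>2 * \<delta>\<close>, together \<open>7 * \<delta>\<close>.\<close>
    define \<delta> where "\<delta> = \<epsilon> / 7"
    have \<delta>: "0 < \<delta>" using \<epsilon> by (simp add: \<delta>_def)
    obtain d0 where d0: "\<And>x. norm x \<le> 1 \<Longrightarrow> norm (P (K d0 x) - P x) \<le> \<delta>"
      using eventually_happens'[OF G uniform[OF P \<delta>]] by blast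
    obtain B where B: "compact B" "K d0 ` cball 0 1 \<subseteq> B" using E.compact_opsE[OF K bounded_cball] by metis
    have "continuous_on B P" using JX[OF P] continuous_on_subset by (auto simp: hom_polys_iff)
    then have "compact (P ` B)" using B(1) by (rule compact_continuous_image)
    then have "\<forall>e>0. \<exists>Z. finite Z \<and> P ` B \<subseteq> (\<Union>z\<in>Z. ball z e)"
      unfolding compact_eq_totally_bounded by (rule conjunct2)
    then obtain Z where Z: "finite Z" "P ` B \<subseteq> (\<Union>z\<in>Z. ball z \<delta>)" using \<delta> by blast
    have "\<forall>\<^sub>F d in G. \<forall>c\<in>Z. norm (S d c - c) \<le> \<delta>"
      using Z(1) S_id[OF \<delta>] by (intro eventually_ball_finite) auto
    with S2 show ?thesis
    proof eventually_elim
      case (elim d)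
      show ?case
      proof (intro allI impI)
        fix x :: 'e assume x: "norm x \<le> 1"
        then have "P (K d0 x) \<in> P ` B" using B(2) by (auto simp: image_subset_iff)
        then obtain c where c: "c \<in> Z" "dist c (P (K d0 x)) < \<delta>" using Z(2) by auto
        have near: "norm (P x - c) \<le> 2 * \<delta>"
          using d0[OF x] c(2) norm_triangle_ineq4[of "P (K d0 x) - c" "P (K d0 x) - P x"]
          by (simp add: dist_norm norm_minus_commute)
        have "S d (P x) - P x = S d (P x - c) + (S d c - c) - (P x - c)"
          by (simp add: F.op_diff[OF SL])
        then have "norm (S d (P x) - P x) \<le> norm (S d (P x - c)) + norm (S d c - c) + norm (P x - c)"
          using norm_triangle_ineq4[of "S d (P x - c) + (S d c - c)" "P x - c"]
            norm_triangle_ineq[of "S d (P x - c)" "S d c - c"] by simp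
        moreover have "norm (S d (P x - c)) \<le> 2 * norm (P x - c)" "norm (S d c - c) \<le> \<delta>"
          using elim c(1) by auto
        ultimately show "norm (S d (P x) - P x) \<le> \<epsilon>" using near by (simp add: \<delta>_def)
      qed
    qed
  qed
  define \<Phi> where "\<Phi> d Q = (\<lambda>x. S d (Q x - Q (x - K d x)))" for d and Q :: "'e \<Rightarrow> 'f"
  define \<Psi> where "\<Psi> d Q = (\<lambda>x. Q (K d x))" for d and Q :: "'e \<Rightarrow> 'f"
  have \<Phi>_J: "\<Phi> d Q \<in> ?J" if "Q \<in> ?X" for d Q
    unfolding \<Phi>_def by (rule difference_compact_weak[OF cd K S that])
  have \<Psi>_J: "\<Psi> d Q \<in> ?J" if "Q \<in> ?X" for d Q
    unfolding \<Psi>_def by (rule compose_compact_weak[OF K that])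
  show ?thesis
  proof (rule M_ideal_criterion[OF seminormed_hom_polys closed_subspace_weak_hom_polys G,
        where \<Phi> = \<Phi> and \<Psi> = \<Psi> and C = 6])
    show "\<Phi> d Q \<in> ?J" if "Q \<in> ?X" for d Q using that by (rule \<Phi>_J)
    show "\<Psi> d Q \<in> ?J" if "Q \<in> ?X" for d Q using that by (rule \<Psi>_J)
    show "\<Phi> d (P + Q) = \<Phi> d P + \<Phi> d Q" for d P Q
      by (simp add: \<Phi>_def fun_eq_iff F.op_diff[OF SL] F.op_add[OF SL])
    show "\<Phi> d (fun_scale sF a Q) = fun_scale sF a (\<Phi> d Q)" for d a Q
      by (simp add: \<Phi>_def fun_eq_iff fun_scale_def F.op_diff[OF SL] F.op_scale[OF SL] F.scale_right_diff_distrib)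
    show "\<Psi> d (P + Q) = \<Psi> d P + \<Psi> d Q" for d P Q by (simp add: \<Psi>_def fun_eq_iff)
    show "\<Psi> d (fun_scale sF a Q) = fun_scale sF a (\<Psi> d Q)" for d a Q
      by (simp add: \<Psi>_def fun_eq_iff fun_scale_def)
    \<comment> \<open>The factor 6 is 2 from \<open>S2\<close> times 3, where 1 comes from
      \<open>Q x\<close> and 2 from \<open>Q (x - K d x)\<close>.\<close>
    show "\<forall>\<^sub>F d in G. \<forall>Q\<in>?X. poly_norm (\<Phi> d Q) \<le> 6 * poly_norm Q"
      using S2 K2
    proof eventually_elim
      case (elim d)
      show ?case
      proof (intro ballI poly_norm_least)
        fix Q and x :: 'e assume Q: "Q \<in> ?X" and x: "norm x \<le> 1"
        have "norm (Q (x - K d x)) \<le> poly_norm Q * norm (x - K d x) ^ n" by (rule norm_le_poly_norm[OF Q])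
        also have "\<dots> \<le> poly_norm Q * 2"
          using elim(2) x poly_norm_nonneg[OF Q] by (intro mult_left_mono) auto
        finally have "norm (Q x - Q (x - K d x)) \<le> 3 * poly_norm Q"
          using norm_triangle_ineq4[of "Q x" "Q (x - K d x)"] poly_norm_upper[OF Q x] by simp
        then show "norm (\<Phi> d Q x) \<le> 6 * poly_norm Q"
          using elim(1)[rule_format, of "Q x - Q (x - K d x)"] by (simp add: \<Phi>_def)
      qed
    qed
    show "\<forall>\<^sub>F d in G. \<forall>Q\<in>?X. poly_norm (\<Psi> d Q) \<le> (1 + \<epsilon>) * poly_norm Q" if \<epsilon>: "0 < \<epsilon>" for \<epsilon>
      using K_norm[OF \<epsilon>]
    proof eventually_elim
      case (elim d)
      show ?case
      proof (intro ballI poly_norm_least)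
        fix Q and x :: 'e assume Q: "Q \<in> ?X" and x: "norm x \<le> 1"
        have "norm (K d x) ^ n \<le> norm (K d x) ^ n + norm (x - K d x) ^ n" by simp
        also have "\<dots> \<le> (1 + \<epsilon>) * norm x ^ n" using elim by blast
        also have "\<dots> \<le> 1 + \<epsilon>" using power_le_one[OF norm_ge_zero x, of n] \<epsilon> by simp
        finally have "poly_norm Q * norm (K d x) ^ n \<le> poly_norm Q * (1 + \<epsilon>)"
          using poly_norm_nonneg[OF Q] by (rule mult_left_mono)
        then show "norm (\<Psi> d Q x) \<le> (1 + \<epsilon>) * poly_norm Q"
          using norm_le_poly_norm[OF Q, of "K d x"] by (simp add: \<Psi>_def mult.commute)
      qed
    qed
    fix P assume P: "P \<in> ?J"
    show "((\<lambda>d. poly_norm (\<Psi> d P - P)) \<longlongrightarrow> 0) G"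
    proof (rule poly_norm_tendsto_0)
      show "\<Psi> d P - P \<in> ?X" for d using JX \<Psi>_J P by (intro V.subspace_diff[OF H.X]) blast+
      show "\<forall>\<^sub>F d in G. \<forall>x. norm x \<le> 1 \<longrightarrow> norm ((\<Psi> d P - P) x) \<le> \<epsilon>" if "0 < \<epsilon>" for \<epsilon>
        using uniform[OF P that] by eventually_elim (simp add: \<Psi>_def)
    qed
    show "((\<lambda>d. poly_norm (\<Phi> d P - P)) \<longlongrightarrow> 0) G"
    proof (rule poly_norm_tendsto_0)
      show "\<Phi> d P - P \<in> ?X" for d using JX \<Phi>_J P by (intro V.subspace_diff[OF H.X]) blast+
      fix \<epsilon> :: real assume \<epsilon>: "0 < \<epsilon>"
      then have e: "0 < \<epsilon> / 3" by simp
      show "\<forall>\<^sub>F d in G. \<forall>x. norm x \<le> 1 \<longrightarrow> norm ((\<Phi> d P - P) x) \<le> \<epsilon>"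
        using S2 uniform[OF P e] S_uniform[OF P e]
      proof eventually_elim
        case (elim d)
        show ?case
        proof (intro allI impI)
          fix x :: 'e assume x: "norm x \<le> 1"
          have "(\<Phi> d P - P) x = (S d (P x) - P x) - S d (P (x - K d x))"
            by (simp add: \<Phi>_def F.op_diff[OF SL])
          then have "norm ((\<Phi> d P - P) x) \<le> norm (S d (P x) - P x) + norm (S d (P (x - K d x)))"
            using norm_triangle_ineq4 by metis
          moreover have "norm (S d (P (x - K d x))) \<le> 2 * norm (P (x - K d x))" using elim(1) by blast
          moreover have "norm (P (x - K d x)) \<le> \<epsilon> / 3" "norm (S d (P x) - P x) \<le> \<epsilon> / 3"
            using elim x by auto
          ultimately show "norm ((\<Phi> d P - P) x) \<le> \<epsilon>" by simp
        qed
      qed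
    qed
    fix Q and \<epsilon> :: real assume Q: "Q \<in> ?X" and P1: "poly_norm P \<le> 1" and Q1: "poly_norm Q \<le> 1" and \<epsilon>: "0 < \<epsilon>"
    \<comment> \<open>The main term is at most
      \<open>(1 + \<delta>) * (1 + \<delta>) \<le> 1 + 3 * \<delta>\<close>, using
      \<open>\<delta> \<le> 1\<close>. Replacing \<open>P\<close> by
      \<open>S \<circ> P \<circ> K\<close> costs \<open>\<delta> + 2 * \<delta>\<close>, so the
      total error is \<open>6 * \<delta>\<close>.\<close>
    define \<delta> where "\<delta> = min 1 (\<epsilon> / 6)"
    have \<delta>: "0 < \<delta>" "\<delta> \<le> 1" "6 * \<delta> \<le> \<epsilon>" using \<epsilon> by (auto simp: \<delta>_def)
    show "\<forall>\<^sub>F d in G. poly_norm (P + (Q - \<Phi> d Q)) \<le> 1 + \<epsilon>"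
      using S2 uniform[OF P \<delta>(1)] S_uniform[OF P \<delta>(1)] S_norm[OF \<delta>(1)] K_norm[OF \<delta>(1)]
    proof eventually_elim
      case (elim d)
      show ?case
      proof (rule poly_norm_least)
        fix x :: 'e assume x: "norm x \<le> 1"
        have "norm (Q (x - K d x)) \<le> norm (x - K d x) ^ n"
          using norm_le_poly_norm[OF Q, of "x - K d x"] mult_right_mono[OF Q1, of "norm (x - K d x) ^ n"] by simp
        moreover have "norm (P (K d x)) \<le> norm (K d x) ^ n"
          using norm_le_poly_norm[OF JX[OF P], of "K d x"] mult_right_mono[OF P1, of "norm (K d x) ^ n"] by simp
        moreover have "norm (K d x) ^ n + norm (x - K d x) ^ n \<le> (1 + \<delta>) * norm x ^ n" using elim(5) by blast
        moreover have "(1 + \<delta>) * norm x ^ n \<le> 1 + \<delta>" using power_le_one[OF norm_ge_zero x, of n] \<delta> by simp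
        ultimately have z: "norm (Q (x - K d x) + P (K d x)) \<le> 1 + \<delta>"
          using norm_triangle_ineq[of "Q (x - K d x)" "P (K d x)"] by simp
        let ?z = "Q (x - K d x) + P (K d x)"
        have "norm (S d ?z + (Q x - S d (Q x))) \<le> (1 + \<delta>) * max (norm ?z) (norm (Q x))"
          using elim(4) by blast
        also have "\<dots> \<le> (1 + \<delta>) * (1 + \<delta>)"
          using z poly_norm_upper[OF Q x] Q1 \<delta> by (intro mult_left_mono) auto
        also have "\<dots> \<le> 1 + 3 * \<delta>" using \<delta> mult_left_mono[OF \<delta>(2), of \<delta>] by (simp add: algebra_simps)
        finally have main: "norm (S d ?z + (Q x - S d (Q x))) \<le> 1 + 3 * \<delta>" .
        have "norm (S d (P x - P (K d x))) \<le> 2 * norm (P x - P (K d x))" using elim(1) by blast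
        moreover have "norm (P x - P (K d x)) \<le> \<delta>" "norm (P x - S d (P x)) \<le> \<delta>"
          using elim(2,3) x by (auto simp: norm_minus_commute)
        moreover have "(P + (Q - \<Phi> d Q)) x
            = (S d ?z + (Q x - S d (Q x))) + ((P x - S d (P x)) + S d (P x - P (K d x)))"
          by (simp add: \<Phi>_def F.op_diff[OF SL] F.op_add[OF SL])
        then have "norm ((P + (Q - \<Phi> d Q)) x) \<le> norm (S d ?z + (Q x - S d (Q x)))
            + (norm (P x - S d (P x)) + norm (S d (P x - P (K d x))))"
          by (metis norm_triangle_mono norm_triangle_ineq order_refl)
        ultimately show "norm ((P + (Q - \<Phi> d Q)) x) \<le> 1 + \<epsilon>" using main \<delta> by linarith
      qed
    qed
  qed
qed

end

section \<open>Choice of the approximating operators from the hypotheses on the net and on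
  \<open>F\<close>\<close>

theorem proposition2p11:
  fixes sE :: "'k::real_or_complex \<Rightarrow> 'e::banach \<Rightarrow> 'e"
    and sF :: "'k \<Rightarrow> 'f::banach \<Rightarrow> 'f"
    and I :: "'i set" and le :: "'i \<Rightarrow> 'i \<Rightarrow> bool" and K :: "'i \<Rightarrow> 'e \<Rightarrow> 'e"
    and n :: nat
  assumes "normed_space_over sE" and "normed_space_over sF"
    and "M_infty_space sF"
    and "is_critical_degree sE n"
    and "directed_set I le"
    and "\<forall>\<alpha>\<in>I. K \<alpha> \<in> compact_ops sE"
    and "\<exists>C. \<forall>\<alpha>\<in>I. op_norm norm (K \<alpha>) \<le> C"
    and "\<forall>\<phi> \<in> dual_space sE norm UNIV.
           ((\<lambda>\<alpha>. dual_norm norm UNIV ((\<phi> \<circ> K \<alpha>) - \<phi>)) \<longlongrightarrow> 0) (net_filter I le)"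
    and "\<forall>\<epsilon>>0. \<forall>\<alpha>\<^sub>0\<in>I. \<exists>\<alpha>\<in>I. le \<alpha>\<^sub>0 \<alpha> \<and> \<alpha> \<noteq> \<alpha>\<^sub>0 \<and>
           (\<forall>x. norm (K \<alpha> x) ^ n + norm (x - K \<alpha> x) ^ n \<le> (1 + \<epsilon>) * norm x ^ n)"
  shows "M_ideal (fun_scale sF) poly_norm (weak_hom_polys sE sF n) (hom_polys sE sF n)"
proof -
  interpret poly_spaces sE sF using assms(1,2) by (simp add: poly_spaces_def)
  note dir = assms(5)
  \<comment> \<open>For each index \<open>i\<close> and precision \<open>1 / Suc m\<close> an
    operator of the net beyond \<open>i\<close> is selected. For \<open>i\<close> outside
    \<open>I\<close> some compact operator serves as default value, so that \<open>T\<close> is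
    total.\<close>
  have "\<exists>T\<in>compact_ops sE. i \<in> I \<longrightarrow> (\<exists>\<alpha>\<in>I. T = K \<alpha> \<and> le i \<alpha> \<and>
      (\<forall>x. norm (K \<alpha> x) ^ n + norm (x - K \<alpha> x) ^ n \<le> (1 + 1 / Suc m) * norm x ^ n))" for i and m :: nat
  proof (cases "i \<in> I")
    case True
    then obtain \<alpha> where "\<alpha> \<in> I" "le i \<alpha>"
      "\<forall>x. norm (K \<alpha> x) ^ n + norm (x - K \<alpha> x) ^ n \<le> (1 + 1 / Suc m) * norm x ^ n"
      using assms(9)[rule_format, of "1 / Suc m" i] by auto
    then show ?thesis using assms(6) by (intro bexI[of _ "K \<alpha>"]) auto
  next
    case False
    have "I \<noteq> {}" using dir by (simp add: directed_set_def)
    then show ?thesis using False assms(6) by blast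
  qed
  then obtain T where T: "\<And>i m. T i m \<in> compact_ops sE"
    and TK: "\<And>i m. i \<in> I \<Longrightarrow> \<exists>\<alpha>\<in>I. T i m = K \<alpha> \<and> le i \<alpha> \<and>
      (\<forall>x. norm (K \<alpha> x) ^ n + norm (x - K \<alpha> x) ^ n \<le> (1 + 1 / Suc m) * norm x ^ n)"
    by metis
  have "\<exists>R\<in>compact_ops sF. finite C \<longrightarrow>
      (\<forall>x y. norm (R x + (y - R y)) \<le> (1 + 1 / Suc m) * max (norm x) (norm y)) \<and>
      (\<forall>c\<in>C. norm (R c - c) \<le> 1 / Suc m)" for C :: "'f set" and m :: nat
  proof (cases "finite C")
    case True
    then show ?thesis
      using M_infty_space_compact_combination[OF assms(2,3) True, of "1 / Suc m"] by auto
  next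
    \<comment> \<open>For infinite \<open>C\<close> nothing is required, and the operator obtained
      for the empty set serves as default value.\<close>
    case False
    then show ?thesis
      using M_infty_space_compact_combination[OF assms(2,3), of "{}" 1] by auto
  qed
  then obtain R where R: "\<And>C m. R C m \<in> compact_ops sF"
    and R_norm: "\<And>C m x y. finite C \<Longrightarrow> norm (R C m x + (y - R C m y)) \<le> (1 + 1 / Suc m) * max (norm x) (norm y)"
    and R_id: "\<And>C m c. finite C \<Longrightarrow> c \<in> C \<Longrightarrow> norm (R C m c - c) \<le> 1 / Suc m"
    by metis
  \<comment> \<open>An index is a triple \<open>(i, (m, C))\<close>. The product filter lets
    \<open>i\<close> run along the net while \<open>m\<close> grows and the finite set
    \<open>C\<close> exhausts \<open>F\<close>, so both conditions on \<open>K\<close> and both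
    conditions on \<open>S\<close> hold eventually.\<close>
  define G where "G = net_filter I le \<times>\<^sub>F ((sequentially :: nat filter) \<times>\<^sub>F finite_subsets_at_top (UNIV :: 'f set))"
  have netI: "\<forall>\<^sub>F i in net_filter I le. i \<in> I"
    using dir by (auto simp: eventually_net_filter[OF dir] directed_set_def)
  have G1: "\<forall>\<^sub>F d in G. Q (fst d)" if "eventually Q (net_filter I le)" for Q
    unfolding G_def using that by (rule eventually_compose_filterlim[OF _ filterlim_fst])
  have G2: "\<forall>\<^sub>F d in G. Q (fst (snd d))" if "eventually Q sequentially" for Q
    unfolding G_def using that
    by (rule eventually_compose_filterlim[OF _ filterlim_compose[OF filterlim_fst filterlim_snd]])
  have G3: "\<forall>\<^sub>F d in G. Q (snd (snd d))" if "eventually Q (finite_subsets_at_top UNIV)" for Q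
    unfolding G_def using that
    by (rule eventually_compose_filterlim[OF _ filterlim_compose[OF filterlim_snd filterlim_snd]])
  have small: "\<forall>\<^sub>F d in G. 1 / real (Suc (fst (snd d))) \<le> \<epsilon>" if "0 < \<epsilon>" for \<epsilon>
  proof -
    have "(\<lambda>m. 1 / real (Suc m)) \<longlonglongrightarrow> 0" using LIMSEQ_inverse_real_of_nat by (simp add: inverse_eq_divide)
    from order_tendstoD(2)[OF this that] have "\<forall>\<^sub>F m in sequentially. 1 / real (Suc m) \<le> \<epsilon>"
      by (rule eventually_mono) simp
    then show ?thesis by (rule G2)
  qed
  have fin: "\<forall>\<^sub>F d in G. finite (snd (snd d))" and mem: "\<forall>\<^sub>F d in G. c \<in> snd (snd d)" for c
    by (rule G3, force simp: eventually_finite_subsets_at_top)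
      (rule G3, auto simp: eventually_finite_subsets_at_top intro!: exI[of _ "{c}"])
  show ?thesis
  proof (rule M_ideal_weak_hom_polys[where G = G and K = "\<lambda>d. T (fst d) (fst (snd d))"
        and S = "\<lambda>d. R (snd (snd d)) (fst (snd d))"])
    show "1 \<le> n" and "\<And>k. 1 \<le> k \<Longrightarrow> k < n \<Longrightarrow> weak_hom_polys sE (*) k = hom_polys sE (*) k"
      using assms(4) by (auto simp: is_critical_degree_def)
    have "net_filter I le \<noteq> bot"
      using dir by (auto simp: trivial_limit_def eventually_net_filter[OF dir] directed_set_def reflp_on_def)
    then show "G \<noteq> bot" by (simp add: G_def prod_filter_eq_bot)
    show "T (fst d) (fst (snd d)) \<in> compact_ops sE" for d by (rule T)
    show "R (snd (snd d)) (fst (snd d)) \<in> compact_ops sF" for d by (rule R)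
  next
    fix \<phi> and \<epsilon> :: real assume \<phi>: "E.functional \<phi>" and \<epsilon>: "0 < \<epsilon>"
    then have "((\<lambda>\<alpha>. dual_norm norm UNIV ((\<phi> \<circ> K \<alpha>) - \<phi>)) \<longlongrightarrow> 0) (net_filter I le)"
      using assms(8) by (simp add: E.dual_space_UNIV_iff)
    then have "\<forall>\<^sub>F \<alpha> in net_filter I le. dual_norm norm UNIV ((\<phi> \<circ> K \<alpha>) - \<phi>) < \<epsilon>"
      using \<epsilon> by (rule order_tendstoD(2))
    then obtain i0 where i0: "i0 \<in> I" "\<And>\<alpha>. \<alpha> \<in> I \<Longrightarrow> le i0 \<alpha> \<Longrightarrow> dual_norm norm UNIV ((\<phi> \<circ> K \<alpha>) - \<phi>) < \<epsilon>"
      by (auto simp: eventually_net_filter[OF dir])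
    have "\<forall>\<^sub>F i in net_filter I le. i \<in> I \<and> le i0 i"
      using i0(1) by (auto simp: eventually_net_filter[OF dir])
    from G1[OF this] show "\<forall>\<^sub>F d in G. \<forall>x. norm (\<phi> (T (fst d) (fst (snd d)) x - x)) \<le> \<epsilon> * norm x"
    proof eventually_elim
      case (elim d)
      then obtain \<alpha> where \<alpha>: "\<alpha> \<in> I" "T (fst d) (fst (snd d)) = K \<alpha>" "le (fst d) \<alpha>" using TK by blast
      have "transp_on I le" using dir by (simp add: directed_set_def)
      \<comment> \<open>The selected operator is \<open>K \<alpha>\<close> with
        \<open>\<alpha>\<close> beyond \<open>fst d\<close>, which is itself beyond
        \<open>i0\<close>; hence the smallness of the adjoint difference past \<open>i0\<close>
        survives the selection.\<close>
      then have "le i0 \<alpha>" using elim \<alpha> i0(1) by (auto dest: transp_onD)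
      then have lt: "dual_norm norm UNIV ((\<phi> \<circ> K \<alpha>) - \<phi>) < \<epsilon>" using i0(2) \<alpha>(1) by blast
      have KL: "K \<alpha> \<in> bounded_ops sE" using assms(6) \<alpha>(1) E.compact_ops_bounded by blast
      obtain B where B: "\<And>x. norm (K \<alpha> x) \<le> B * norm x" using E.op_boundE[OF KL] by metis
      obtain c where c: "0 \<le> c" "\<And>x. norm (\<phi> x) \<le> c * norm x" using E.functional_boundE[OF \<phi>] by auto
      have f: "E.functional (\<phi> \<circ> K \<alpha>)"
      proof (rule E.functionalI)
        show "norm ((\<phi> \<circ> K \<alpha>) x) \<le> (c * B) * norm x" for x
          using order_trans[OF c(2) mult_left_mono[OF B c(1)]] by (simp add: mult.assoc)
      qed (simp_all add: E.op_add[OF KL] E.op_scale[OF KL] E.functional_add[OF \<phi>] E.functional_scale[OF \<phi>])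
      show ?case
      proof
        fix x :: 'e
        have "norm (((\<phi> \<circ> K \<alpha>) - \<phi>) x) \<le> dual_norm norm UNIV ((\<phi> \<circ> K \<alpha>) - \<phi>) * norm x"
          by (intro E.norm_le_dual_norm E.functional_minus f \<phi>) simp
        also have "\<dots> \<le> \<epsilon> * norm x" using lt by (intro mult_right_mono) auto
        finally show "norm (\<phi> (T (fst d) (fst (snd d)) x - x)) \<le> \<epsilon> * norm x"
          by (simp add: \<alpha>(2) E.functional_diff[OF \<phi>])
      qed
    qed
  next
    fix \<epsilon> :: real assume \<epsilon>: "0 < \<epsilon>"
    show "\<forall>\<^sub>F d in G. \<forall>x. norm (T (fst d) (fst (snd d)) x) ^ n + norm (x - T (fst d) (fst (snd d)) x) ^ n
        \<le> (1 + \<epsilon>) * norm x ^ n"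
      using G1[OF netI] small[OF \<epsilon>]
    proof eventually_elim
      case (elim d)
      then obtain \<alpha> where \<alpha>: "T (fst d) (fst (snd d)) = K \<alpha>"
        "\<And>x. norm (K \<alpha> x) ^ n + norm (x - K \<alpha> x) ^ n \<le> (1 + 1 / Suc (fst (snd d))) * norm x ^ n"
        using TK[of "fst d" "fst (snd d)"] by blast
      show ?case
      proof
        fix x :: 'e
        have "(1 + 1 / Suc (fst (snd d))) * norm x ^ n \<le> (1 + \<epsilon>) * norm x ^ n"
          using elim(2) by (intro mult_right_mono) auto
        then show "norm (T (fst d) (fst (snd d)) x) ^ n + norm (x - T (fst d) (fst (snd d)) x) ^ n
            \<le> (1 + \<epsilon>) * norm x ^ n"
          using \<alpha>(2)[of x] unfolding \<alpha>(1) by linarith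
      qed
    qed
    show "\<forall>\<^sub>F d in G. \<forall>x y. norm (R (snd (snd d)) (fst (snd d)) x + (y - R (snd (snd d)) (fst (snd d)) y))
        \<le> (1 + \<epsilon>) * max (norm x) (norm y)"
      using fin small[OF \<epsilon>]
    proof eventually_elim
      case (elim d)
      show ?case
      proof (intro allI)
        fix x y :: 'f
        have "(1 + 1 / Suc (fst (snd d))) * max (norm x) (norm y) \<le> (1 + \<epsilon>) * max (norm x) (norm y)"
          using elim(2) by (intro mult_right_mono) (auto simp: le_max_iff_disj)
        then show "norm (R (snd (snd d)) (fst (snd d)) x + (y - R (snd (snd d)) (fst (snd d)) y))
            \<le> (1 + \<epsilon>) * max (norm x) (norm y)"
          using R_norm[OF elim(1), of "fst (snd d)" x y] by linarith
      qed
    qed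
    show "\<forall>\<^sub>F d in G. norm (R (snd (snd d)) (fst (snd d)) c - c) \<le> \<epsilon>" for c
      using fin mem[of c] small[OF \<epsilon>]
      by eventually_elim (meson R_id order_trans)
  qed
qed

end
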